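(* Let $n\ge1$, $a<b$, and let $\gamma:[a,b]\to\mathbb{R}^{n+1}$, $\gamma\in C^1([a,b])\cap C^{n+1}((a,b))$, be a curve with totally positive torsion. If $n=2\ell$ then $$\mathrm{Area}(\partial\,\mathrm{conv}(\gamma([a,b])))=\frac{1}{n!}\int_{a\le x_1\le\dots\le x_\ell\le b}\left(\sqrt{\det S_a^{\mathrm{Tr}}S_a}+\sqrt{\det S_b^{\mathrm{Tr}}S_b}\right)dx,$$ where $S_r=(\gamma(x_1)-\gamma(r),\dots,\gamma(x_\ell)-\gamma(r),\gamma'(x_1),\dots,\gamma'(x_\ell))$ is a $(2\ell+1)\times2\ell$ matrix and $dx$ is $\ell$-dimensional Lebesgue measure. If $n=2\ell-1$ then $$\mathrm{Area}(\partial\,\mathrm{conv}(\gamma([a,b])))=\frac{1}{n!}\int_{a\le x_2\le\dots\le x_\ell\le b}\sqrt{\det\Psi^{\mathrm{Tr}}\Psi}\,d\tilde{x}+\frac{1}{n!}\int_{a\le x_1\le\dots\le x_\ell\le b}\sqrt{\det\Phi^{\mathrm{Tr}}\Phi}\,dx,$$ where $\Psi=(\gamma(b)-\gamma(a),\gamma(x_2)-\gamma(a),\dots,\gamma(x_\ell)-\gamma(a),\gamma'(x_2),\dots,\gamma'(x_\ell))$ and $\Phi=(\gamma(x_2)-\gamma(x_1),\dots,\gamma(x_\ell)-\gamma(x_1),\gamma'(x_1),\dots,\gamma'(x_\ell))$ are $2\ell\times(2\ell-1)$ matrices, $dx$ is $\ell$-dimensional and $d\tilde{x}$ is $(\ell-1)$-dimensional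 Lebesgue measure.
   Context: A curve $\gamma\in C([a,b],\mathbb{R}^{n+1})\cap C^{n+1}((a,b),\mathbb{R}^{n+1})$ has totally positive torsion if for every $t\in(a,b)$ all leading principal minors of the $(n+1)\times(n+1)$ matrix with columns $(\gamma'(t),\gamma''(t),\dots,\gamma^{(n+1)}(t))$ are positive. $\mathrm{conv}$ is convex hull, $\partial$ is topological boundary in $\mathbb{R}^{n+1}$, $\mathrm{Area}$ is $n$-dimensional Lebesgue (surface) measure in $\mathbb{R}^{n+1}$ (i.e. $n$-dimensional Hausdorff measure normalized to agree with Lebesgue measure on $n$-planes), and $A^{\mathrm{Tr}}$ is the transpose of $A$. Vectors listed in a matrix are its columns. When $\ell=1$ and $n=1$, the integral over the empty set of variables $x_2,\dots,x_\ell$ is understood as the value of the integrand. *)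

theory Defs
  imports
    "HOL-Analysis.Analysis"
    "Jordan_Normal_Form.Determinant"
    "Jordan_Normal_Form.DL_Submatrix"
begin

text \<open>
  Points live in \<open>real ^ 'm\<close>; the linear order on the index type \<open>'m\<close> fixes the
  enumeration of the coordinates on which leading principal minors depend.
  Coordinates are counted from 0.
\<close>

definition nth_index :: "nat \<Rightarrow> 'm::{finite,linorder}" where
  "nth_index i = sorted_list_of_set UNIV ! i"

definition coord_vec :: "real ^ 'm::{finite,linorder} \<Rightarrow> real Matrix.vec" where
  "coord_vec v = Matrix.vec CARD('m) (\<lambda>i. vec_nth v (nth_index i))"

definition columns :: "(real ^ 'm::{finite,linorder}) list \<Rightarrow> real Matrix.mat" where
  "columns vs = mat_of_cols CARD('m) (map coord_vec vs)"

text \<open>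
  Derivatives are taken within \<open>S\<close>: one-sided at the endpoints of a closed interval, ordinary
  ones if \<open>S\<close> is open. Only the values of \<open>f\<close> on \<open>S\<close> matter at points of \<open>S\<close>.
\<close>

fun iter_deriv :: "real set \<Rightarrow> nat \<Rightarrow> (real \<Rightarrow> 'a::real_normed_vector) \<Rightarrow> real \<Rightarrow> 'a" where
  "iter_deriv S 0 f = f"
| "iter_deriv S (Suc k) f = (\<lambda>t. vector_derivative (iter_deriv S k f) (at t within S))"

definition C_k_on :: "nat \<Rightarrow> (real \<Rightarrow> 'a::real_normed_vector) \<Rightarrow> real set \<Rightarrow> bool" where
  "C_k_on k f S \<longleftrightarrow>
     (\<forall>j<k. \<forall>t\<in>S. iter_deriv S j f differentiable (at t within S)) \<and>
     (\<forall>j\<le>k. continuous_on S (iter_deriv S j f))"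

definition torsion_matrix ::
  "(real \<Rightarrow> real ^ 'm::{finite,linorder}) \<Rightarrow> real \<Rightarrow> real \<Rightarrow> real \<Rightarrow> real Matrix.mat" where
  "torsion_matrix \<gamma> a b t = columns (map (\<lambda>j. iter_deriv {a<..<b} j \<gamma> t) [1..<CARD('m) + 1])"

definition totally_positive_torsion ::
  "(real \<Rightarrow> real ^ 'm::{finite,linorder}) \<Rightarrow> real \<Rightarrow> real \<Rightarrow> bool" where
  "totally_positive_torsion \<gamma> a b \<longleftrightarrow>
     C_k_on 0 \<gamma> {a..b} \<and> C_k_on CARD('m) \<gamma> {a<..<b} \<and>
     (\<forall>t\<in>{a<..<b}. \<forall>k\<in>{1..CARD('m)}.
        Determinant.det (submatrix (torsion_matrix \<gamma> a b t) {..<k} {..<k}) > 0)"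

text \<open>
  Unnormalized Hausdorff measure of dimension \<open>n\<close>. Since \<open>diameter\<close> is unspecified on unbounded
  sets, covers consist of bounded sets. Intended for \<open>n \<ge> 1\<close> (for \<open>n = 0\<close> the convention
  \<open>0 ^ 0 = 1\<close> would count empty covering sets).
\<close>

definition hausdorff_premeasure :: "nat \<Rightarrow> real \<Rightarrow> 'a::metric_space set \<Rightarrow> ennreal" where
  "hausdorff_premeasure n \<delta> A =
     (INF U \<in> {U :: nat \<Rightarrow> 'a set.
                 A \<subseteq> (\<Union>i. U i) \<and> (\<forall>i. bounded (U i) \<and> diameter (U i) \<le> \<delta>)}.
        \<Sum>i. ennreal (diameter (U i) ^ n))"

definition hausdorff_measure :: "nat \<Rightarrow> 'a::metric_space set \<Rightarrow> ennreal" where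
  "hausdorff_measure n A = (SUP \<delta>\<in>{0<..}. hausdorff_premeasure n \<delta> A)"

definition unit_cube :: "nat \<Rightarrow> (real ^ 'm::{finite,linorder}) set" where
  "unit_cube n = {x. \<forall>i<CARD('m). vec_nth x (nth_index i) \<in> (if i < n then {0..1} else {0})}"

text \<open>
  The normalization making \<open>n\<close>-dimensional Hausdorff measure agree with Lebesgue measure on
  \<open>n\<close>-planes: on an \<open>n\<close>-plane the unnormalized measure is translation invariant, hence a multiple
  of Lebesgue measure, and the factor is its value (in \<open>(0, \<infinity>)\<close>) on a unit \<open>n\<close>-cube.
\<close>

definition area :: "nat \<Rightarrow> (real ^ 'm::{finite,linorder}) set \<Rightarrow> ennreal" where
  "area n A = hausdorff_measure n A / hausdorff_measure n (unit_cube n :: (real ^ 'm::{finite,linorder}) set)"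

text \<open>
  \<open>I\<close>-dimensional Lebesgue measure; for \<open>I = {}\<close> it is a unit point mass, so that an integral
  over no variables is the value of the integrand.
\<close>

definition lebesgue_on_vars :: "nat set \<Rightarrow> (nat \<Rightarrow> real) measure" where
  "lebesgue_on_vars I = PiM I (\<lambda>_. lborel)"

definition ordered_points :: "nat set \<Rightarrow> real \<Rightarrow> real \<Rightarrow> (nat \<Rightarrow> real) set" where
  "ordered_points I a b = {x. (\<forall>i\<in>I. a \<le> x i \<and> x i \<le> b) \<and> mono_on I x}"

definition gram_sqrt :: "real Matrix.mat \<Rightarrow> real" where
  "gram_sqrt A = sqrt (Determinant.det (transpose_mat A * A))"

definition curve_deriv :: "real \<Rightarrow> real \<Rightarrow> (real \<Rightarrow> 'a::real_normed_vector) \<Rightarrow> real \<Rightarrow> 'a" where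
  "curve_deriv a b \<gamma> = iter_deriv {a..b} 1 \<gamma>"

definition S_mat ::
  "(real \<Rightarrow> real ^ 'm::{finite,linorder}) \<Rightarrow> real \<Rightarrow> real \<Rightarrow> nat \<Rightarrow> real \<Rightarrow> (nat \<Rightarrow> real)
     \<Rightarrow> real Matrix.mat" where
  "S_mat \<gamma> a b l r x =
     columns (map (\<lambda>i. \<gamma> (x i) - \<gamma> r) [1..<l+1] @
              map (\<lambda>i. curve_deriv a b \<gamma> (x i)) [1..<l+1])"

definition Psi_mat ::
  "(real \<Rightarrow> real ^ 'm::{finite,linorder}) \<Rightarrow> real \<Rightarrow> real \<Rightarrow> nat \<Rightarrow> (nat \<Rightarrow> real)
     \<Rightarrow> real Matrix.mat" where
  "Psi_mat \<gamma> a b l x =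
     columns ([\<gamma> b - \<gamma> a] @ map (\<lambda>i. \<gamma> (x i) - \<gamma> a) [2..<l+1] @
              map (\<lambda>i. curve_deriv a b \<gamma> (x i)) [2..<l+1])"

definition Phi_mat ::
  "(real \<Rightarrow> real ^ 'm::{finite,linorder}) \<Rightarrow> real \<Rightarrow> real \<Rightarrow> nat \<Rightarrow> (nat \<Rightarrow> real)
     \<Rightarrow> real Matrix.mat" where
  "Phi_mat \<gamma> a b l x =
     columns (map (\<lambda>i. \<gamma> (x i) - \<gamma> (x 1)) [2..<l+1] @
              map (\<lambda>i. curve_deriv a b \<gamma> (x i)) [1..<l+1])"

end

theory Submission
  imports Defs
begin

text \<open>
  Let \<open>N = n + 1\<close> be the dimension and \<open>K\<close> the convex hull of the curve. The frontier of \<open>K\<close> consists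
  of two sheets. Each sheet is a union of simplices with vertices on the curve, and the integrals in
  the theorem are the areas of the sheets.

  Zero counting. All that is needed about \<open>K\<close> follows from one property of the curve: a function
  \<open>t \<mapsto> c0 + c \<bullet> \<gamma> t\<close> with \<open>(c0, c) \<noteq> 0\<close> has at most \<open>N\<close> zeros in \<open>[a, b]\<close>, even if zeros in the open
  interval at which the derivative vanishes too are counted twice (\<open>zero_count\<close>). Rolle's theorem
  reduces this to combinations of the coordinates of \<open>\<gamma>'\<close>. For these, torsion enters as the
  non-vanishing of Wronskians: divide by the first function and differentiate; one function
  disappears and the Wronskians of the rest still do not vanish (\<open>zero_count_nonvanishing\<close>). If the
  bound \<open>N\<close> is attained with all interior zeros double, the function has constant sign
  (\<open>no_sign_change\<close>). Dually, points and tangents of the curve are independent as long as there are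
  at most \<open>N + 1\<close> of them (\<open>independent_points_and_tangents\<close>).

  The frontier. A functional supporting \<open>K\<close> at \<open>p\<close> is nonnegative on the curve, so its zeros in the
  open interval are double, and \<open>p\<close> is a convex combination of curve points whose number, interior
  points counted twice, is at most \<open>N\<close> (\<open>frontier_point_supported\<close>). Conversely, a set of curve points
  whose count is exactly \<open>N\<close> is annihilated by a functional of constant sign, so its convex
  combinations lie on the frontier (\<open>touching_point_in_frontier\<close>). There are two maximal types of such
  sets: for \<open>n = 2 l\<close>, \<open>l\<close> interior points together with \<open>a\<close>, or with \<open>b\<close>; for \<open>n = 2 l - 1\<close>, \<open>l - 1\<close>
  interior points together with both ends, or \<open>l\<close> interior points. These are the two sheets.
  Independence of \<open>N + 1\<close> points shows that each sheet is parametrized injectively by weights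
  and interior points, and that the sheets meet only in degenerate simplices.

  Area. The parametrizations are injective immersions of an open subset of \<open>n\<close>-space, and the area
  formula for Hausdorff measure (\<open>area_formula\<close>) turns their areas into integrals of
  Jacobians. The unknown value of Hausdorff measure on the unit cube cancels against the
  normalization in \<open>area\<close>. The Jacobian is the product of the weights of the interior points and a
  Gram determinant which depends on the points only; by a Dirichlet integral
  (\<open>dirichlet_integral_barycentric\<close>) the weights integrate to \<open>1 / n!\<close> for each of the types.
\<close>

no_notation vec_index (infixl \<open>$\<close> 100)
no_notation scalar_prod (infix \<open>\<bullet>\<close> 70)

section \<open>Zeros of combinations of functions with non-vanishing Wronskians\<close>

fun n_diff :: "real set \<Rightarrow> nat \<Rightarrow> (real \<Rightarrow> real) \<Rightarrow> bool" where
  "n_diff I 0 f \<longleftrightarrow> True"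
| "n_diff I (Suc k) f \<longleftrightarrow> (\<forall>t\<in>I. f differentiable (at t)) \<and> n_diff I k (deriv f)"

text \<open>
  A Wronskian of \<open>k\<close> functions is nonzero at \<open>t\<close> iff no nontrivial combination of them vanishes to
  order \<open>k\<close> at \<open>t\<close>; in this form the condition passes to quotients and derivatives without any
  computation with determinants.
\<close>

fun vanishes :: "nat \<Rightarrow> (real \<Rightarrow> real) \<Rightarrow> real \<Rightarrow> bool" where
  "vanishes 0 f t \<longleftrightarrow> True"
| "vanishes (Suc k) f t \<longleftrightarrow> f t = 0 \<and> vanishes k (deriv f) t"

lemma has_deriv_transform:
  fixes f g :: "real \<Rightarrow> real"
  assumes "open I" "t \<in> I" "\<And>s. s \<in> I \<Longrightarrow> f s = g s" "(f has_real_derivative D) (at t)"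
  shows "(g has_real_derivative D) (at t)"
  using assms has_field_derivative_transform_within_open by blast

lemma deriv_cong_open:
  fixes f g :: "real \<Rightarrow> real"
  assumes "open I" "t \<in> I" "\<And>s. s \<in> I \<Longrightarrow> f s = g s"
  shows "deriv f t = deriv g t"
  by (rule deriv_cong_ev) (use assms eventually_nhds in blast)+

lemma differentiable_cong_open:
  fixes f g :: "real \<Rightarrow> real"
  assumes "open I" "t \<in> I" "\<And>s. s \<in> I \<Longrightarrow> f s = g s" "f differentiable (at t)"
  shows "g differentiable (at t)"
  using assms has_deriv_transform[OF assms(1-3)] by (meson real_differentiable_def)

lemma n_diff_cong:
  assumes "open I" "\<And>s. s \<in> I \<Longrightarrow> f s = g s" "n_diff I k f"
  shows "n_diff I k g"
  using assms
proof (induction k arbitrary: f g)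
  case (Suc k)
  have "n_diff I k (deriv g)"
    using Suc.IH[of "deriv f" "deriv g"] Suc.prems deriv_cong_open[OF \<open>open I\<close>, of _ f g] by auto
  moreover have "g differentiable at t" if "t \<in> I" for t
    using differentiable_cong_open[OF \<open>open I\<close> that, of f g] Suc.prems that by auto
  ultimately show ?case by simp
qed auto

lemma vanishes_cong:
  assumes "open I" "\<And>s. s \<in> I \<Longrightarrow> f s = g s" "t \<in> I" "vanishes k f t"
  shows "vanishes k g t"
  using assms
proof (induction k arbitrary: f g)
  case (Suc k)
  have "vanishes k (deriv g) t"
    using Suc.IH[of "deriv f" "deriv g"] Suc.prems deriv_cong_open[OF \<open>open I\<close>, of _ f g] by auto
  then show ?case using Suc.prems by auto
qed auto

lemma has_deriv_deriv:
  fixes f :: "real \<Rightarrow> real"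
  shows "f differentiable (at t) \<Longrightarrow> (f has_real_derivative deriv f t) (at t)"
  by (simp add: DERIV_deriv_iff_real_differentiable)

lemma n_diff_mono: "n_diff I k f \<Longrightarrow> j \<le> k \<Longrightarrow> n_diff I j f"
proof (induction j arbitrary: k f)
  case (Suc j)
  then show ?case by (cases k) auto
qed auto

lemma deriv_add_open:
  fixes f g :: "real \<Rightarrow> real"
  assumes "f differentiable (at t)" "g differentiable (at t)"
  shows "deriv (\<lambda>s. f s + g s) t = deriv f t + deriv g t"
  by (rule DERIV_imp_deriv) (intro DERIV_add has_deriv_deriv assms)

lemma deriv_mult_open:
  fixes f g :: "real \<Rightarrow> real"
  assumes "f differentiable (at t)" "g differentiable (at t)"
  shows "deriv (\<lambda>s. f s * g s) t = deriv f t * g t + f t * deriv g t"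
  by (rule DERIV_imp_deriv)
     (use DERIV_mult[OF has_deriv_deriv[OF assms(1)] has_deriv_deriv[OF assms(2)]] in
       \<open>simp add: mult.commute\<close>)

lemma n_diff_const: "n_diff I k (\<lambda>_. c)"
  by (induction k arbitrary: c) auto

lemma n_diff_add:
  assumes "open I" "n_diff I k f" "n_diff I k g"
  shows "n_diff I k (\<lambda>s. f s + g s)"
  using assms
proof (induction k arbitrary: f g)
  case (Suc k)
  have "n_diff I k (\<lambda>s. deriv f s + deriv g s)"
    using Suc by auto
  then have "n_diff I k (deriv (\<lambda>s. f s + g s))"
    by (rule n_diff_cong[OF \<open>open I\<close>, rotated]) (use Suc.prems deriv_add_open in auto)
  then show ?case using Suc.prems by auto
qed auto

lemma n_diff_mult:
  assumes "open I" "n_diff I k f" "n_diff I k g"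
  shows "n_diff I k (\<lambda>s. f s * g s)"
  using assms
proof (induction k arbitrary: f g)
  case (Suc k)
  have "n_diff I k f" "n_diff I k g" using Suc.prems n_diff_mono[of I "Suc k" _ k] by auto
  then have "n_diff I k (\<lambda>s. deriv f s * g s + f s * deriv g s)"
    using Suc by (intro n_diff_add Suc.IH) auto
  then have "n_diff I k (deriv (\<lambda>s. f s * g s))"
    by (rule n_diff_cong[OF \<open>open I\<close>, rotated]) (use Suc.prems deriv_mult_open in auto)
  then show ?case using Suc.prems by auto
qed auto

lemma n_diff_sum:
  assumes "open I" "\<And>j. j \<in> A \<Longrightarrow> n_diff I k (f j)"
  shows "n_diff I k (\<lambda>s. \<Sum>j\<in>A. f j s)"
  using assms(2)
proof (induction A rule: infinite_finite_induct)
  case (insert x A)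
  then show ?case using n_diff_add[OF assms(1), of k "f x" "\<lambda>s. \<Sum>j\<in>A. f j s"] by auto
qed (auto simp: n_diff_const)

lemma n_diff_inverse:
  assumes "open I" "n_diff I k f" "\<And>t. t \<in> I \<Longrightarrow> f t \<noteq> 0"
  shows "n_diff I k (\<lambda>s. inverse (f s))"
  using assms(2)
proof (induction k)
  case (Suc k)
  have d: "((\<lambda>s. inverse (f s)) has_real_derivative - (inverse (f t) * deriv f t * inverse (f t))) (at t)"
    if "t \<in> I" for t
    using DERIV_inverse'[OF has_deriv_deriv] Suc.prems that assms(3) by auto
  have "n_diff I k f" using Suc.prems n_diff_mono[of I "Suc k" _ k] by auto
  with Suc have i: "n_diff I k (\<lambda>s. inverse (f s))" by auto
  have "n_diff I k (\<lambda>s. (-1) * (inverse (f s) * deriv f s * inverse (f s)))"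
    using Suc.prems i by (intro n_diff_mult[OF assms(1)] n_diff_const) auto
  then have "n_diff I k (deriv (\<lambda>s. inverse (f s)))"
    by (rule n_diff_cong[OF \<open>open I\<close>, rotated]) (use DERIV_imp_deriv[OF d] in auto)
  then show ?case using d by (auto simp: real_differentiable_def)
qed auto

lemma vanishes_mono: "vanishes k f t \<Longrightarrow> j \<le> k \<Longrightarrow> vanishes j f t"
proof (induction j arbitrary: k f)
  case (Suc j)
  then show ?case by (cases k) auto
qed auto

lemma vanishes_add:
  assumes "open I" "t \<in> I" "n_diff I (k - 1) f" "n_diff I (k - 1) g" "vanishes k f t" "vanishes k g t"
  shows "vanishes k (\<lambda>s. f s + g s) t"
  using assms(3-)
proof (induction k arbitrary: f g)
  case (Suc k)
  show ?case
  proof (cases k)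
    case (Suc k')
    have "vanishes k (\<lambda>s. deriv f s + deriv g s) t"
      using Suc.IH Suc Suc.prems by auto
    then have "vanishes k (deriv (\<lambda>s. f s + g s)) t"
      by (rule vanishes_cong[OF \<open>open I\<close>, rotated 2])
         (use Suc Suc.prems deriv_add_open \<open>t \<in> I\<close> in auto)
    then show ?thesis using Suc.prems by auto
  qed (use Suc.prems in auto)
qed auto

text \<open>
  By the product rule, \<open>(f g)' = f' g + f g'\<close> is a sum of two products whose second factors, \<open>g\<close> and
  \<open>g'\<close>, vanish to order \<open>k - 1\<close>.
\<close>

lemma vanishes_mult:
  assumes "open I" "t \<in> I" "n_diff I (k - 1) f" "n_diff I (k - 1) g" "vanishes k g t"
  shows "vanishes k (\<lambda>s. f s * g s) t"
  using assms(3-)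
proof (induction k arbitrary: f g)
  case (Suc k)
  show ?case
  proof (cases k)
    case (Suc k')
    have v: "vanishes k g t" using Suc.prems(3) vanishes_mono[of "Suc k" g t k] by auto
    have n: "n_diff I (k - 1) f" "n_diff I (k - 1) g" 
      using Suc.prems n_diff_mono[of I k _ "k - 1"] by auto
    have "vanishes k (\<lambda>s. deriv f s * g s + f s * deriv g s) t"
      using Suc.IH Suc Suc.prems v n
      by (intro vanishes_add[OF assms(1,2)] n_diff_mult[OF assms(1)]) auto
    then have "vanishes k (deriv (\<lambda>s. f s * g s)) t"
      by (rule vanishes_cong[OF \<open>open I\<close>, rotated 2])
         (use Suc Suc.prems deriv_mult_open \<open>t \<in> I\<close> in auto)
    then show ?thesis using Suc.prems by auto
  qed (use Suc.prems in auto)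
qed auto

text \<open>
  The zeros of \<open>g'\<close> between consecutive zeros of \<open>g\<close> avoid \<open>Z\<close>; so they can be added to the zeros of
  \<open>g\<close> that are double.
\<close>

lemma Rolle_count:
  fixes g g' :: "real \<Rightarrow> real"
  assumes I: "is_interval I" and cont: "continuous_on I g"
    and der: "\<And>t. t \<in> interior I \<Longrightarrow> (g has_real_derivative g' t) (at t)"
    and Z: "finite Z" "Z \<subseteq> I" "\<And>z. z \<in> Z \<Longrightarrow> g z = 0" "Z \<noteq> {}"
  shows "\<exists>W. finite W \<and> W \<subseteq> interior I \<and> W \<inter> Z = {} \<and> (\<forall>w\<in>W. g' w = 0) \<and> Suc (card W) = card Z"
proof -
  have "\<exists>W. finite W \<and> W \<subseteq> interior I \<and> W \<inter> Z = {} \<and> (\<forall>w\<in>W. g' w = 0 \<and> w < Max Z) \<and> Suc (card W) = card Z"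
    using Z
  proof (induction Z rule: finite_linorder_max_induct)
    case (insert b A)
    note fA = insert.hyps(1) and lt = insert.hyps(2)
    have AI: "A \<subseteq> I" "b \<in> I" and Z0: "g b = 0" "\<And>z. z \<in> A \<Longrightarrow> g z = 0" using insert.prems by auto
    show ?case
    proof (cases "A = {}")
      case False
      with insert.IH[OF AI(1) Z0(2) False] obtain W where W: "finite W" "W \<subseteq> interior I" "W \<inter> A = {}"
        "\<forall>w\<in>W. g' w = 0 \<and> w < Max A" "Suc (card W) = card A" by blast
      define m where "m = Max A"
      have m: "m \<in> A" "m < b" unfolding m_def using fA lt False by auto
      have "m \<in> I" "b \<in> I" using m AI by auto
      then have sub: "{m..b} \<subseteq> I" using mem_is_interval_1_I[OF I] by (meson atLeastAtMost_iff subsetI)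
      have sub': "{m<..<b} \<subseteq> interior I" 
        using sub by (intro interior_maximal) auto
      have "\<exists>z. m < z \<and> z < b \<and> DERIV g z :> 0"
      proof (rule Rolle)
        show "g m = g b" using m Z0 by auto
        show "continuous_on {m..b} g" using cont sub continuous_on_subset by blast
        show "g differentiable at x" if "m < x" "x < b" for x
          using der[of x] sub' that unfolding real_differentiable_def
          by (meson greaterThanLessThan_iff subsetD)
      qed (use m in auto)
      then obtain z where z: "m < z" "z < b" "DERIV g z :> 0" by blast
      have "g' z = 0" using DERIV_unique[OF der z(3)] sub' z by auto
      have "z \<notin> A" using z fA False unfolding m_def by (meson Max_ge leD)
      have "z \<notin> W" using W(4) z unfolding m_def by force
      have "b \<notin> A" using lt by auto
      have "Max (insert b A) = b" using fA lt by (intro Max_eqI) (auto intro: less_imp_le)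
      moreover have "\<forall>w\<in>insert z W. g' w = 0 \<and> w < b"
        using W(4) z \<open>g' z = 0\<close> m unfolding m_def by auto
      moreover have "insert z W \<inter> insert b A = {}" using \<open>z \<notin> A\<close> W z m unfolding m_def by force
      moreover have "insert z W \<subseteq> interior I" using W z sub' by auto
      moreover have "Suc (card (insert z W)) = card (insert b A)"
        using W \<open>z \<notin> W\<close> \<open>b \<notin> A\<close> fA by auto
      ultimately show ?thesis using W(1) by (intro exI[of _ "insert z W"]) auto
    next
      case True then show ?thesis by (intro exI[of _ "{}"]) auto
    qed
  qed auto
  then show ?thesis by blast
qed

text \<open>
  Division by \<open>f 0\<close> makes the first function constant, and differentiation removes it. A double zero
  of the combination becomes a zero of the new combination, so Rolle's theorem loses only one zero,
  just as the induction loses one function. Double zeros of the combination become simple ones of the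
  derivative.
\<close>

lemma zero_count_nonvanishing:
  fixes f :: "nat \<Rightarrow> real \<Rightarrow> real"
  assumes "open I" "is_interval I"
    and "\<And>j. j < N \<Longrightarrow> n_diff I (N - 1) (f j)"
    and "\<And>k t c. \<lbrakk>k \<le> N; t \<in> I; vanishes k (\<lambda>s. \<Sum>j<k. c j * f j s) t\<rbrakk> \<Longrightarrow> \<forall>j<k. c j = 0"
    and "\<exists>j<N. c j \<noteq> 0"
    and "finite Z" "Z \<subseteq> I" "\<And>z. z \<in> Z \<Longrightarrow> (\<Sum>j<N. c j * f j z) = 0"
    and "D \<subseteq> Z" "\<And>z. z \<in> D \<Longrightarrow> deriv (\<lambda>s. \<Sum>j<N. c j * f j s) z = 0"
  shows "card Z + card D < N"
  using assms(3-)
proof (induction N arbitrary: f c Z D)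
  case (Suc N)
  note Zp = Suc.prems(4,5,7)
  have f0: "f 0 t \<noteq> 0" if "t \<in> I" for t
    using Suc.prems(2)[of 1 t "\<lambda>_. 1"] that by auto
  define g where "g = (\<lambda>s. \<Sum>j<Suc N. c j * f j s)"
  show ?case
  proof (cases "\<exists>j<N. c (Suc j) \<noteq> 0")
    case False
    then have *: "g = (\<lambda>s. c 0 * f 0 s)" unfolding g_def
      by (intro ext) (simp add: sum.lessThan_Suc_shift del: sum.lessThan_Suc)
    have "c 0 \<noteq> 0" using Suc.prems(3) False by (metis less_Suc_eq_0_disj)
    then have "Z = {}" using * Suc.prems(5,6) f0 unfolding g_def[symmetric] 
      by (auto simp: fun_eq_iff g_def subset_iff)
    then show ?thesis using Suc.prems(7) by auto
  next
    case True
    then have "N > 0" by auto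
    then obtain N' where N': "N = Suc N'" by (cases N) auto
    have df: "n_diff I N (f j)" if "j < Suc N" for j using Suc.prems(1) that by auto
    define r where "r = (\<lambda>s. inverse (f 0 s))"
    have dr: "n_diff I N r" unfolding r_def using f0 df by (intro n_diff_inverse[OF assms(1)]) auto
    define h where "h = (\<lambda>j s. r s * f (Suc j) s)"
    have dh: "n_diff I N (h j)" if "j < N" for j
      unfolding h_def using that df dr by (intro n_diff_mult[OF assms(1)]) auto
    define F where "F = (\<lambda>j. deriv (h j))"
    have h_der: "(h j has_real_derivative F j t) (at t)" if "j < N" "t \<in> I" for j t
      using dh[OF that(1)] that has_deriv_deriv unfolding F_def N' by auto
    have comb: "((\<lambda>s. d + (\<Sum>j<k. e j * h j s)) has_real_derivative (\<Sum>j<k. e j * F j t)) (at t)"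
      if "k \<le> N" "t \<in> I" for d e k t
      using h_der that by (auto intro!: derivative_eq_intros sum.cong)
    \<comment> \<open>the \<open>F j\<close> inherit non-degeneracy: a combination vanishing to order \<open>k\<close> at \<open>t\<close> is the derivative
      of a combination \<open>H\<close> of \<open>1\<close> and the \<open>h j\<close> that is zero at \<open>t\<close>, and \<open>f 0 * H\<close> is a combination
      of \<open>k + 1\<close> of the given functions vanishing to order \<open>k + 1\<close>\<close>
    have F_nv: "\<forall>j<k. e j = 0"
      if "k \<le> N" "t \<in> I" "vanishes k (\<lambda>s. \<Sum>j<k. e j * F j s) t" for k t e
    proof -
      define d where "d = - (\<Sum>j<k. e j * h j t)"
      define H where "H = (\<lambda>s. d + (\<Sum>j<k. e j * h j s))"
      have "vanishes k (deriv H) t"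
        by (rule vanishes_cong[OF assms(1) _ _ that(3)])
           (use DERIV_imp_deriv[OF comb[OF that(1)]] that(2) in \<open>auto simp: H_def\<close>)
      then have "vanishes (Suc k) H t" by (simp add: H_def d_def)
      moreover have "n_diff I k H" unfolding H_def
        using dh that n_diff_mono[of I N _ k]
        by (intro n_diff_add[OF assms(1)] n_diff_sum[OF assms(1)] n_diff_mult[OF assms(1)] n_diff_const) auto
      ultimately have "vanishes (Suc k) (\<lambda>s. f 0 s * H s) t"
        using df n_diff_mono[of I N _ k] that by (intro vanishes_mult[OF assms(1)]) auto
      moreover have "f 0 s * H s = (\<Sum>j<Suc k. case_nat d e j * f j s)" if "s \<in> I" for s
      proof -
        have "f 0 s * H s = d * f 0 s + (\<Sum>j<k. f 0 s * (e j * h j s))"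
          unfolding H_def by (simp add: algebra_simps sum_distrib_left)
        also have "(\<Sum>j<k. f 0 s * (e j * h j s)) = (\<Sum>j<k. e j * f (Suc j) s)"
          unfolding h_def r_def using f0[OF that] by (intro sum.cong) auto
        finally show ?thesis by (simp add: sum.lessThan_Suc_shift del: sum.lessThan_Suc)
      qed
      ultimately have "vanishes (Suc k) (\<lambda>s. \<Sum>j<Suc k. case_nat d e j * f j s) t"
        using vanishes_cong[OF assms(1), of "\<lambda>s. f 0 s * H s" "\<lambda>s. \<Sum>j<Suc k. case_nat d e j * f j s" t "Suc k"] that(2)
        by blast
      from Suc.prems(2)[OF _ that(2) this] that(1) have "\<forall>j<Suc k. case_nat d e j = 0" by simp
      then show ?thesis by (metis Suc_less_eq nat.case(2))
    qed
    define H where "H = (\<lambda>s. c 0 + (\<Sum>j<N. c (Suc j) * h j s))"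
    have H_eq: "H s = r s * g s" if "s \<in> I" for s
      unfolding H_def g_def h_def r_def using f0[OF that]
      by (simp add: sum.lessThan_Suc_shift sum_distrib_left algebra_simps del: sum.lessThan_Suc)
    have H_der: "(H has_real_derivative (\<Sum>j<N. c (Suc j) * F j t)) (at t)" if "t \<in> I" for t
      unfolding H_def by (rule comb) (use that in auto)
    show ?thesis
    proof (cases "Z = {}")
      case False
      have "\<exists>W. finite W \<and> W \<subseteq> interior I \<and> W \<inter> Z = {} \<and> (\<forall>w\<in>W. (\<Sum>j<N. c (Suc j) * F j w) = 0) \<and> Suc (card W) = card Z"
      proof (rule Rolle_count[where g = H])
        show "continuous_on I H" using H_der by (intro continuous_at_imp_continuous_on ballI DERIV_isCont)
        show "H z = 0" if "z \<in> Z" for z using H_eq Suc.prems(5,6) that unfolding g_def by auto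
      qed (use assms(2) H_der interior_open[OF assms(1)] Zp False in auto)
      then obtain W where W: "finite W" "W \<subseteq> I" "W \<inter> Z = {}"
        "\<forall>w\<in>W. (\<Sum>j<N. c (Suc j) * F j w) = 0" "Suc (card W) = card Z"
        using interior_open[OF assms(1)] by auto
      have D: "(\<Sum>j<N. c (Suc j) * F j z) = 0" if "z \<in> D" for z
      proof -
        have z: "z \<in> I" "z \<in> Z" using that Zp by auto
        have "g differentiable at z" unfolding g_def using df z N' by (auto intro!: derivative_intros)
        moreover have "r differentiable at z" using dr z N' by auto
        ultimately have "deriv (\<lambda>s. r s * g s) z = deriv r z * g z + r z * deriv g z"
          using deriv_mult_open by blast
        also have "\<dots> = 0" using Suc.prems(6)[OF z(2)] Suc.prems(8)[OF that] unfolding g_def by simp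
        also have "deriv (\<lambda>s. r s * g s) z = deriv H z"
          by (rule deriv_cong_open[OF assms(1) z(1)]) (use H_eq in auto)
        finally show ?thesis using DERIV_imp_deriv[OF H_der[OF z(1)]] by simp
      qed
      have dF: "n_diff I (N - 1) (F j)" if "j < N" for j
        using dh[OF that] N' unfolding F_def by auto
      have finD: "finite D" using Zp finite_subset by blast
      have "card (W \<union> D) + card ({}::real set) < N"
      proof (rule Suc.IH[of F "\<lambda>j. c (Suc j)"])
        show "\<exists>j<N. c (Suc j) \<noteq> 0" by (rule True)
        show "finite (W \<union> D)" using W finD by blast
        show "W \<union> D \<subseteq> I" using W Zp by blast
        show "(\<Sum>j<N. c (Suc j) * F j z) = 0" if "z \<in> W \<union> D" for z using W(4) D that by blast
      qed (use dF F_nv in blast)+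
      moreover have "card (W \<union> D) = card W + card D"
        using W Zp finD by (intro card_Un_disjoint) auto
      ultimately show ?thesis using W by auto
    qed (use Zp in auto)
  qed
next
  case 0
  from 0(3) show ?case by simp
qed

section \<open>Curves with totally positive torsion\<close>

declare iter_deriv.simps(2) [simp del]

lemma pick_lessThan:
  assumes "i < k"
  shows "pick {..<k} i = i"
proof -
  have "{a \<in> {..<k}. a < i} = {..<i}" using assms by auto
  then show ?thesis using pick_card_in_set[of i "{..<k}"] assms by simp
qed

lemma nth_index_bij: "bij_betw (nth_index :: nat \<Rightarrow> 'm::{finite,linorder}) {..<CARD('m)} UNIV"
proof -
  have "bij_betw ((!) (sorted_list_of_set (UNIV :: 'm set))) {..<length (sorted_list_of_set (UNIV :: 'm set))} (set (sorted_list_of_set (UNIV :: 'm set)))"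
    by (rule bij_betw_nth) auto
  then show ?thesis unfolding nth_index_def[abs_def] by simp
qed

lemma inner_eq_sum_nth_index:
  fixes c v :: "real ^ 'm::{finite,linorder}"
  shows "c \<bullet> v = (\<Sum>j<CARD('m). c $ nth_index j * v $ nth_index j)"
  unfolding inner_vec_def by (subst sum.reindex_bij_betw[OF nth_index_bij, symmetric]) simp

lemma columns_index:
  fixes vs :: "(real ^ 'm::{finite,linorder}) list"
  assumes "i < CARD('m)" "j < length vs"
  shows "columns vs $$ (i, j) = vs ! j $ nth_index i"
  using assms by (simp add: columns_def mat_of_cols_index coord_vec_def)

lemma columns_dim [simp]:
  fixes vs :: "(real ^ 'm::{finite,linorder}) list"
  shows "dim_row (columns vs) = CARD('m)" "dim_col (columns vs) = length vs"
  by (simp_all add: columns_def)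

locale torsion_curve =
  fixes \<gamma> :: "real \<Rightarrow> real ^ 'm::{finite,linorder}" and a b :: real
  assumes ab: "a < b"
    and C1: "C_k_on 1 \<gamma> {a..b}"
    and tpt: "totally_positive_torsion \<gamma> a b"
begin

abbreviation G where "G \<equiv> \<lambda>k. iter_deriv {a<..<b} k \<gamma>"

lemma G_deriv:
  assumes "k < CARD('m)" "t \<in> {a<..<b}"
  shows "(G k has_vector_derivative G (Suc k) t) (at t)"
proof -
  have "G k differentiable (at t within {a<..<b})"
    using tpt assms unfolding totally_positive_torsion_def C_k_on_def by blast
  then have "(G k has_vector_derivative G (Suc k) t) (at t within {a<..<b})"
    by (simp add: vector_derivative_works iter_deriv.simps(2))
  then show ?thesis using assms(2) at_within_open[of t "{a<..<b}"] by auto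
qed

lemma inner_G_deriv:
  assumes "k < CARD('m)" "t \<in> {a<..<b}"
  shows "((\<lambda>t. c \<bullet> G k t) has_real_derivative c \<bullet> G (Suc k) t) (at t)"
  using bounded_linear.has_vector_derivative[OF bounded_linear_inner_right G_deriv[OF assms]]
  by (simp add: has_real_derivative_iff_has_vector_derivative)

lemma n_diff_inner_G:
  assumes "k + m \<le> CARD('m)"
  shows "n_diff {a<..<b} k (\<lambda>t. c \<bullet> G m t)"
  using assms
proof (induction k arbitrary: m)
  case (Suc k)
  have d: "((\<lambda>t. c \<bullet> G m t) has_real_derivative c \<bullet> G (Suc m) t) (at t)" if "t \<in> {a<..<b}" for t
    using inner_G_deriv Suc.prems that by simp
  have "n_diff {a<..<b} k (\<lambda>t. c \<bullet> G (Suc m) t)" using Suc by simp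
  then have "n_diff {a<..<b} k (deriv (\<lambda>t. c \<bullet> G m t))"
    by (rule n_diff_cong[rotated 2]) (use DERIV_imp_deriv[OF d] in auto)
  then show ?case using d unfolding n_diff.simps real_differentiable_def by blast
qed simp

lemma vanishes_inner_G:
  assumes "k + m \<le> Suc CARD('m)" "t \<in> {a<..<b}" "vanishes k (\<lambda>t. c \<bullet> G m t) t" "i < k"
  shows "c \<bullet> G (m + i) t = 0"
  using assms
proof (induction k arbitrary: m i)
  case (Suc k)
  show ?case
  proof (cases i)
    case 0
    then show ?thesis using Suc.prems by simp
  next
    case (Suc i')
    then have m: "m < CARD('m)" using Suc.prems by simp
    have "vanishes k (deriv (\<lambda>t. c \<bullet> G m t)) t" using Suc.prems by simp
    then have "vanishes k (\<lambda>t. c \<bullet> G (Suc m) t) t"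
      by (rule vanishes_cong[where I = "{a<..<b}", rotated 3])
         (use DERIV_imp_deriv[OF inner_G_deriv[OF m]] \<open>t \<in> {a<..<b}\<close> in auto)
    then have "c \<bullet> G (Suc m + i') t = 0" using Suc Suc.prems by (intro Suc.IH) auto
    then show ?thesis using Suc by simp
  qed
qed simp

text \<open>
  The sums are the entries of the product of the vector \<open>e\<close> with the leading minor of order \<open>k\<close> of the
  torsion matrix, which is invertible.
\<close>

lemma torsion_nondegenerate:
  assumes "k \<le> CARD('m)" "t \<in> {a<..<b}" "\<And>i. i < k \<Longrightarrow> (\<Sum>j<k. e j * G (Suc i) t $ nth_index j) = 0"
  shows "\<forall>j<k. e j = 0"
proof (cases "k = 0")
  case False
  define M where "M = submatrix (torsion_matrix \<gamma> a b t) {..<k} {..<k}"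
  have lt: "{i. i < CARD('m) \<and> i \<in> {..<k}} = {..<k}" using assms(1) by auto
  have dims: "dim_row (torsion_matrix \<gamma> a b t) = CARD('m)" "dim_col (torsion_matrix \<gamma> a b t) = CARD('m)"
    by (simp_all add: torsion_matrix_def)
  have M: "M \<in> carrier_mat k k"
    unfolding M_def by (rule carrier_matI) (simp_all only: dim_submatrix dims lt card_lessThan)
  have M_ix: "M $$ (r, s) = G (Suc s) t $ nth_index r" if "r < k" "s < k" for r s
  proof -
    have "M $$ (r, s) = torsion_matrix \<gamma> a b t $$ (pick {..<k} r, pick {..<k} s)"
      unfolding M_def by (rule submatrix_index) (use that in \<open>simp_all only: dims lt card_lessThan\<close>)
    also have "\<dots> = torsion_matrix \<gamma> a b t $$ (r, s)" using that by (simp add: pick_lessThan)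
    also have "\<dots> = map (\<lambda>j. G j t) [1..<CARD('m) + 1] ! s $ nth_index r"
      unfolding torsion_matrix_def by (rule columns_index) (use that assms(1) in auto)
    also have "\<dots> = G (Suc s) t $ nth_index r"
      using that assms(1) by (simp del: upt_Suc)
    finally show ?thesis .
  qed
  have "Determinant.det M > 0"
    using tpt assms False unfolding totally_positive_torsion_def M_def by auto
  then have "Determinant.det (transpose_mat M) \<noteq> 0" using det_transpose[OF M] by simp
  then have no: "\<not> (\<exists>v. v \<in> carrier_vec k \<and> v \<noteq> 0\<^sub>v k \<and> transpose_mat M *\<^sub>v v = 0\<^sub>v k)"
    using det_0_iff_vec_prod_zero_field[of "transpose_mat M" k] M by auto
  define v where "v = Matrix.vec k e"
  have "transpose_mat M *\<^sub>v v = 0\<^sub>v k"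
  proof (rule eq_vecI)
    fix i assume i: "i < dim_vec (0\<^sub>v k :: real Matrix.vec)"
    have "vec_index (transpose_mat M *\<^sub>v v) i = (\<Sum>j<k. M $$ (j, i) * e j)"
      using M i unfolding v_def by (auto simp: scalar_prod_def lessThan_atLeast0)
    also have "\<dots> = (\<Sum>j<k. e j * G (Suc i) t $ nth_index j)"
      using M_ix i by (intro sum.cong) auto
    finally show "vec_index (transpose_mat M *\<^sub>v v) i = vec_index (0\<^sub>v k) i"
      using assms(3) i by simp
  qed (use M in auto)
  moreover have "v \<in> carrier_vec k" unfolding v_def by simp
  ultimately have "v = 0\<^sub>v k" using no by blast
  then have "vec_index v j = 0" if "j < k" for j using that by simp
  then show ?thesis unfolding v_def by simp
qed simp

abbreviation "\<gamma>' \<equiv> curve_deriv a b \<gamma>"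

lemma \<gamma>_deriv: "t \<in> {a..b} \<Longrightarrow> (\<gamma> has_vector_derivative \<gamma>' t) (at t within {a..b})"
proof -
  assume "t \<in> {a..b}"
  then have "\<gamma> differentiable (at t within {a..b})" using C1 unfolding C_k_on_def by force
  then show ?thesis by (simp add: curve_deriv_def vector_derivative_works iter_deriv.simps(2))
qed

lemma \<gamma>'_cont: "continuous_on {a..b} \<gamma>'"
  using C1 unfolding C_k_on_def curve_deriv_def by blast

lemma \<gamma>'_eq: "t \<in> {a<..<b} \<Longrightarrow> \<gamma>' t = G 1 t"
proof -
  assume t: "t \<in> {a<..<b}"
  have "(\<gamma> has_vector_derivative \<gamma>' t) (at t within {a<..<b})"
    using has_vector_derivative_within_subset[OF \<gamma>_deriv] t by (meson greaterThanLessThan_subseteq_atLeastAtMost_iff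
        greaterThanLessThan_iff atLeastAtMost_iff less_imp_le order_refl)
  then have "(\<gamma> has_vector_derivative \<gamma>' t) (at t)" using t at_within_open[of t "{a<..<b}"] by auto
  then have "vector_derivative \<gamma> (at t) = \<gamma>' t" by (rule vector_derivative_at)
  moreover have "vector_derivative \<gamma> (at t) = G 1 t"
    using vector_derivative_at[OF G_deriv[OF _ t, of 0]] by simp
  ultimately show ?thesis by simp
qed

lemma deriv_zero_count:
  assumes "c \<noteq> 0" "finite Z" "Z \<subseteq> {a<..<b}" "\<And>z. z \<in> Z \<Longrightarrow> c \<bullet> G 1 z = 0"
    and "D \<subseteq> Z" "\<And>z. z \<in> D \<Longrightarrow> deriv (\<lambda>t. c \<bullet> G 1 t) z = 0"
  shows "card Z + card D < CARD('m)"
proof -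
  have eq: "(\<Sum>j<CARD('m). c $ nth_index j * G 1 s $ nth_index j) = c \<bullet> G 1 s" for s
    by (rule inner_eq_sum_nth_index[symmetric])
  show ?thesis
  proof (rule zero_count_nonvanishing[where I = "{a<..<b}" and c = "\<lambda>j. c $ nth_index j" and f = "\<lambda>j s. G 1 s $ nth_index j"])
    fix j
    have "n_diff {a<..<b} (CARD('m) - 1) (\<lambda>s. axis (nth_index j) 1 \<bullet> G 1 s)"
      by (rule n_diff_inner_G) (simp add: Suc_leI)
    then show "n_diff {a<..<b} (CARD('m) - 1) (\<lambda>s. G 1 s $ nth_index j)"
      by (simp add: inner_axis')
  next
    fix k t e
    assume *: "k \<le> CARD('m)" "t \<in> {a<..<b}" "vanishes k (\<lambda>s. \<Sum>j<k. e j * G 1 s $ nth_index j) t"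
    define v :: "real ^ 'm::{finite,linorder}" where "v = (\<Sum>j<k. e j *\<^sub>R axis (nth_index j) 1)"
    have v: "v \<bullet> w = (\<Sum>j<k. e j * w $ nth_index j)" for w
      unfolding v_def by (simp add: inner_sum_left inner_axis')
    have "v \<bullet> G (Suc i) t = 0" if "i < k" for i
      using vanishes_inner_G[of k 1 t v i] * that unfolding v[symmetric] by simp
    then show "\<forall>j<k. e j = 0" using torsion_nondegenerate[OF *(1,2), of e] unfolding v by blast
  next
    show "\<exists>j<CARD('m). c $ nth_index j \<noteq> 0"
    proof -
      obtain i where "c $ i \<noteq> 0" using assms(1) by (auto simp: Finite_Cartesian_Product.vec_eq_iff)
      moreover obtain j where "j < CARD('m)" "i = nth_index j" 
        using bij_betw_imp_surj_on[OF nth_index_bij] by (metis UNIV_I imageE lessThan_iff)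
      ultimately show ?thesis by blast
    qed
  qed (use assms is_interval_oo in \<open>simp_all only: eq open_greaterThanLessThan\<close>)
qed


lemma curve_functional_cont: "continuous_on {a..b} (\<lambda>t. c0 + c \<bullet> \<gamma> t)"
proof -
  have "continuous_on {a..b} \<gamma>" using C1 unfolding C_k_on_def by force
  then show ?thesis by (intro continuous_intros)
qed

lemma curve_functional_deriv:
  assumes "t \<in> {a<..<b}"
  shows "((\<lambda>t. c0 + c \<bullet> \<gamma> t) has_real_derivative c \<bullet> G 1 t) (at t)"
proof -
  have "((\<lambda>t. c \<bullet> \<gamma> t) has_real_derivative c \<bullet> G 1 t) (at t)"
    using inner_G_deriv[OF _ assms, of 0 c] by simp
  then show ?thesis by (auto intro!: derivative_eq_intros)
qed

lemma Rolle_curve: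
  assumes "finite Z" "Z \<subseteq> {a..b}" "\<And>z. z \<in> Z \<Longrightarrow> c0 + c \<bullet> \<gamma> z = 0" "Z \<noteq> {}"
  obtains W where "finite W" "W \<subseteq> {a<..<b}" "W \<inter> Z = {}" "\<And>w. w \<in> W \<Longrightarrow> c \<bullet> G 1 w = 0" "Suc (card W) = card Z"
proof -
  have "\<exists>W. finite W \<and> W \<subseteq> interior {a..b} \<and> W \<inter> Z = {} \<and> (\<forall>w\<in>W. c \<bullet> G 1 w = 0) \<and> Suc (card W) = card Z"
  proof (rule Rolle_count[where g = "\<lambda>t. c0 + c \<bullet> \<gamma> t"])
    show "((\<lambda>t. c0 + c \<bullet> \<gamma> t) has_real_derivative c \<bullet> G 1 t) (at t)" if "t \<in> interior {a..b}" for t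
      using curve_functional_deriv that by (simp add: interior_atLeastAtMost_real)
  qed (use assms curve_functional_cont in \<open>simp_all add: is_interval_cc\<close>)
  then show ?thesis using that by (auto simp: interior_atLeastAtMost_real)
qed

text \<open>
  One application of Rolle's theorem on the closed interval gains the double zeros and leads to a
  combination of the coordinates of \<open>\<gamma>'\<close> on the open interval.
\<close>

lemma zero_count:
  assumes nz: "c0 \<noteq> 0 \<or> c \<noteq> 0" and Z: "finite Z" "Z \<subseteq> {a..b}" "\<And>z. z \<in> Z \<Longrightarrow> c0 + c \<bullet> \<gamma> z = 0"
    and D: "D \<subseteq> Z \<inter> {a<..<b}" "\<And>z. z \<in> D \<Longrightarrow> c \<bullet> \<gamma>' z = 0"
  shows "card Z + card D \<le> CARD('m)"
proof (cases "Z = {}")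
  case False
  then have "c \<noteq> 0" using nz Z(3) by fastforce
  obtain W where W: "finite W" "W \<subseteq> {a<..<b}" "W \<inter> Z = {}" "\<And>w. w \<in> W \<Longrightarrow> c \<bullet> G 1 w = 0" "Suc (card W) = card Z"
    using Rolle_curve[OF Z False] by metis
  have "finite D" using D Z finite_subset by blast
  have "card (W \<union> D) + card ({} :: real set) < CARD('m)"
  proof (rule deriv_zero_count[OF \<open>c \<noteq> 0\<close>])
    show "c \<bullet> G 1 z = 0" if "z \<in> W \<union> D" for z
      using W(4) D(2)[of z] D(1) \<gamma>'_eq[of z] that by auto
  qed (use W D \<open>finite D\<close> in auto)
  moreover have "card (W \<union> D) = card W + card D"
    using W D \<open>finite D\<close> by (intro card_Un_disjoint) auto
  ultimately show ?thesis using W(5) by simp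
qed (use D in auto)

text \<open>
  If the sign changed from plus to minus at a zero \<open>\<tau>\<close>, then \<open>\<tau>\<close> would be a zero of order three: the
  derivative \<open>h\<close> is negative on both sides of \<open>\<tau>\<close> and zero at \<open>\<tau>\<close>, hence has a local maximum there.
  Then \<open>\<tau>\<close> is a double zero of \<open>h\<close>, which already has as many zeros as it can have.
\<close>

lemma no_sign_change:
  assumes nz: "c0 \<noteq> 0 \<or> c \<noteq> 0" and Z: "finite Z" "Z \<subseteq> {a..b}" "\<And>z. z \<in> Z \<Longrightarrow> c0 + c \<bullet> \<gamma> z = 0"
    and D: "\<And>z. z \<in> Z \<inter> {a<..<b} \<Longrightarrow> c \<bullet> \<gamma>' z = 0"
    and full: "card Z + card (Z \<inter> {a<..<b}) = CARD('m)"
    and t: "a \<le> t1" "t1 < t2" "t2 \<le> b" "c0 + c \<bullet> \<gamma> t1 > 0"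
  shows "c0 + c \<bullet> \<gamma> t2 \<ge> 0"
proof (rule ccontr)
  assume neg: "\<not> ?thesis"
  define g where "g = (\<lambda>t. c0 + c \<bullet> \<gamma> t)"
  define h where "h = (\<lambda>t. c \<bullet> G 1 t)"
  define D where "D = Z \<inter> {a<..<b}"
  have "Z \<noteq> {}" using full by auto
  then have "c \<noteq> 0" using nz Z(3) by fastforce
  have finD: "finite D" using Z D_def by auto
  have zeros: "z \<in> Z" if "z \<in> {a..b}" "g z = 0" for z
  proof (rule ccontr)
    assume "z \<notin> Z"
    have "card (insert z Z) + card D \<le> CARD('m)"
      by (rule zero_count[OF nz]) (use Z D that g_def D_def in auto)
    then show False using full \<open>z \<notin> Z\<close> Z(1) unfolding D_def by simp
  qed
  obtain W where W: "finite W" "W \<subseteq> {a<..<b}" "W \<inter> Z = {}" "\<And>w. w \<in> W \<Longrightarrow> h w = 0" "Suc (card W) = card Z"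
    using Rolle_curve[OF Z \<open>Z \<noteq> {}\<close>] unfolding h_def by metis
  have hD: "h z = 0" if "z \<in> D" for z using D[of z] \<gamma>'_eq[of z] that unfolding D_def h_def by auto
  have cardWD: "card (W \<union> D) = card W + card D"
    using W finD D_def by (intro card_Un_disjoint) auto
  have WD: "z \<in> W \<union> D" if "z \<in> {a<..<b}" "h z = 0" for z
  proof (rule ccontr)
    assume "z \<notin> W \<union> D"
    have "card (insert z (W \<union> D)) + card ({} :: real set) < CARD('m)"
    proof (rule deriv_zero_count[OF \<open>c \<noteq> 0\<close>])
      show "c \<bullet> G 1 y = 0" if "y \<in> insert z (W \<union> D)" for y
        using that W(4) hD \<open>h z = 0\<close> unfolding h_def by blast
      show "insert z (W \<union> D) \<subseteq> {a<..<b}" using \<open>z \<in> {a<..<b}\<close> W(2) unfolding D_def by blast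
    qed (use W finD in auto)
    then show False using full W cardWD \<open>z \<notin> W \<union> D\<close> finD unfolding D_def[symmetric] by simp
  qed
  have g_cont: "continuous_on {a..b} g" unfolding g_def by (rule curve_functional_cont)
  have g_der: "(g has_real_derivative h t) (at t)" if "t \<in> {a<..<b}" for t
    unfolding g_def h_def by (rule curve_functional_deriv[OF that])
  have g1: "g t1 > 0" and g2: "g t2 < 0" using t neg unfolding g_def by auto
  \<comment> \<open>\<open>g\<close> takes positive values arbitrarily close to \<open>\<tau>\<close> on the left and is nonpositive on the right;
    the largest zero before \<open>t2\<close> would not do, as \<open>g\<close> might be negative on both sides of it\<close>
  define S where "S = {t\<in>{t1..t2}. g t > 0}"
  have S: "t1 \<in> S" "bdd_above S" "S \<subseteq> {t1..t2}"
    using t g1 unfolding S_def by (auto intro!: bdd_aboveI[of _ t2])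
  define \<tau> where "\<tau> = Sup S"
  have \<tau>: "t1 \<le> \<tau>" "\<tau> \<le> t2"
    unfolding \<tau>_def using S by (auto intro!: cSup_upper cSup_least)
  have right: "g s \<le> 0" if "\<tau> < s" "s \<le> t2" for s
  proof (rule ccontr)
    assume "\<not> g s \<le> 0"
    then have "s \<in> S" using that \<tau> unfolding S_def by auto
    then show False using cSup_upper[OF _ S(2)] that \<tau>_def by fastforce
  qed
  have left: "\<exists>s\<in>S. \<tau> - e < s \<and> s \<le> \<tau>" if "e > 0" for e
  proof -
    have "\<tau> - e < Sup S" using that \<tau>_def by simp
    then obtain s where "s \<in> S" "\<tau> - e < s" using S(1) less_cSupE by blast
    then show ?thesis using cSup_upper[OF _ S(2)] \<tau>_def by blast
  qed
  have g\<tau>: "g \<tau> = 0"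
  proof (rule ccontr)
    assume "g \<tau> \<noteq> 0"
    moreover have "\<tau> \<in> {a..b}" using \<tau> t by simp
    ultimately obtain e where e: "e > 0" "\<And>s. s \<in> {a..b} \<Longrightarrow> \<bar>s - \<tau>\<bar> < e \<Longrightarrow> \<bar>g s - g \<tau>\<bar> < \<bar>g \<tau>\<bar>"
      using g_cont unfolding continuous_on_iff dist_real_def by (metis zero_less_abs_iff)
    show False
    proof (cases "g \<tau> > 0")
      case True
      then have "\<tau> < t2" using g2 \<tau> by (cases "\<tau> = t2") auto
      define s where "s = min t2 (\<tau> + e / 2)"
      have "\<tau> < s" "s \<le> t2" "\<bar>s - \<tau>\<bar> < e" "s \<in> {a..b}"
        unfolding s_def using \<open>\<tau> < t2\<close> e(1) \<tau> t by auto
      then show False using e(2)[of s] right[of s] True by auto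
    next
      case False
      obtain s where s: "s \<in> S" "\<tau> - e < s" "s \<le> \<tau>" using left[OF e(1)] by blast
      have "s \<in> {a..b}" "\<bar>s - \<tau>\<bar> < e" using s S(3) t e(1) by auto
      then show False using e(2)[of s] s(1) False unfolding S_def by auto
    qed
  qed
  have \<tau>': "t1 < \<tau>" "\<tau> < t2" using \<tau> g\<tau> g1 g2 by (auto simp: order_less_le)
  then have \<tau>ab: "\<tau> \<in> {a<..<b}" using t by simp
  then have "\<tau> \<in> Z" using zeros g\<tau> by simp
  then have \<tau>D: "\<tau> \<in> D" using \<tau>ab D_def by simp
  have "card {\<tau>} \<le> card Z" "card {\<tau>} \<le> card D" using \<open>\<tau> \<in> Z\<close> \<tau>D Z(1) finD by (auto simp: card_gt_0_iff Suc_le_eq)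
  then have two: "1 < CARD('m)" using full D_def by simp
  have h_der: "(h has_real_derivative c \<bullet> G 2 t) (at t)" if "t \<in> {a<..<b}" for t
    using inner_G_deriv[OF two that, of c] unfolding h_def by (simp add: numeral_2_eq_2)
  obtain d0 where d0: "d0 > 0" "\<And>x. x \<in> W \<union> Z \<Longrightarrow> x \<noteq> \<tau> \<Longrightarrow> d0 \<le> dist \<tau> x"
    using finite_set_avoid[of "W \<union> Z" \<tau>] W(1) Z(1) by auto
  define d where "d = min d0 (min (\<tau> - t1) (t2 - \<tau>))"
  have d: "d > 0" unfolding d_def using d0 \<tau>' by simp
  have d_sub: "s \<in> {a<..<b}" "t1 < s" "s < t2" if "\<bar>s - \<tau>\<bar> < d" for s
    using that t unfolding d_def by auto
  have nz: "s \<notin> Z" "s \<notin> W \<union> D" if "\<bar>s - \<tau>\<bar> < d" "s \<noteq> \<tau>" for s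
    using d0(2)[of s] that unfolding d_def D_def dist_real_def by auto
  \<comment> \<open>\<open>h\<close> has no zero near \<open>\<tau>\<close> other than \<open>\<tau>\<close>, so one negative value on each side determines its sign\<close>
  have h_sign: "h y < 0" if J: "J \<subseteq> {s. \<bar>s - \<tau>\<bar> < d \<and> s \<noteq> \<tau>}" "connected J" and yz: "y \<in> J" "z \<in> J" "h z < 0" for J y z
  proof (rule ccontr)
    assume "\<not> h y < 0"
    have "continuous_on J h"
      using J d_sub h_der by (intro continuous_at_imp_continuous_on ballI DERIV_isCont) blast
    then have "connected (h ` J)" using J(2) connected_continuous_image by blast
    then have "{h z..h y} \<subseteq> h ` J" using yz by (intro connected_contains_Icc) auto
    then have "0 \<in> h ` J" using yz \<open>\<not> h y < 0\<close> by auto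
    then obtain s where "s \<in> J" "h s = 0" by auto
    then show False using WD[of s] nz(2)[of s] d_sub(1)[of s] J(1) by blast
  qed
  obtain s where s: "s \<in> S" "\<tau> - d < s" "s \<le> \<tau>" using left[OF d] by blast
  then have s': "g s > 0" "s < \<tau>" using g\<tau> unfolding S_def by (auto simp: order_less_le)
  have "\<exists>z. s < z \<and> z < \<tau> \<and> g \<tau> - g s = (\<tau> - s) * h z"
  proof (rule MVT2[OF s'(2)])
    fix x assume "s \<le> x" "x \<le> \<tau>"
    then have "\<bar>x - \<tau>\<bar> < d" using s by simp
    then show "(g has_real_derivative h x) (at x)" using g_der d_sub(1) by blast
  qed
  then obtain z where z: "s < z" "z < \<tau>" "g \<tau> - g s = (\<tau> - s) * h z" by blast
  have hz: "h z < 0" using z s' g\<tau> by (smt (verit) mult_nonneg_nonneg)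
  define q where "q = \<tau> + d / 2"
  have q: "\<tau> < q" "\<bar>q - \<tau>\<bar> < d" unfolding q_def using d by auto
  have "g q \<le> 0" using right[of q] d_sub[OF q(2)] q by simp
  moreover have "g q \<noteq> 0" using nz(1)[OF q(2)] zeros[of q] d_sub(1)[OF q(2)] q by auto
  ultimately have gq: "g q < 0" by simp
  have "\<exists>r. \<tau> < r \<and> r < q \<and> g q - g \<tau> = (q - \<tau>) * h r"
  proof (rule MVT2[OF q(1)])
    fix x assume "\<tau> \<le> x" "x \<le> q"
    then have "\<bar>x - \<tau>\<bar> < d" using q by simp
    then show "(g has_real_derivative h x) (at x)" using g_der d_sub(1) by blast
  qed
  then obtain r where r: "\<tau> < r" "r < q" "g q - g \<tau> = (q - \<tau>) * h r" by blast
  have hr: "h r < 0" using r gq g\<tau> q by (smt (verit) mult_nonneg_nonneg)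
  have "h y \<le> h \<tau>" if "\<bar>\<tau> - y\<bar> < d" for y
  proof -
    consider "y < \<tau>" | "y = \<tau>" | "y > \<tau>" by linarith
    then show ?thesis
    proof cases
      case 1
      then have "h y < 0" using that z s hz
        by (intro h_sign[of "{\<tau> - d<..<\<tau>}" y z]) auto
      then show ?thesis using hD[OF \<tau>D] by simp
    next
      case 3
      then have "h y < 0" using that r q hr
        by (intro h_sign[of "{\<tau><..<\<tau> + d}" y r]) auto
      then show ?thesis using hD[OF \<tau>D] by simp
    qed simp
  qed
  then have "c \<bullet> G 2 \<tau> = 0" using DERIV_local_max[OF h_der[OF \<tau>ab] d] by blast
  then have dh: "deriv h \<tau> = 0" using DERIV_imp_deriv[OF h_der[OF \<tau>ab]] by simp
  have "card (W \<union> D) + card {\<tau>} < CARD('m)"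
  proof (rule deriv_zero_count[OF \<open>c \<noteq> 0\<close>])
    show "c \<bullet> G 1 y = 0" if "y \<in> W \<union> D" for y
      using that W(4) hD unfolding h_def by blast
    show "deriv (\<lambda>t. c \<bullet> G 1 t) y = 0" if "y \<in> {\<tau>}" for y using that dh unfolding h_def by simp
    show "W \<union> D \<subseteq> {a<..<b}" using W(2) unfolding D_def by blast
  qed (use W finD \<tau>D in auto)
  then show False using full W(5) cardWD unfolding D_def[symmetric] by simp
qed

end

section \<open>Functionals annihilating points and tangents of the curve\<close>

text \<open>
  The pairs \<open>(c0, c)\<close> form a space of dimension \<open>DIM('b) + 1\<close>, and each element of \<open>V\<close> imposes one linear
  condition.
\<close>

lemma ex_annihilating_functional:
  fixes V :: "(real \<times> 'b::euclidean_space) set"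
  assumes "finite V" "card V \<le> DIM('b)"
  obtains c0 c where "c0 \<noteq> 0 \<or> c \<noteq> 0" "\<And>s v. (s, v) \<in> V \<Longrightarrow> c0 * s + c \<bullet> v = 0"
proof -
  have "dim V \<le> card V" using assms(1) by (rule dim_le_card') 
  then have "dim V < DIM(real \<times> 'b)" using assms(2) by simp
  then obtain x :: "real \<times> 'b" where x: "x \<noteq> 0" "\<And>y. y \<in> span V \<Longrightarrow> x \<bullet> y = 0"
    using orthogonal_to_subspace_exists[of V] unfolding real_inner_class.orthogonal_def by blast
  obtain c0 c where xc: "x = (c0, c)" by (cases x)
  have "c0 * s + c \<bullet> v = 0" if "(s, v) \<in> V" for s v
    using x(2)[OF span_base[OF that]] xc by (simp add: inner_prod_def)
  then show ?thesis using x(1) xc that by (auto simp: zero_prod_def)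
qed

context torsion_curve
begin

lemma ex_touching_functional:
  assumes "finite Z" "finite D" "card Z + card D \<le> CARD('m)"
  obtains c0 c where "c0 \<noteq> 0 \<or> c \<noteq> 0" "\<And>z. z \<in> Z \<Longrightarrow> c0 + c \<bullet> \<gamma> z = 0" "\<And>z. z \<in> D \<Longrightarrow> c \<bullet> \<gamma>' z = 0"
proof -
  define V where "V = (\<lambda>z. (1::real, \<gamma> z)) ` Z \<union> (\<lambda>z. (0, \<gamma>' z)) ` D"
  have "card V \<le> card ((\<lambda>z. (1::real, \<gamma> z)) ` Z) + card ((\<lambda>z. (0::real, \<gamma>' z)) ` D)"
    unfolding V_def by (rule card_Un_le)
  also have "\<dots> \<le> card Z + card D" by (intro add_mono card_image_le assms)
  finally have "card V \<le> DIM(real ^ 'm::{finite,linorder})" using assms by simp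
  moreover have "finite V" unfolding V_def using assms by simp
  ultimately obtain c0 c where "c0 \<noteq> 0 \<or> c \<noteq> 0" and *: "\<And>s v. (s, v) \<in> V \<Longrightarrow> c0 * s + c \<bullet> v = 0"
    using ex_annihilating_functional[of V] by metis
  moreover have "c0 + c \<bullet> \<gamma> z = 0" if "z \<in> Z" for z using *[of 1 "\<gamma> z"] that by (auto simp: V_def)
  moreover have "c \<bullet> \<gamma>' z = 0" if "z \<in> D" for z using *[of 0 "\<gamma>' z"] that by (auto simp: V_def)
  ultimately show ?thesis using that by blast
qed

lemma ex_more_points:
  assumes "finite Z"
  obtains E where "finite E" "card E = k" "E \<subseteq> {a..b}" "E \<inter> Z = {}"
proof -
  have "infinite ({a..b} - Z)" using ab assms by (intro Diff_infinite_finite) auto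
  then obtain E where "finite E" "card E = k" "E \<subseteq> {a..b} - Z"
    using infinite_arbitrarily_large by blast
  then show ?thesis using that[of E] by blast
qed

text \<open>
  A coefficient is isolated by a functional that annihilates all the other vectors. Extra points \<open>E\<close> are
  added so that the functional already has \<open>N\<close> zeros; then it cannot annihilate the remaining vector
  as well. The tangents come first, because the functional for a point \<open>y\<close> is not required to
  annihilate the tangent at \<open>y\<close>.
\<close>

lemma independent_points_and_tangents:
  assumes Z: "finite Z" "Z \<subseteq> {a..b}" and D: "D \<subseteq> Z \<inter> {a<..<b}"
    and cd: "card Z + card D \<le> Suc CARD('m)"
    and s0: "(\<Sum>z\<in>Z. \<alpha> z) = 0" and s1: "(\<Sum>z\<in>Z. \<alpha> z *\<^sub>R \<gamma> z) + (\<Sum>z\<in>D. \<beta> z *\<^sub>R \<gamma>' z) = 0"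
  shows "(\<forall>z\<in>Z. \<alpha> z = 0) \<and> (\<forall>z\<in>D. \<beta> z = 0)"
proof -
  have finD: "finite D" using D Z(1) finite_subset by blast
  have pair: "(\<Sum>z\<in>Z. \<alpha> z * (c0 + c \<bullet> \<gamma> z)) + (\<Sum>z\<in>D. \<beta> z * (c \<bullet> \<gamma>' z)) = 0" for c0 c
  proof -
    have "(\<Sum>z\<in>Z. \<alpha> z * (c0 + c \<bullet> \<gamma> z)) + (\<Sum>z\<in>D. \<beta> z * (c \<bullet> \<gamma>' z)) =
      c0 * (\<Sum>z\<in>Z. \<alpha> z) + c \<bullet> ((\<Sum>z\<in>Z. \<alpha> z *\<^sub>R \<gamma> z) + (\<Sum>z\<in>D. \<beta> z *\<^sub>R \<gamma>' z))"
      by (simp add: inner_sum_right inner_add_right sum_distrib_left sum.distrib[symmetric] algebra_simps)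
    then show ?thesis using s0 s1 by simp
  qed
  have \<beta>: "\<beta> y = 0" if y: "y \<in> D" for y
  proof -
    obtain E where E: "finite E" "card E = Suc CARD('m) - (card Z + card D)" "E \<subseteq> {a..b}" "E \<inter> Z = {}"
      using ex_more_points[OF Z(1)] by blast
    have cZE: "card (Z \<union> E) = card Z + card E" using E Z(1) by (intro card_Un_disjoint) auto
    have cD: "card D = Suc (card (D - {y}))" by (rule card.remove[OF finD y])
    have "card (Z \<union> E) + card (D - {y}) = CARD('m)" using cZE cD E(2) cd by arith
    then obtain c0 c where c: "c0 \<noteq> 0 \<or> c \<noteq> 0" "\<And>z. z \<in> Z \<union> E \<Longrightarrow> c0 + c \<bullet> \<gamma> z = 0"
        "\<And>z. z \<in> D - {y} \<Longrightarrow> c \<bullet> \<gamma>' z = 0"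
      using ex_touching_functional[of "Z \<union> E" "D - {y}"] E(1) Z(1) finD by (metis finite_Diff finite_UnI order_refl)
    have ne: "c \<bullet> \<gamma>' y \<noteq> 0"
    proof
      assume "c \<bullet> \<gamma>' y = 0"
      then have "card (Z \<union> E) + card D \<le> CARD('m)"
        using c(3) E Z D by (intro zero_count[OF c(1) _ _ c(2)]) auto
      then show False using cZE E(2) cd by arith
    qed
    have "(\<Sum>z\<in>D. \<beta> z * (c \<bullet> \<gamma>' z)) = \<beta> y * (c \<bullet> \<gamma>' y)"
      using c(3) y finD by (subst sum.remove[of _ y]) auto
    moreover have "(\<Sum>z\<in>Z. \<alpha> z * (c0 + c \<bullet> \<gamma> z)) = 0" using c(2) by (intro sum.neutral) auto
    ultimately show ?thesis using pair[of c0 c] ne by simp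
  qed
  have "\<alpha> y = 0" if y: "y \<in> Z" for y
  proof -
    have le: "card Z \<le> Suc CARD('m)" using cd by simp
    obtain E where E: "finite E" "card E = Suc CARD('m) - card Z" "E \<subseteq> {a..b}" "E \<inter> Z = {}"
      using ex_more_points[OF Z(1)] by blast
    have cZ: "card Z = Suc (card (Z - {y}))" by (rule card.remove[OF Z(1) y])
    have cZE: "card ((Z - {y}) \<union> E) = card (Z - {y}) + card E" using E Z(1) by (intro card_Un_disjoint) auto
    have "card ((Z - {y}) \<union> E) \<le> CARD('m)" using cZE cZ E(2) le by arith
    then obtain c0 c where c: "c0 \<noteq> 0 \<or> c \<noteq> 0" "\<And>z. z \<in> (Z - {y}) \<union> E \<Longrightarrow> c0 + c \<bullet> \<gamma> z = 0"
      using ex_touching_functional[of "(Z - {y}) \<union> E" "{}"] E(1) Z(1)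
      by (metis add_0_right card.empty finite_Diff finite_UnI finite.emptyI)
    have ne: "c0 + c \<bullet> \<gamma> y \<noteq> 0"
    proof
      assume 0: "c0 + c \<bullet> \<gamma> y = 0"
      have "card (Z \<union> E) + card ({} :: real set) \<le> CARD('m)"
      proof (rule zero_count[OF c(1)])
        show "c0 + c \<bullet> \<gamma> z = 0" if "z \<in> Z \<union> E" for z using c(2)[of z] 0 that by (cases "z = y") auto
      qed (use E Z in auto)
      then have "card (Z \<union> E) \<le> CARD('m)" by simp
      moreover have "card (Z \<union> E) = card Z + card E" using E Z(1) by (intro card_Un_disjoint) auto
      ultimately show False using E(2) le by arith
    qed
    have "(\<Sum>z\<in>Z. \<alpha> z * (c0 + c \<bullet> \<gamma> z)) = \<alpha> y * (c0 + c \<bullet> \<gamma> y)"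
      using c(2) y Z(1) by (subst sum.remove[of _ y]) auto
    moreover have "(\<Sum>z\<in>D. \<beta> z * (c \<bullet> \<gamma>' z)) = 0" using \<beta> by (intro sum.neutral) auto
    ultimately show ?thesis using pair[of c0 c] ne by simp
  qed
  then show ?thesis using \<beta> by blast
qed

lemma convex_combination_unique:
  assumes "finite Z" "finite Z'" "Z \<subseteq> {a..b}" "Z' \<subseteq> {a..b}" "card (Z \<union> Z') \<le> Suc CARD('m)"
    and "\<And>z. z \<in> Z \<Longrightarrow> \<mu> z \<noteq> 0" "\<And>z. z \<in> Z' \<Longrightarrow> \<mu>' z \<noteq> 0"
    and "sum \<mu> Z = sum \<mu>' Z'" "(\<Sum>z\<in>Z. \<mu> z *\<^sub>R \<gamma> z) = (\<Sum>z\<in>Z'. \<mu>' z *\<^sub>R \<gamma> z)"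
  shows "Z = Z' \<and> (\<forall>z\<in>Z. \<mu> z = \<mu>' z)"
proof -
  define m where "m = (\<lambda>z. if z \<in> Z then \<mu> z else 0)"
  define m' where "m' = (\<lambda>z. if z \<in> Z' then \<mu>' z else 0)"
  have 0: "(\<Sum>z\<in>Z \<union> Z'. m z) = sum \<mu> Z" "(\<Sum>z\<in>Z \<union> Z'. m' z) = sum \<mu>' Z'"
    unfolding m_def m'_def using assms(1,2)
    by (auto simp: sum.If_cases Int_absorb1 intro!: sum.mono_neutral_cong_right)
  have 1: "(\<Sum>z\<in>Z \<union> Z'. m z *\<^sub>R \<gamma> z) = (\<Sum>z\<in>Z. \<mu> z *\<^sub>R \<gamma> z)"
    "(\<Sum>z\<in>Z \<union> Z'. m' z *\<^sub>R \<gamma> z) = (\<Sum>z\<in>Z'. \<mu>' z *\<^sub>R \<gamma> z)"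
    unfolding m_def m'_def using assms(1,2) by (auto intro!: sum.mono_neutral_cong_right)
  have "\<forall>z\<in>Z \<union> Z'. m z - m' z = 0"
    using independent_points_and_tangents[of "Z \<union> Z'" "{}" "\<lambda>z. m z - m' z" "\<lambda>_. 0"] assms 0 1
    by (simp add: sum_subtractf scaleR_left_diff_distrib)
  then have *: "m z = m' z" if "z \<in> Z \<union> Z'" for z using that by auto
  have "z \<in> Z \<longleftrightarrow> z \<in> Z'" for z
    using *[of z] assms(6,7) unfolding m_def m'_def by (cases "z \<in> Z"; cases "z \<in> Z'") auto
  then have "Z = Z'" by blast
  moreover have "\<mu> z = \<mu>' z" if "z \<in> Z" for z
    using *[of z] that \<open>Z = Z'\<close> unfolding m_def m'_def by auto
  ultimately show ?thesis by blast
qed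

section \<open>The frontier of the convex hull\<close>

abbreviation K where "K \<equiv> convex hull (\<gamma> ` {a..b})"

lemma \<gamma>_cont: "continuous_on {a..b} \<gamma>"
  using C1 unfolding C_k_on_def by force

lemma compact_K: "compact K"
  by (intro compact_convex_hull compact_continuous_image \<gamma>_cont) auto

lemma frontier_K_iff: "p \<in> frontier K \<longleftrightarrow> p \<in> K \<and> p \<notin> interior K"
  using compact_K by (auto simp: frontier_def compact_imp_closed closure_closed)

text \<open>
  There are as many conditions as the dimension allows, so some functional vanishes at the points of \<open>Z\<close>,
  to second order at the interior ones. It has constant sign by the lemma \<open>no_sign_change\<close>,
  hence it supports \<open>K\<close> at all convex combinations of these points.
\<close>

lemma touching_point_in_frontier:
  assumes Z: "finite Z" "Z \<subseteq> {a..b}" "card Z + card (Z \<inter> {a<..<b}) = CARD('m)"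
    and \<mu>: "\<And>z. z \<in> Z \<Longrightarrow> \<mu> z \<ge> 0" "sum \<mu> Z = 1"
  shows "(\<Sum>z\<in>Z. \<mu> z *\<^sub>R \<gamma> z) \<in> frontier K"
proof -
  let ?p = "\<Sum>z\<in>Z. \<mu> z *\<^sub>R \<gamma> z"
  obtain c0 c where c: "c0 \<noteq> 0 \<or> c \<noteq> 0" "\<And>z. z \<in> Z \<Longrightarrow> c0 + c \<bullet> \<gamma> z = 0"
      "\<And>z. z \<in> Z \<inter> {a<..<b} \<Longrightarrow> c \<bullet> \<gamma>' z = 0"
    using ex_touching_functional[of Z "Z \<inter> {a<..<b}"] Z by (metis finite_Int order_refl)
  have "Z \<noteq> {}" using \<mu>(2) by auto
  then have c': "c \<noteq> 0" using c(1,2) by fastforce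
  have same: "c0 + c \<bullet> \<gamma> t \<ge> 0" if "t \<in> {a..b}" "s \<in> {a..b}" "c0 + c \<bullet> \<gamma> s > 0" for s t
  proof -
    consider "s < t" | "s = t" | "t < s" by linarith
    then show ?thesis
    proof cases
      case 1
      then show ?thesis using no_sign_change[OF c(1) Z(1,2) c(2,3) Z(3), of s t] that by auto
    next
      case 3
      show ?thesis
      proof (rule ccontr)
        assume "\<not> ?thesis"
        then have "- c0 + (- c) \<bullet> \<gamma> t > 0" by simp
        moreover have "- c0 + (- c) \<bullet> \<gamma> z = 0" if "z \<in> Z" for z using c(2)[OF that] by simp
        moreover have "(- c) \<bullet> \<gamma>' z = 0" if "z \<in> Z \<inter> {a<..<b}" for z using c(3)[OF that] by simp
        moreover have "- c0 \<noteq> 0 \<or> - c \<noteq> 0" using c(1) by simp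
        ultimately have "- c0 + (- c) \<bullet> \<gamma> s \<ge> 0"
          using no_sign_change[of "- c0" "- c" Z t s] Z 3 that by auto
        then show False using that by simp
      qed
    qed (use that in auto)
  qed
  have pK: "?p \<in> K"
    using Z \<mu> by (intro convex_sum convex_convex_hull hull_inc) auto
  have cp: "c0 + c \<bullet> ?p = 0"
  proof -
    have "c0 + c \<bullet> ?p = (\<Sum>z\<in>Z. \<mu> z * (c0 + c \<bullet> \<gamma> z))"
      using \<mu>(2) by (simp add: inner_sum_right algebra_simps sum.distrib flip: sum_distrib_left)
    then show ?thesis using c(2) by simp
  qed
  \<comment> \<open>the sign of the functional\<close>
  obtain e :: real where e: "e \<noteq> 0" "\<And>t. t \<in> {a..b} \<Longrightarrow> e * (c0 + c \<bullet> \<gamma> t) \<ge> 0"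
  proof (cases "\<exists>s\<in>{a..b}. c0 + c \<bullet> \<gamma> s > 0")
    case True
    then show ?thesis using same that[of 1] by auto
  next
    case False
    then show ?thesis using that[of "-1"] by force
  qed
  have half: "(e *\<^sub>R c) \<bullet> y \<ge> - (e * c0)" if "y \<in> K" for y
  proof -
    have "(e *\<^sub>R c) \<bullet> \<gamma> t \<ge> - (e * c0)" if "t \<in> {a..b}" for t
      using e(2)[OF that] unfolding distrib_left inner_scaleR_left by linarith
    then have "\<gamma> ` {a..b} \<subseteq> {y. (e *\<^sub>R c) \<bullet> y \<ge> - (e * c0)}" by blast
    then have "K \<subseteq> {y. (e *\<^sub>R c) \<bullet> y \<ge> - (e * c0)}" by (intro hull_minimal convex_halfspace_ge)
    then show ?thesis using that by blast
  qed
  have "?p \<notin> interior K"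
  proof
    assume "?p \<in> interior K"
    then obtain d where d: "d > 0" "cball ?p d \<subseteq> K" by (meson mem_interior_cball)
    define u where "u = e *\<^sub>R c"
    have "u \<noteq> 0" using e c' by (simp add: u_def)
    define q where "q = ?p - (d / norm u) *\<^sub>R u"
    have "q \<in> cball ?p d" using d \<open>u \<noteq> 0\<close> by (simp add: q_def dist_norm)
    then have "u \<bullet> q \<ge> - (e * c0)" using half d(2) unfolding u_def by blast
    moreover have "u \<bullet> q = u \<bullet> ?p - d * norm u"
      using \<open>u \<noteq> 0\<close> unfolding q_def by (simp add: inner_diff_right dot_square_norm power2_eq_square)
    moreover have "u \<bullet> ?p = - (e * c0)" using cp unfolding u_def by (simp add: eq_neg_iff_add_eq_0) (metis add.commute distrib_left mult_zero_right)
    ultimately show False using d(1) \<open>u \<noteq> 0\<close> by (smt (verit) zero_less_norm_iff mult_pos_pos)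
  qed
  then show ?thesis using pK frontier_K_iff by blast
qed

text \<open>
  The points occurring in a convex representation of \<open>p\<close> are zeros of a functional supporting \<open>K\<close> at
  \<open>p\<close>. At its zeros in the open interval this functional has a minimum, so they count twice.
\<close>

lemma frontier_point_supported:
  assumes "p \<in> frontier K"
  obtains Z \<mu> where "finite Z" "Z \<subseteq> {a..b}" "card Z + card (Z \<inter> {a<..<b}) \<le> CARD('m)"
    "\<And>z. z \<in> Z \<Longrightarrow> \<mu> z \<ge> 0" "sum \<mu> Z = 1" "p = (\<Sum>z\<in>Z. \<mu> z *\<^sub>R \<gamma> z)"
proof -
  have p: "p \<in> K" "p \<notin> interior K" using assms frontier_K_iff by auto
  have fin: "finite {t\<in>{a..b}. c0 + c \<bullet> \<gamma> t = 0}" if "c \<noteq> 0" for c0 c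
  proof (rule ccontr)
    assume "infinite {t\<in>{a..b}. c0 + c \<bullet> \<gamma> t = 0}"
    then obtain Z where Z: "finite Z" "card Z = Suc CARD('m)" "Z \<subseteq> {t\<in>{a..b}. c0 + c \<bullet> \<gamma> t = 0}"
      using infinite_arbitrarily_large by blast
    have "card Z + card ({} :: real set) \<le> CARD('m)"
      by (rule zero_count[of c0 c]) (use Z that in auto)
    then show False using Z(2) by simp
  qed
  \<comment> \<open>otherwise the curve lies in a hyperplane, and some functional has infinitely many zeros\<close>
  have "interior K \<noteq> {}"
  proof
    assume "interior K = {}"
    then obtain c d where c: "c \<noteq> 0" "K \<subseteq> {x. c \<bullet> x = d}"
      using empty_interior_subset_hyperplane[of K] convex_convex_hull by metis
    have "\<gamma> t \<in> K" if "t \<in> {a..b}" for t using that by (intro hull_inc) auto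
    then have "c \<bullet> \<gamma> t = d" if "t \<in> {a..b}" for t using c(2) that by blast
    then have "- d + c \<bullet> \<gamma> t = 0" if "t \<in> {a..b}" for t using that by (metis add.left_inverse)
    then have "{t\<in>{a..b}. - d + c \<bullet> \<gamma> t = 0} = {a..b}" by blast
    then show False using fin[OF c(1), of "- d"] infinite_Icc[OF ab] by metis
  qed
  then have "p \<notin> rel_interior K" using p(2) rel_interior_nonempty_interior by blast
  then obtain c where c: "c \<noteq> 0" "\<And>y. y \<in> K \<Longrightarrow> c \<bullet> p \<le> c \<bullet> y"
    using supporting_hyperplane_rel_boundary[OF convex_convex_hull p(1)] by metis
  define g where "g = (\<lambda>t. - (c \<bullet> p) + c \<bullet> \<gamma> t)"
  have g_nn: "g t \<ge> 0" if "t \<in> {a..b}" for t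
    using c(2)[of "\<gamma> t"] that unfolding g_def by (simp add: hull_inc)
  define Z where "Z = {t\<in>{a..b}. g t = 0}"
  have finZ: "finite Z" unfolding Z_def g_def by (rule fin[OF c(1)])
  have cardZ: "card Z + card (Z \<inter> {a<..<b}) \<le> CARD('m)"
  proof (rule zero_count[of "- (c \<bullet> p)" c])
    fix z assume z: "z \<in> Z \<inter> {a<..<b}"
    then have zab: "z \<in> {a<..<b}" by blast
    have der: "(g has_real_derivative c \<bullet> G 1 z) (at z)"
      unfolding g_def by (rule curve_functional_deriv[OF zab])
    define d where "d = min (z - a) (b - z)"
    have "d > 0" using zab unfolding d_def by simp
    moreover have "\<forall>y. \<bar>z - y\<bar> < d \<longrightarrow> g z \<le> g y"
    proof (intro allI impI)
      fix y assume "\<bar>z - y\<bar> < d"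
      then have "y \<in> {a..b}" unfolding d_def by auto
      then show "g z \<le> g y" using g_nn[of y] z unfolding Z_def by simp
    qed
    ultimately have "c \<bullet> G 1 z = 0" using DERIV_local_min[OF der] by blast
    then show "c \<bullet> \<gamma>' z = 0" using \<gamma>'_eq[OF zab] by simp
  qed (use finZ c(1) Z_def g_def in auto)
  obtain S u where S: "finite S" "S \<subseteq> \<gamma> ` {a..b}" "\<forall>x\<in>S. 0 \<le> u x" "sum u S = 1" "(\<Sum>v\<in>S. u v *\<^sub>R v) = p"
    using p(1) unfolding convex_hull_explicit by blast
  have supp: "v \<in> \<gamma> ` Z" if v: "v \<in> S" "u v \<noteq> 0" for v
  proof -
    have nn: "u w * (- (c \<bullet> p) + c \<bullet> w) \<ge> 0" if w: "w \<in> S" for w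
    proof -
      obtain t where "t \<in> {a..b}" "w = \<gamma> t" using S(2) w by blast
      then show ?thesis using g_nn[of t] S(3) w unfolding g_def by simp
    qed
    have "(\<Sum>w\<in>S. u w * (- (c \<bullet> p) + c \<bullet> w)) = - (c \<bullet> p) * sum u S + c \<bullet> (\<Sum>v\<in>S. u v *\<^sub>R v)"
      by (simp add: inner_sum_right algebra_simps sum.distrib sum_subtractf sum_distrib_right)
    also have "\<dots> = 0" using S by simp
    finally have "u v * (- (c \<bullet> p) + c \<bullet> v) = 0"
      using sum_nonneg_eq_0_iff[OF S(1), of "\<lambda>w. u w * (- (c \<bullet> p) + c \<bullet> w)"] nn v(1) by blast
    then have "- (c \<bullet> p) + c \<bullet> v = 0" using v(2) by simp
    moreover obtain t where "t \<in> {a..b}" "v = \<gamma> t" using S(2) v(1) by blast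
    ultimately show ?thesis unfolding Z_def g_def by auto
  qed
  have inj: "inj_on \<gamma> {a..b}"
  proof (rule inj_onI, rule ccontr)
    fix x y assume xy: "x \<in> {a..b}" "y \<in> {a..b}" "\<gamma> x = \<gamma> y" "x \<noteq> y"
    have "0 < CARD('m)" by (rule zero_less_card_finite)
    then have "card ({x} \<union> {y}) \<le> Suc CARD('m)" using xy(4) by simp
    then have "{x} = {y}"
      using convex_combination_unique[of "{x}" "{y}" "\<lambda>_. 1" "\<lambda>_. 1"] xy(1-3) by simp
    then show False using xy(4) by simp
  qed
  define \<mu> where "\<mu> = (\<lambda>z. if \<gamma> z \<in> S then u (\<gamma> z) else 0)"
  have injZ: "inj_on \<gamma> Z" using inj by (rule inj_on_subset) (auto simp: Z_def)
  have tr: "(\<Sum>z\<in>Z. h (\<mu> z) (\<gamma> z)) = (\<Sum>v\<in>S. h (u v) v)" if h: "\<And>v. h 0 v = 0"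
    for h :: "real \<Rightarrow> real ^ 'm::{finite,linorder} \<Rightarrow> 'c::comm_monoid_add"
  proof -
    have "(\<Sum>z\<in>Z. h (\<mu> z) (\<gamma> z)) = (\<Sum>v\<in>\<gamma> ` Z. h (if v \<in> S then u v else 0) v)"
      by (simp add: sum.reindex[OF injZ] \<mu>_def)
    also have "\<dots> = (\<Sum>v\<in>\<gamma> ` Z \<inter> S. h (u v) v)"
      using finZ h by (intro sum.mono_neutral_cong_right) auto
    also have "\<dots> = (\<Sum>v\<in>S. h (u v) v)"
    proof (rule sum.mono_neutral_left)
      show "\<forall>v\<in>S - \<gamma> ` Z \<inter> S. h (u v) v = 0" using supp h by (metis DiffD1 DiffD2 IntI)
    qed (use S(1) in auto)
    finally show ?thesis .
  qed
  show ?thesis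
  proof (rule that[OF finZ _ cardZ])
    show "Z \<subseteq> {a..b}" by (auto simp: Z_def)
    show "\<mu> z \<ge> 0" for z using S(3) by (simp add: \<mu>_def)
    show "sum \<mu> Z = 1" using tr[of "\<lambda>r v. r"] S(4) by simp
    show "p = (\<Sum>z\<in>Z. \<mu> z *\<^sub>R \<gamma> z)" using tr[of "\<lambda>r v. r *\<^sub>R v"] S(5) by simp
  qed
qed

end

section \<open>Families of inscribed simplices\<close>

lemma ex_strict_mono_enumeration:
  fixes M :: "nat set" and A :: "real set"
  assumes "finite M" "finite A" "card A = card M"
  shows "\<exists>x. strict_mono_on M x \<and> x ` M = A"
  using assms
proof (induction M arbitrary: A rule: finite_linorder_max_induct)
  case empty
  then show ?case by simp
next
  case (insert m M)
  have mM: "m \<notin> M" using insert.hyps(2) by auto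
  then have c: "card A = Suc (card M)" using insert.prems insert.hyps(1) by simp
  then have "A \<noteq> {}" by auto
  then have mx: "Max A \<in> A" "\<And>x. x \<in> A \<Longrightarrow> x \<le> Max A" using insert.prems by auto
  have "card (A - {Max A}) = card M" using c mx(1) insert.prems(1) by simp
  then obtain x where x: "strict_mono_on M x" "x ` M = A - {Max A}"
    using insert.IH[of "A - {Max A}"] insert.prems(1) by blast
  have lt: "x i < Max A" if "i \<in> M" for i
  proof -
    have "x i \<in> A - {Max A}" using x(2) that by blast
    then show ?thesis using mx(2) by (simp add: order_less_le)
  qed
  define y where "y = x(m := Max A)"
  have "strict_mono_on (insert m M) y"
  proof (rule strict_mono_onI)
    fix r s assume rs: "r \<in> insert m M" "s \<in> insert m M" "r < s"
    then have r: "r \<in> M" "r \<noteq> m" using insert.hyps(2) by fastforce+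
    show "y r < y s"
      using rs r lt x(1) by (auto simp: y_def strict_mono_on_def)
  qed
  moreover have "y ` insert m M = A"
  proof -
    have "y ` M = x ` M" unfolding y_def using mM by (intro image_cong) auto
    then show ?thesis using x(2) mx(1) unfolding y_def by auto
  qed
  ultimately show ?case by blast
qed

lemma strict_mono_enumeration_unique:
  fixes x y :: "nat \<Rightarrow> real"
  assumes "finite M" "strict_mono_on M x" "strict_mono_on M y" "x ` M = y ` M" "i \<in> M"
  shows "x i = y i"
  using assms
proof (induction M arbitrary: i rule: finite_linorder_max_induct)
  case (insert m M)
  have mM: "m \<notin> M" using insert.hyps(2) by auto
  have le: "z i \<le> z m" if "strict_mono_on (insert m M) z" "i \<in> insert m M" for z :: "nat \<Rightarrow> real" and i
    using that insert.hyps(2) strict_mono_onD[OF that(1) that(2), of m] by (cases "i = m") auto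
  have "x m \<in> y ` insert m M" unfolding insert.prems(3)[symmetric] by (rule imageI) simp
  moreover have "y m \<in> x ` insert m M" unfolding insert.prems(3) by (rule imageI) simp
  ultimately have eq: "x m = y m"
    using le[OF insert.prems(1)] le[OF insert.prems(2)] by (metis antisym imageE)
  have ne: "z i \<noteq> z m" if "strict_mono_on (insert m M) z" "i \<in> M" for z :: "nat \<Rightarrow> real" and i
    using that insert.hyps(2) strict_mono_onD[OF that(1), of i m] by fastforce
  have im: "z ` M = z ` insert m M - {z m}" if "strict_mono_on (insert m M) z" for z :: "nat \<Rightarrow> real"
    using ne[OF that] by auto
  have mono: "strict_mono_on M x" "strict_mono_on M y"
    using insert.prems(1,2) by (auto simp: strict_mono_on_def)
  have "x ` M = y ` M" unfolding im[OF insert.prems(1)] im[OF insert.prems(2)] insert.prems(3) eq ..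
  then show ?case using insert.IH[OF mono] insert.prems(4) eq by blast
qed simp

text \<open>
  A family of simplices with vertices on the curve, indexed by \<open>P\<close>: the vertices in \<open>M\<close> move in the
  interval, the others are fixed at one of its ends. The weight of the vertex \<open>p0\<close> is determined by
  the others. The condition \<open>dim_eq\<close> says both that the family has \<open>card P - 1 + card M = n\<close> parameters
  and that its vertices, with the moving ones counted twice, exhaust the zero count \<open>N\<close>.
\<close>

locale simplex_family = torsion_curve \<gamma> a b
  for \<gamma> :: "real \<Rightarrow> real ^ 'm::{finite,linorder}" and a b :: real +
  fixes P M :: "nat set" and p0 :: nat and e :: "nat \<Rightarrow> real"
  assumes finite_P: "finite P" and p0: "p0 \<in> P" and M_sub: "M \<subseteq> P"
    and e_ends: "\<And>i. i \<in> P - M \<Longrightarrow> e i \<in> {a, b}" and e_inj: "inj_on e (P - M)"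
    and dim_eq: "card P + card M = CARD('m)"
begin

definition node :: "(nat \<Rightarrow> real) \<Rightarrow> nat \<Rightarrow> real" where
  "node x i = (if i \<in> M then x i else e i)"

definition weight :: "(nat \<Rightarrow> real) \<Rightarrow> nat \<Rightarrow> real" where
  "weight w i = (if i = p0 then 1 - sum w (P - {p0}) else w i)"

definition hull_point :: "(nat \<Rightarrow> real) \<Rightarrow> (nat \<Rightarrow> real) \<Rightarrow> real ^ 'm::{finite,linorder}" where
  "hull_point w x = (\<Sum>i\<in>P. weight w i *\<^sub>R \<gamma> (node x i))"

definition generic :: "(nat \<Rightarrow> real) \<Rightarrow> (nat \<Rightarrow> real) \<Rightarrow> bool" where
  "generic w x \<longleftrightarrow> (\<forall>i\<in>P. weight w i > 0) \<and> strict_mono_on M x \<and> (\<forall>i\<in>M. a < x i \<and> x i < b)"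

definition admissible :: "(nat \<Rightarrow> real) \<Rightarrow> (nat \<Rightarrow> real) \<Rightarrow> bool" where
  "admissible w x \<longleftrightarrow> (\<forall>i\<in>P. weight w i \<ge> 0) \<and> x \<in> ordered_points M a b"

lemma finite_M: "finite M" using finite_P M_sub finite_subset by blast

lemma sum_weight: "sum (weight w) P = 1"
proof -
  have "sum (weight w) P = weight w p0 + sum (weight w) (P - {p0})"
    by (rule sum.remove[OF finite_P p0])
  also have "sum (weight w) (P - {p0}) = sum w (P - {p0})"
    by (rule sum.cong) (auto simp: weight_def)
  finally show ?thesis by (simp add: weight_def)
qed

lemma node_image: "node x ` P = x ` M \<union> e ` (P - M)"
  using M_sub by (auto simp: node_def image_def)

lemma node_inj:
  assumes "strict_mono_on M x" "\<And>i. i \<in> M \<Longrightarrow> x i \<notin> e ` (P - M)"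
  shows "inj_on (node x) P"
proof (rule inj_onI)
  fix i j assume ij: "i \<in> P" "j \<in> P" "node x i = node x j"
  have "inj_on x M" using assms(1) by (rule strict_mono_on_imp_inj_on)
  moreover have "x k \<noteq> e l \<and> e l \<noteq> x k" if "k \<in> M" "l \<in> P" "l \<notin> M" for k l
    using assms(2)[OF that(1)] that(2,3) by (metis DiffI image_eqI)
  ultimately show "i = j"
    using ij e_inj unfolding node_def inj_on_def by (auto split: if_splits)
qed

lemma generic_nodes:
  assumes "generic w x"
  shows "inj_on (node x) P" "finite (node x ` P)" "node x ` P \<subseteq> {a..b}"
    "node x ` P \<inter> {a<..<b} = x ` M" "node x ` P \<inter> {a, b} = e ` (P - M)"
    "card (node x ` P) = card P" "card (x ` M) = card M"
proof -
  have g: "strict_mono_on M x" "\<And>i. i \<in> M \<Longrightarrow> a < x i \<and> x i < b" using assms by (auto simp: generic_def)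
  have xe: "x i \<notin> e ` (P - M)" if "i \<in> M" for i using g(2)[OF that] e_ends by force
  show inj: "inj_on (node x) P" using node_inj[OF g(1) xe] .
  show "finite (node x ` P)" using finite_P by simp
  have E: "e ` (P - M) \<subseteq> {a, b}" using e_ends by blast
  have X: "x ` M \<subseteq> {a<..<b}" using g(2) by auto
  show "node x ` P \<subseteq> {a..b}" unfolding node_image using E X ab by fastforce
  show "node x ` P \<inter> {a<..<b} = x ` M" unfolding node_image using E X by fastforce
  show "node x ` P \<inter> {a, b} = e ` (P - M)" unfolding node_image using E X by fastforce
  show "card (node x ` P) = card P" by (rule card_image[OF inj])
  show "card (x ` M) = card M" by (rule card_image[OF strict_mono_on_imp_inj_on[OF g(1)]])
qed

lemma hull_point_nodes:
  assumes "generic w x" 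
  defines "\<mu> \<equiv> \<lambda>z. weight w (the_inv_into P (node x) z)"
  shows "hull_point w x = (\<Sum>z\<in>node x ` P. \<mu> z *\<^sub>R \<gamma> z)" "sum \<mu> (node x ` P) = 1"
    "\<And>i. i \<in> P \<Longrightarrow> \<mu> (node x i) = weight w i" "\<And>z. z \<in> node x ` P \<Longrightarrow> \<mu> z > 0"
proof -
  note inj = generic_nodes(1)[OF assms(1)]
  show \<mu>: "\<mu> (node x i) = weight w i" if "i \<in> P" for i
    unfolding \<mu>_def using that by (simp add: the_inv_into_f_f[OF inj])
  show "hull_point w x = (\<Sum>z\<in>node x ` P. \<mu> z *\<^sub>R \<gamma> z)"
    unfolding hull_point_def sum.reindex[OF inj] using \<mu> by (intro sum.cong) auto
  have "sum \<mu> (node x ` P) = sum (weight w) P"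
    unfolding sum.reindex[OF inj] using \<mu> by (intro sum.cong) auto
  then show "sum \<mu> (node x ` P) = 1" using sum_weight by simp
  show "\<mu> z > 0" if "z \<in> node x ` P" for z
    using that \<mu> assms(1) unfolding generic_def by auto
qed

lemma generic_in_frontier:
  assumes "generic w x"
  shows "hull_point w x \<in> frontier K"
proof -
  note n = generic_nodes[OF assms] and h = hull_point_nodes[OF assms]
  have "card (node x ` P) + card (node x ` P \<inter> {a<..<b}) = CARD('m)"
    unfolding n using dim_eq by simp
  then show ?thesis unfolding h(1)
    by (rule touching_point_in_frontier[OF n(2,3)]) (use h(2,4) in \<open>auto intro: less_imp_le\<close>)
qed

text \<open>
  Two simplices of the family have the same fixed vertices, so together they have at most
  \<open>card P + card M = N\<close> vertices. Independence makes the vertices and weights unique, and the order of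
  the moving vertices recovers their indices.
\<close>

lemma generic_inj:
  assumes "generic w x" "generic w' x'" "hull_point w x = hull_point w' x'"
  shows "(\<forall>i\<in>P - {p0}. w i = w' i) \<and> (\<forall>i\<in>M. x i = x' i)"
proof -
  note n = generic_nodes[OF assms(1)] and h = hull_point_nodes[OF assms(1)]
  note n' = generic_nodes[OF assms(2)] and h' = hull_point_nodes[OF assms(2)]
  have U: "node x ` P \<union> node x' ` P = node x ` P \<union> x' ` M" unfolding node_image by blast
  have "card (node x ` P \<union> node x' ` P) \<le> card (node x ` P) + card (x' ` M)"
    unfolding U by (rule card_Un_le)
  then have c: "card (node x ` P \<union> node x' ` P) \<le> Suc CARD('m)" using n(6) n'(7) dim_eq by simp
  define \<mu> where "\<mu> = (\<lambda>z. weight w (the_inv_into P (node x) z))"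
  define \<mu>' where "\<mu>' = (\<lambda>z. weight w' (the_inv_into P (node x') z))"
  have eq: "node x ` P = node x' ` P \<and> (\<forall>z\<in>node x ` P. \<mu> z = \<mu>' z)"
  proof (rule convex_combination_unique[OF n(2) n'(2) n(3) n'(3) c])
    show "\<mu> z \<noteq> 0" if "z \<in> node x ` P" for z using h(4)[OF that] by (simp add: \<mu>_def)
    show "\<mu>' z \<noteq> 0" if "z \<in> node x' ` P" for z using h'(4)[OF that] by (simp add: \<mu>'_def)
    show "sum \<mu> (node x ` P) = sum \<mu>' (node x' ` P)" using h(2) h'(2) by (simp add: \<mu>_def \<mu>'_def)
    show "(\<Sum>z\<in>node x ` P. \<mu> z *\<^sub>R \<gamma> z) = (\<Sum>z\<in>node x' ` P. \<mu>' z *\<^sub>R \<gamma> z)"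
      using h(1) h'(1) assms(3) by (simp add: \<mu>_def \<mu>'_def)
  qed
  then have "x ` M = x' ` M" using n(4) n'(4) by simp
  then have xx: "x i = x' i" if "i \<in> M" for i
    using strict_mono_enumeration_unique[OF finite_M _ _ _ that] assms(1,2) unfolding generic_def by blast
  then have nn: "node x i = node x' i" for i by (simp add: node_def)
  have "w i = w' i" if "i \<in> P - {p0}" for i
  proof -
    have "weight w i = weight w' i"
      using eq that h(3)[of i] h'(3)[of i] nn[of i] unfolding \<mu>_def \<mu>'_def by (metis DiffD1 image_eqI)
    then show ?thesis using that by (simp add: weight_def)
  qed
  then show ?thesis using xx by blast
qed

text \<open>
  This is injectivity of the derivative of the parametrization: the vertices and the tangents at the moving
  vertices are \<open>N\<close> vectors in all, and a relation between differences of vertices is a relation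
  between vertices whose coefficients add up to zero.
\<close>

lemma tangent_independent:
  assumes "generic w x"
    and 0: "(\<Sum>i\<in>P - {p0}. u i *\<^sub>R (\<gamma> (node x i) - \<gamma> (node x p0))) + (\<Sum>i\<in>M. v i *\<^sub>R weight w i *\<^sub>R \<gamma>' (x i)) = 0"
  shows "(\<forall>i\<in>P - {p0}. u i = 0) \<and> (\<forall>i\<in>M. v i = 0)"
proof -
  note n = generic_nodes[OF assms(1)]
  have injx: "inj_on x M" using assms(1) strict_mono_on_imp_inj_on unfolding generic_def by blast
  define u' where "u' = (\<lambda>i. if i = p0 then - sum u (P - {p0}) else u i)"
  have u'P: "(\<Sum>i\<in>P - {p0}. h (u' i) i) = (\<Sum>i\<in>P - {p0}. h (u i) i)" for h :: "real \<Rightarrow> nat \<Rightarrow> 'c::comm_monoid_add"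
    by (rule sum.cong) (auto simp: u'_def)
  define \<alpha> where "\<alpha> = (\<lambda>z. u' (the_inv_into P (node x) z))"
  define \<beta> where "\<beta> = (\<lambda>z. v (the_inv_into M x z) * weight w (the_inv_into M x z))"
  have \<alpha>: "\<alpha> (node x i) = u' i" if "i \<in> P" for i
    unfolding \<alpha>_def using that by (simp add: the_inv_into_f_f[OF n(1)])
  have \<beta>: "\<beta> (x i) = v i * weight w i" if "i \<in> M" for i
    unfolding \<beta>_def using that by (simp add: the_inv_into_f_f[OF injx])
  have s0: "sum \<alpha> (node x ` P) = 0"
  proof -
    have "sum \<alpha> (node x ` P) = sum u' P"
      unfolding sum.reindex[OF n(1)] using \<alpha> by (intro sum.cong) auto
    also have "\<dots> = u' p0 + sum u' (P - {p0})" by (rule sum.remove[OF finite_P p0])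
    also have "sum u' (P - {p0}) = sum u (P - {p0})" by (rule u'P[of "\<lambda>r i. r"])
    finally show ?thesis by (simp add: u'_def)
  qed
  have s1: "(\<Sum>z\<in>node x ` P. \<alpha> z *\<^sub>R \<gamma> z) + (\<Sum>z\<in>x ` M. \<beta> z *\<^sub>R \<gamma>' z) = 0"
  proof -
    have "(\<Sum>z\<in>node x ` P. \<alpha> z *\<^sub>R \<gamma> z) = (\<Sum>i\<in>P. u' i *\<^sub>R \<gamma> (node x i))"
      unfolding sum.reindex[OF n(1)] using \<alpha> by (intro sum.cong) auto
    also have "\<dots> = u' p0 *\<^sub>R \<gamma> (node x p0) + (\<Sum>i\<in>P - {p0}. u' i *\<^sub>R \<gamma> (node x i))"
      by (rule sum.remove[OF finite_P p0])
    also have "(\<Sum>i\<in>P - {p0}. u' i *\<^sub>R \<gamma> (node x i)) = (\<Sum>i\<in>P - {p0}. u i *\<^sub>R \<gamma> (node x i))"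
      by (rule u'P[of "\<lambda>r i. r *\<^sub>R \<gamma> (node x i)"])
    also have "u' p0 *\<^sub>R \<gamma> (node x p0) + (\<Sum>i\<in>P - {p0}. u i *\<^sub>R \<gamma> (node x i)) =
        (\<Sum>i\<in>P - {p0}. u i *\<^sub>R (\<gamma> (node x i) - \<gamma> (node x p0)))"
      by (simp add: u'_def scaleR_diff_right sum_subtractf scaleR_sum_left)
    finally have 1: "(\<Sum>z\<in>node x ` P. \<alpha> z *\<^sub>R \<gamma> z) = (\<Sum>i\<in>P - {p0}. u i *\<^sub>R (\<gamma> (node x i) - \<gamma> (node x p0)))" .
    have 2: "(\<Sum>z\<in>x ` M. \<beta> z *\<^sub>R \<gamma>' z) = (\<Sum>i\<in>M. v i *\<^sub>R weight w i *\<^sub>R \<gamma>' (x i))"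
      unfolding sum.reindex[OF injx] using \<beta> by (intro sum.cong) auto
    show ?thesis unfolding 1 2 using 0 .
  qed
  have "(\<forall>z\<in>node x ` P. \<alpha> z = 0) \<and> (\<forall>z\<in>x ` M. \<beta> z = 0)"
    by (rule independent_points_and_tangents[OF n(2,3) _ _ s0 s1])
       (use n(4) n(6,7) dim_eq in auto)
  then have u'0: "u' i = 0" if "i \<in> P" for i using \<alpha>[OF that] that by auto
  have v0: "v i = 0" if i: "i \<in> M" for i
  proof -
    have "v i * weight w i = 0" using \<open>_ \<and> (\<forall>z\<in>x ` M. \<beta> z = 0)\<close> \<beta>[OF i] i by auto
    moreover have "weight w i > 0" using assms(1) M_sub i unfolding generic_def by blast
    ultimately show ?thesis by simp
  qed
  show ?thesis
  proof (intro conjI ballI)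
    fix i assume "i \<in> P - {p0}"
    then show "u i = 0" using u'0[of i] by (simp add: u'_def)
  qed (rule v0)
qed

text \<open>
  If there are fewer than \<open>card M\<close> points outside the fixed ends, arbitrary further points of weight zero are
  added as vertices.
\<close>

lemma admissible_covers:
  assumes "finite Z" "Z \<subseteq> {a..b}" "card (Z - e ` (P - M)) \<le> card M"
    and "\<And>z. z \<in> Z \<Longrightarrow> \<mu> z \<ge> 0" "sum \<mu> Z = 1"
  shows "\<exists>w x. admissible w x \<and> hull_point w x = (\<Sum>z\<in>Z. \<mu> z *\<^sub>R \<gamma> z)"
proof -
  let ?E = "e ` (P - M)"
  have finE: "finite ?E" using finite_P by simp
  obtain F where F: "finite F" "card F = card M - card (Z - ?E)" "F \<subseteq> {a..b}" "F \<inter> (Z \<union> ?E) = {}"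
    using ex_more_points[of "Z \<union> ?E"] assms(1) finE by (metis finite_Un)
  define A where "A = (Z - ?E) \<union> F"
  have "card A = card (Z - ?E) + card F"
    unfolding A_def using F assms(1) by (intro card_Un_disjoint) auto
  then have "card A = card M" using F(2) assms(3) by simp
  moreover have "finite A" using F assms(1) by (simp add: A_def)
  ultimately obtain x where x: "strict_mono_on M x" "x ` M = A"
    using ex_strict_mono_enumeration[OF finite_M] by blast
  have AE: "A \<inter> ?E = {}" and Aab: "A \<subseteq> {a..b}" using F assms(2) unfolding A_def by auto
  have inj: "inj_on (node x) P"
    by (rule node_inj[OF x(1)]) (use x(2) AE in blast)
  have ZP: "Z \<subseteq> node x ` P" unfolding node_image x(2) A_def by blast
  define w where "w = (\<lambda>i. if node x i \<in> Z then \<mu> (node x i) else 0)"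
  have tr: "(\<Sum>i\<in>P. h (w i) (node x i)) = (\<Sum>z\<in>Z. h (\<mu> z) z)" if h: "\<And>z. h 0 z = 0"
    for h :: "real \<Rightarrow> real \<Rightarrow> 'c::comm_monoid_add"
  proof -
    have "(\<Sum>i\<in>P. h (w i) (node x i)) = (\<Sum>z\<in>node x ` P. h (if z \<in> Z then \<mu> z else 0) z)"
      unfolding sum.reindex[OF inj] by (rule sum.cong) (auto simp: w_def)
    also have "\<dots> = (\<Sum>z\<in>Z. h (\<mu> z) z)"
      using ZP finite_P h by (intro sum.mono_neutral_cong_right) auto
    finally show ?thesis .
  qed
  have "sum w P = 1" using tr[of "\<lambda>r z. r"] assms(5) by simp
  then have weight: "weight w i = w i" for i
    using sum.remove[OF finite_P p0, of w] by (simp add: weight_def)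
  have "admissible w x"
  proof -
    have "w i \<ge> 0" for i using assms(4) by (simp add: w_def)
    moreover have "mono_on M x" using x(1) by (rule strict_mono_on_imp_mono_on)
    moreover have "a \<le> x i \<and> x i \<le> b" if "i \<in> M" for i
      using Aab x(2) that by (metis atLeastAtMost_iff imageI subsetD)
    ultimately show ?thesis unfolding admissible_def ordered_points_def weight by blast
  qed
  moreover have "hull_point w x = (\<Sum>z\<in>Z. \<mu> z *\<^sub>R \<gamma> z)"
    unfolding hull_point_def weight using tr[of "\<lambda>r z. r *\<^sub>R \<gamma> z"] by simp
  ultimately show ?thesis by blast
qed

end

text \<open>
  The supports of the two representations are determined by the point, but they differ in the ends of
  the interval that they contain.
\<close>

lemma generic_disjoint:
  assumes "simplex_family \<gamma> a b P M p0 e" "simplex_family \<gamma> a b P' M' p0' e'"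
    and "card (e ` (P - M) \<union> e' ` (P' - M')) + card M + card M' \<le> Suc CARD('m)"
    and "e ` (P - M) \<noteq> e' ` (P' - M')"
    and "simplex_family.generic a b P M p0 w x" "simplex_family.generic a b P' M' p0' w' x'"
  shows "simplex_family.hull_point \<gamma> P M p0 e w x \<noteq> 
    simplex_family.hull_point (\<gamma> :: real \<Rightarrow> real ^ 'm::{finite,linorder}) P' M' p0' e' w' x'"
proof
  interpret A: simplex_family \<gamma> a b P M p0 e by fact
  interpret B: simplex_family \<gamma> a b P' M' p0' e' by fact
  assume *: "A.hull_point w x = B.hull_point w' x'"
  note n = A.generic_nodes[OF assms(5)] and h = A.hull_point_nodes[OF assms(5)]
  note n' = B.generic_nodes[OF assms(6)] and h' = B.hull_point_nodes[OF assms(6)]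
  have U: "A.node x ` P \<union> B.node x' ` P' = (e ` (P - M) \<union> e' ` (P' - M')) \<union> (x ` M \<union> x' ` M')"
    unfolding A.node_image B.node_image by blast
  have "card (A.node x ` P \<union> B.node x' ` P') \<le> card (e ` (P - M) \<union> e' ` (P' - M')) + card (x ` M \<union> x' ` M')"
    unfolding U by (rule card_Un_le)
  also have "card (x ` M \<union> x' ` M') \<le> card M + card M'"
    using card_Un_le[of "x ` M" "x' ` M'"] n(7) n'(7) by simp
  finally have c: "card (A.node x ` P \<union> B.node x' ` P') \<le> Suc CARD('m)" using assms(3) by simp
  have "A.node x ` P = B.node x' ` P' \<and> (\<forall>z\<in>A.node x ` P. A.weight w (the_inv_into P (A.node x) z) = B.weight w' (the_inv_into P' (B.node x') z))"
  proof (rule A.convex_combination_unique[OF n(2) n'(2) n(3) n'(3) c])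
    fix z
    show "A.weight w (the_inv_into P (A.node x) z) \<noteq> 0" if "z \<in> A.node x ` P" using h(4)[OF that] by simp
    show "B.weight w' (the_inv_into P' (B.node x') z) \<noteq> 0" if "z \<in> B.node x' ` P'" using h'(4)[OF that] by simp
  qed (use h(1,2) h'(1,2) * in simp_all)
  then show False using n(5) n'(5) assms(4) by simp
qed

section \<open>Hausdorff measure as an outer measure\<close>

lemma premeasure_le_cover:
  assumes "A \<subseteq> (\<Union>i. U i)" "\<And>i. bounded (U i)" "\<And>i. diameter (U i) \<le> \<delta>"
  shows "hausdorff_premeasure n \<delta> A \<le> (\<Sum>i. ennreal (diameter (U i) ^ n))"
  unfolding hausdorff_premeasure_def by (rule INF_lower) (use assms in simp)

lemma premeasure_greatest:
  assumes "\<And>U. \<lbrakk>A \<subseteq> (\<Union>i. U i); \<And>i. bounded (U i); \<And>i. diameter (U i) \<le> \<delta>\<rbrakk>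
    \<Longrightarrow> x \<le> (\<Sum>i. ennreal (diameter (U i) ^ n))"
  shows "x \<le> hausdorff_premeasure n \<delta> A"
  unfolding hausdorff_premeasure_def by (rule INF_greatest) (use assms in simp)

lemma premeasure_antimono:
  assumes "A \<subseteq> B" "\<delta>' \<le> \<delta>"
  shows "hausdorff_premeasure n \<delta> A \<le> hausdorff_premeasure n \<delta>' B"
proof (rule premeasure_greatest)
  fix U assume U: "B \<subseteq> (\<Union>i::nat. U i)" "\<And>i. bounded (U i)" "\<And>i. diameter (U i) \<le> \<delta>'"
  show "hausdorff_premeasure n \<delta> A \<le> (\<Sum>i. ennreal (diameter (U i) ^ n))"
    by (rule premeasure_le_cover) (use U assms order_trans in blast)+
qed

lemma premeasure_le_hausdorff: "\<delta> > 0 \<Longrightarrow> hausdorff_premeasure n \<delta> A \<le> hausdorff_measure n A"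
  unfolding hausdorff_measure_def by (rule SUP_upper) simp

lemma hausdorff_least:
  "(\<And>\<delta>. \<delta> > 0 \<Longrightarrow> hausdorff_premeasure n \<delta> A \<le> x) \<Longrightarrow> hausdorff_measure n A \<le> x"
  unfolding hausdorff_measure_def by (rule SUP_least) simp

lemma hausdorff_mono: "A \<subseteq> B \<Longrightarrow> hausdorff_measure n A \<le> hausdorff_measure n B"
  by (rule hausdorff_least) (meson order_refl order_trans premeasure_antimono premeasure_le_hausdorff)

lemma hausdorff_empty:
  assumes "n \<ge> 1"
  shows "hausdorff_measure n ({} :: 'a::metric_space set) = 0"
proof -
  have "hausdorff_measure n ({} :: 'a set) \<le> 0"
  proof (rule hausdorff_least)
    fix \<delta> :: real assume "\<delta> > 0"
    then have "hausdorff_premeasure n \<delta> ({} :: 'a set) \<le> (\<Sum>i::nat. ennreal (diameter ({} :: 'a set) ^ n))"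
      by (intro premeasure_le_cover) auto
    then show "hausdorff_premeasure n \<delta> ({} :: 'a set) \<le> 0" using assms by (simp add: power_0_left)
  qed
  then show ?thesis by simp
qed

lemma premeasure_countable_subadditive:
  "hausdorff_premeasure n \<delta> (\<Union>i. A i) \<le> (\<Sum>i::nat. hausdorff_premeasure n \<delta> (A i))"
proof (rule ennreal_le_epsilon)
  fix e :: real
  assume fin: "(\<Sum>i. hausdorff_premeasure n \<delta> (A i)) < Orderings.top" and e: "e > 0"
  define r where "r = (\<lambda>i::nat. e * (1/2) ^ Suc i)"
  have r: "r i > 0" for i using e by (simp add: r_def)
  have "\<exists>U. A i \<subseteq> (\<Union>j::nat. U j) \<and> (\<forall>j. bounded (U j) \<and> diameter (U j) \<le> \<delta>) \<and>
      (\<Sum>j. ennreal (diameter (U j) ^ n)) < hausdorff_premeasure n \<delta> (A i) + ennreal (r i)" for i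
  proof -
    have ne: "hausdorff_premeasure n \<delta> (A i) \<noteq> \<infinity>"
      using ennreal_suminf_lessD[OF fin, of i] by auto
    show ?thesis
      using INF_approx_ennreal[OF r, of "hausdorff_premeasure n \<delta> (A i)" _ _ i, OF hausdorff_premeasure_def ne]
      by auto
  qed
  then obtain U where U: "\<And>i. A i \<subseteq> (\<Union>j::nat. U i j)" "\<And>i j. bounded (U i j)"
      "\<And>i j. diameter (U i j) \<le> \<delta>"
      "\<And>i. (\<Sum>j. ennreal (diameter (U i j) ^ n)) < hausdorff_premeasure n \<delta> (A i) + ennreal (r i)"
    by metis
  define V where "V = (\<lambda>k. U (fst (prod_decode k)) (snd (prod_decode k)))"
  have "hausdorff_premeasure n \<delta> (\<Union>i. A i) \<le> (\<Sum>k. ennreal (diameter (V k) ^ n))"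
  proof (rule premeasure_le_cover)
    show "(\<Union>i. A i) \<subseteq> (\<Union>k. V k)"
    proof
      fix x assume "x \<in> (\<Union>i. A i)"
      then obtain i j where "x \<in> U i j" using U(1) by blast
      then have "x \<in> V (prod_encode (i, j))" by (simp add: V_def)
      then show "x \<in> (\<Union>k. V k)" by blast
    qed
  qed (use U in \<open>auto simp: V_def\<close>)
  also have "\<dots> = (\<Sum>k. (case prod_decode k of (i, j) \<Rightarrow> ennreal (diameter (U i j) ^ n)))"
    by (simp add: V_def case_prod_beta)
  also have "\<dots> = (\<Sum>i. \<Sum>j. ennreal (diameter (U i j) ^ n))"
    by (rule suminf_ennreal_2dimen) simp
  also have "\<dots> \<le> (\<Sum>i. hausdorff_premeasure n \<delta> (A i) + ennreal (r i))"
    by (intro suminf_le less_imp_le U(4)) auto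
  also have "\<dots> = (\<Sum>i. hausdorff_premeasure n \<delta> (A i)) + (\<Sum>i. ennreal (r i))"
    by (rule suminf_add[symmetric]) auto
  also have "(\<Sum>i. ennreal (r i)) = ennreal e"
  proof -
    have "r sums e" unfolding r_def using sums_mult[OF power_half_series, of e] by simp
    then show ?thesis using r by (intro suminf_ennreal_eq) (auto intro: less_imp_le)
  qed
  finally show "hausdorff_premeasure n \<delta> (\<Union>i. A i) \<le> (\<Sum>i. hausdorff_premeasure n \<delta> (A i)) + ennreal e" .
qed

lemma hausdorff_countable_subadditive:
  "hausdorff_measure n (\<Union>i. A i) \<le> (\<Sum>i::nat. hausdorff_measure n (A i))"
proof (rule hausdorff_least)
  fix \<delta> :: real assume \<delta>: "\<delta> > 0"
  have "hausdorff_premeasure n \<delta> (\<Union>i. A i) \<le> (\<Sum>i. hausdorff_premeasure n \<delta> (A i))"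
    by (rule premeasure_countable_subadditive)
  also have "\<dots> \<le> (\<Sum>i. hausdorff_measure n (A i))"
    by (intro suminf_le premeasure_le_hausdorff \<delta>) auto
  finally show "hausdorff_premeasure n \<delta> (\<Union>i. A i) \<le> (\<Sum>i. hausdorff_measure n (A i))" .
qed

lemma hausdorff_subadditive:
  assumes "n \<ge> 1"
  shows "hausdorff_measure n (A \<union> B) \<le> hausdorff_measure n A + hausdorff_measure n B"
  using hausdorff_countable_subadditive[of n "binaryset A B"]
  by (simp add: UN_binaryset_eq suminf_binaryset_eq[of "hausdorff_measure n", OF hausdorff_empty[OF assms]])

lemma hausdorff_subadditive_countable_family:
  assumes "n \<ge> 1" "countable D"
  shows "hausdorff_measure n (\<Union>D) \<le> (\<integral>\<^sup>+K. hausdorff_measure n K \<partial>count_space D)"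
proof -
  define I where "I = to_nat_on D ` D"
  have bij: "bij_betw (from_nat_into D) I D"
    unfolding I_def using assms(2) by (auto intro!: bij_betw_byWitness[where f' = "to_nat_on D"])
  define X where "X = (\<lambda>k. if k \<in> I then from_nat_into D k else {})"
  have "\<Union>D \<subseteq> (\<Union>k. X k)"
  proof
    fix x assume "x \<in> \<Union>D"
    then obtain K where "K \<in> D" "x \<in> K" by blast
    then have "x \<in> X (to_nat_on D K)" using assms(2) by (simp add: X_def I_def)
    then show "x \<in> (\<Union>k. X k)" by blast
  qed
  then have "hausdorff_measure n (\<Union>D) \<le> hausdorff_measure n (\<Union>k. X k)" by (rule hausdorff_mono)
  also have "\<dots> \<le> (\<Sum>k. hausdorff_measure n (X k))" by (rule hausdorff_countable_subadditive)
  also have "\<dots> = (\<integral>\<^sup>+k. hausdorff_measure n (X k) \<partial>count_space UNIV)"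
    by (rule nn_integral_count_space_nat[symmetric])
  also have "\<dots> = (\<integral>\<^sup>+k. hausdorff_measure n (X k) \<partial>count_space I)"
    by (rule nn_integral_count_space_eq) (simp_all add: X_def hausdorff_empty[OF assms(1)])
  also have "\<dots> = (\<integral>\<^sup>+k. hausdorff_measure n (from_nat_into D k) \<partial>count_space I)"
    by (intro nn_integral_cong) (simp add: X_def)
  also have "\<dots> = (\<integral>\<^sup>+K. hausdorff_measure n K \<partial>count_space D)"
    by (rule nn_integral_bij_count_space[OF bij])
  finally show ?thesis .
qed

text \<open>
  A cover of \<open>A\<close> of mesh \<open>\<delta> / L\<close> is mapped to a cover of the image of mesh \<open>\<delta>\<close>. The factor \<open>1 / L ^ n\<close> is kept on
  the left until the infimum over covers has been taken.
\<close>

lemma hausdorff_lipschitz_image: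
  fixes f :: "'a::real_normed_vector \<Rightarrow> 'b::real_normed_vector"
  assumes L: "L > 0" and f: "\<And>x y. \<lbrakk>x \<in> A; y \<in> A\<rbrakk> \<Longrightarrow> norm (f x - f y) \<le> L * norm (x - y)"
  shows "hausdorff_measure n (f ` A) \<le> ennreal (L ^ n) * hausdorff_measure n A"
proof (rule hausdorff_least)
  fix \<delta> :: real assume \<delta>: "\<delta> > 0"
  have "hausdorff_premeasure n \<delta> (f ` A) * ennreal (1 / L ^ n) \<le> hausdorff_premeasure n (\<delta> / L) A"
  proof (rule premeasure_greatest)
    fix U assume U: "A \<subseteq> (\<Union>i::nat. U i)" "\<And>i. bounded (U i)" "\<And>i. diameter (U i) \<le> \<delta> / L"
    define V where "V = (\<lambda>i. f ` (U i \<inter> A))"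
    have dV: "norm (x - y) \<le> L * diameter (U i)" if "x \<in> V i" "y \<in> V i" for x y i
    proof -
      obtain x' y' where x': "x' \<in> U i" "x' \<in> A" "x = f x'" "y' \<in> U i" "y' \<in> A" "y = f y'"
        using \<open>x \<in> V i\<close> \<open>y \<in> V i\<close> unfolding V_def by blast
      have "norm (x - y) \<le> L * norm (x' - y')" using x' f by simp
      also have "\<dots> \<le> L * diameter (U i)"
        using diameter_bounded_bound[OF U(2) x'(1,4)] L by (simp add: dist_norm)
      finally show ?thesis .
    qed
    have diam: "diameter (V i) \<le> L * diameter (U i)" for i
      using dV[of _ i] L diameter_ge_0[OF U(2)] by (intro diameter_le) auto
    have bdd: "bounded (V i)" for i
      unfolding bounded_two_points
      using dV[of _ i] by (auto simp: dist_norm)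
    have "hausdorff_premeasure n \<delta> (f ` A) \<le> (\<Sum>i. ennreal (diameter (V i) ^ n))"
    proof (rule premeasure_le_cover[OF _ bdd])
      show "f ` A \<subseteq> (\<Union>i. V i)" using U(1) unfolding V_def by blast
      show "diameter (V i) \<le> \<delta>" for i
      proof -
        have "L * diameter (U i) \<le> L * (\<delta> / L)" using U(3)[of i] L by (intro mult_left_mono) auto
        then show ?thesis using diam[of i] L by simp
      qed
    qed
    also have "\<dots> \<le> (\<Sum>i. ennreal (L ^ n) * ennreal (diameter (U i) ^ n))"
    proof (intro suminf_le)
      fix i
      have "diameter (V i) ^ n \<le> (L * diameter (U i)) ^ n"
        by (intro power_mono diam diameter_ge_0 bdd)
      then show "ennreal (diameter (V i) ^ n) \<le> ennreal (L ^ n) * ennreal (diameter (U i) ^ n)"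
        using L by (simp add: ennreal_mult'[symmetric] power_mult_distrib ennreal_leI)
    qed auto
    also have "\<dots> = ennreal (L ^ n) * (\<Sum>i. ennreal (diameter (U i) ^ n))" by simp
    finally have "hausdorff_premeasure n \<delta> (f ` A) * ennreal (1 / L ^ n) \<le>
        ennreal (L ^ n) * (\<Sum>i. ennreal (diameter (U i) ^ n)) * ennreal (1 / L ^ n)"
      by (rule mult_right_mono) simp
    also have "\<dots> = (ennreal (L ^ n) * ennreal (1 / L ^ n)) * (\<Sum>i. ennreal (diameter (U i) ^ n))"
      by (simp add: ac_simps)
    also have "ennreal (L ^ n) * ennreal (1 / L ^ n) = 1"
      using L by (simp add: ennreal_mult'[symmetric])
    finally show "hausdorff_premeasure n \<delta> (f ` A) * ennreal (1 / L ^ n) \<le> (\<Sum>i. ennreal (diameter (U i) ^ n))"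
      by simp
  qed
  also have "\<dots> \<le> hausdorff_measure n A" using \<delta> L by (intro premeasure_le_hausdorff) simp
  finally have "ennreal (L ^ n) * (hausdorff_premeasure n \<delta> (f ` A) * ennreal (1 / L ^ n)) \<le>
      ennreal (L ^ n) * hausdorff_measure n A" by (rule mult_left_mono) simp
  moreover have "ennreal (L ^ n) * (hausdorff_premeasure n \<delta> (f ` A) * ennreal (1 / L ^ n)) =
      hausdorff_premeasure n \<delta> (f ` A) * (ennreal (L ^ n) * ennreal (1 / L ^ n))"
    by (simp add: ac_simps)
  moreover have "ennreal (L ^ n) * ennreal (1 / L ^ n) = 1"
    using L by (simp add: ennreal_mult'[symmetric])
  ultimately show "hausdorff_premeasure n \<delta> (f ` A) \<le> ennreal (L ^ n) * hausdorff_measure n A" by simp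
qed

lemma hausdorff_isometric_image:
  fixes f :: "'a::real_normed_vector \<Rightarrow> 'b::real_normed_vector"
  assumes "\<And>x y. \<lbrakk>x \<in> A; y \<in> A\<rbrakk> \<Longrightarrow> norm (f x - f y) = norm (x - y)"
  shows "hausdorff_measure n (f ` A) = hausdorff_measure n A"
proof (rule antisym)
  show "hausdorff_measure n (f ` A) \<le> hausdorff_measure n A"
    using hausdorff_lipschitz_image[of 1 A f n] assms by simp
  have inj: "inj_on f A"
  proof (rule inj_onI)
    fix x y assume "x \<in> A" "y \<in> A" "f x = f y"
    then show "x = y" using assms[of x y] by simp
  qed
  have "hausdorff_measure n (the_inv_into A f ` f ` A) \<le> ennreal (1 ^ n) * hausdorff_measure n (f ` A)"
    by (rule hausdorff_lipschitz_image) (use assms the_inv_into_f_f[OF inj] in auto)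
  moreover have "the_inv_into A f ` f ` A = A" by (rule the_inv_into_onto[OF inj, unfolded atomize_eq, simplified])
  ultimately show "hausdorff_measure n A \<le> hausdorff_measure n (f ` A)" by simp
qed

text \<open>
  A set of diameter below the distance of \<open>A\<close> and \<open>B\<close> meets at most one of them.
\<close>

lemma premeasure_separated:
  fixes A B :: "'a::real_normed_vector set"
  assumes n: "n \<ge> 1" and d: "\<And>x y. \<lbrakk>x \<in> A; y \<in> B\<rbrakk> \<Longrightarrow> d \<le> dist x y" and \<delta>: "\<delta> < d"
  shows "hausdorff_premeasure n \<delta> A + hausdorff_premeasure n \<delta> B \<le> hausdorff_premeasure n \<delta> (A \<union> B)"
proof (rule premeasure_greatest)
  fix U assume U: "A \<union> B \<subseteq> (\<Union>i::nat. U i)" "\<And>i. bounded (U i)" "\<And>i. diameter (U i) \<le> \<delta>"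
  have sub: "diameter (U i \<inter> C) \<le> diameter (U i)" for i C by (rule diameter_subset) (auto simp: U)
  have bdd: "bounded (U i \<inter> C)" for i C using U(2) by (rule bounded_subset) auto
  have "hausdorff_premeasure n \<delta> A + hausdorff_premeasure n \<delta> B \<le>
      (\<Sum>i. ennreal (diameter (U i \<inter> A) ^ n)) + (\<Sum>i. ennreal (diameter (U i \<inter> B) ^ n))"
  proof (rule add_mono)
    show "hausdorff_premeasure n \<delta> A \<le> (\<Sum>i. ennreal (diameter (U i \<inter> A) ^ n))"
      by (rule premeasure_le_cover[OF _ bdd order_trans[OF sub U(3)]]) (use U(1) in auto)
    show "hausdorff_premeasure n \<delta> B \<le> (\<Sum>i. ennreal (diameter (U i \<inter> B) ^ n))"
      by (rule premeasure_le_cover[OF _ bdd order_trans[OF sub U(3)]]) (use U(1) in auto)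
  qed
  also have "\<dots> = (\<Sum>i. ennreal (diameter (U i \<inter> A) ^ n) + ennreal (diameter (U i \<inter> B) ^ n))"
    by (rule suminf_add) auto
  also have "\<dots> \<le> (\<Sum>i. ennreal (diameter (U i) ^ n))"
  proof (intro suminf_le)
    fix i
    have "U i \<inter> A = {} \<or> U i \<inter> B = {}"
    proof (rule ccontr)
      assume "\<not> ?thesis"
      then obtain x y where "x \<in> U i" "x \<in> A" "y \<in> U i" "y \<in> B" by blast
      then show False using d[of x y] diameter_bounded_bound[OF U(2), of x i y] U(3)[of i] \<delta> by simp
    qed
    moreover have "ennreal (diameter (U i \<inter> C) ^ n) \<le> ennreal (diameter (U i) ^ n)" for C
      by (intro ennreal_leI power_mono sub diameter_ge_0 bdd)
    ultimately show "ennreal (diameter (U i \<inter> A) ^ n) + ennreal (diameter (U i \<inter> B) ^ n) \<le> ennreal (diameter (U i) ^ n)"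
      using n by (auto simp: power_0_left)
  qed auto
  finally show "hausdorff_premeasure n \<delta> A + hausdorff_premeasure n \<delta> B \<le> (\<Sum>i. ennreal (diameter (U i) ^ n))" .
qed

lemma hausdorff_separated:
  fixes A B :: "'a::real_normed_vector set"
  assumes n: "n \<ge> 1" and "d > 0" and d: "\<And>x y. \<lbrakk>x \<in> A; y \<in> B\<rbrakk> \<Longrightarrow> d \<le> dist x y"
  shows "hausdorff_measure n A + hausdorff_measure n B \<le> hausdorff_measure n (A \<union> B)"
proof -
  let ?h = "hausdorff_premeasure n"
  have "hausdorff_measure n A + hausdorff_measure n B = (SUP \<delta>\<in>{0<..}. ?h \<delta> A + ?h \<delta> B)"
    unfolding hausdorff_measure_def
  proof (rule SUP_add_directed_ennreal[symmetric])
    fix i j :: real assume ij: "i \<in> {0<..}" "j \<in> {0<..}"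
    show "\<exists>k\<in>{0<..}. ?h i A + ?h j B \<le> ?h k A + ?h k B"
      by (rule bexI[of _ "min i j"]) (use ij in \<open>auto intro!: add_mono premeasure_antimono\<close>)
  qed
  also have "\<dots> \<le> hausdorff_measure n (A \<union> B)"
  proof (rule SUP_least)
    fix \<delta> :: real assume "\<delta> \<in> {0<..}"
    then have \<delta>: "\<delta> > 0" by simp
    define \<delta>' where "\<delta>' = min \<delta> (d / 2)"
    have \<delta>': "\<delta>' > 0" "\<delta>' \<le> \<delta>" "\<delta>' < d" using \<delta> \<open>d > 0\<close> by (auto simp: \<delta>'_def)
    have "?h \<delta> A + ?h \<delta> B \<le> ?h \<delta>' A + ?h \<delta>' B"
      using \<delta>'(2) by (intro add_mono premeasure_antimono) auto
    also have "\<dots> \<le> ?h \<delta>' (A \<union> B)" by (rule premeasure_separated[OF n d \<delta>'(3)])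
    also have "\<dots> \<le> hausdorff_measure n (A \<union> B)" by (rule premeasure_le_hausdorff[OF \<delta>'(1)])
    finally show "?h \<delta> A + ?h \<delta> B \<le> hausdorff_measure n (A \<union> B)" .
  qed
  finally show ?thesis .
qed

text \<open>
  This is the source of additivity: Lipschitz images of disjoint Lebesgue measurable sets are reduced to it
  by inner approximation.
\<close>

lemma hausdorff_disjoint_compact:
  fixes A B :: "'a::euclidean_space set"
  assumes "n \<ge> 1" "compact A" "compact B" "A \<inter> B = {}"
  shows "hausdorff_measure n A + hausdorff_measure n B \<le> hausdorff_measure n (A \<union> B)"
proof -
  obtain d where "d > 0" "\<forall>x\<in>A. \<forall>y\<in>B. d \<le> dist x y"
    using separate_compact_closed[OF assms(2) compact_imp_closed[OF assms(3)] assms(4)] by blast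
  then show ?thesis by (intro hausdorff_separated[OF assms(1)]) auto
qed

section \<open>Comparison with Lebesgue measure\<close>

lemma premeasure_le_finite_cover:
  assumes n: "n \<ge> 1" and \<delta>: "\<delta> \<ge> 0" and I: "finite I" and A: "A \<subseteq> (\<Union>i\<in>I. U i)"
    and U: "\<And>i. i \<in> I \<Longrightarrow> bounded (U i) \<and> diameter (U i) \<le> \<delta>"
  shows "hausdorff_premeasure n \<delta> A \<le> (\<Sum>i\<in>I. ennreal (diameter (U i) ^ n))"
proof -
  obtain h where h: "bij_betw h {0..<card I} I" using ex_bij_betw_nat_finite[OF I] by blast
  define V where "V = (\<lambda>k. if k < card I then U (h k) else {})"
  have hI: "h k \<in> I" if "k < card I" for k using bij_betwE[OF h] that by auto
  have "hausdorff_premeasure n \<delta> A \<le> (\<Sum>k. ennreal (diameter (V k) ^ n))"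
  proof (rule premeasure_le_cover)
    show "A \<subseteq> (\<Union>k. V k)"
    proof
      fix x assume "x \<in> A"
      then obtain i where i: "i \<in> I" "x \<in> U i" using A by blast
      have "i \<in> h ` {0..<card I}" using i(1) h by (simp add: bij_betw_def)
      then obtain k where "k < card I" "i = h k" by auto
      then have "x \<in> V k" using i by (simp add: V_def)
      then show "x \<in> (\<Union>k. V k)" by blast
    qed
  qed (use U hI \<delta> in \<open>auto simp: V_def\<close>)
  also have "\<dots> = (\<Sum>k\<in>{0..<card I}. ennreal (diameter (V k) ^ n))"
    by (rule suminf_finite) (use n in \<open>auto simp: V_def power_0_left\<close>)
  also have "\<dots> = (\<Sum>k\<in>{0..<card I}. ennreal (diameter (U (h k)) ^ n))"
    by (rule sum.cong) (auto simp: V_def)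
  also have "\<dots> = (\<Sum>i\<in>I. ennreal (diameter (U i) ^ n))" by (rule sum.reindex_bij_betw[OF h])
  finally show ?thesis .
qed

text \<open>
  The grid of \<open>m ^ n\<close> cubes of side \<open>1 / m\<close>, whose diameters are at most \<open>n / m\<close>, contributes the bound
  \<open>n ^ n\<close> for every \<open>m\<close>.
\<close>

lemma hausdorff_unit_cube_finite:
  "hausdorff_measure DIM('a) (cbox 0 One :: 'a::euclidean_space set) < \<infinity>"
proof -
  let ?n = "DIM('a)"
  have "hausdorff_measure ?n (cbox 0 One :: 'a set) \<le> ennreal (real ?n ^ ?n)"
  proof (rule hausdorff_least)
    fix \<delta> :: real assume \<delta>: "\<delta> > 0"
    obtain m :: nat where m: "real ?n / \<delta> < real m" using reals_Archimedean2 by blast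
    have m0: "m > 0"
      by (rule ccontr) (use m \<delta> in \<open>simp add: divide_less_0_iff\<close>)
    have nm: "real ?n / real m \<le> \<delta>" using m m0 \<delta> by (simp add: field_simps)
    define I where "I = (Basis :: 'a set) \<rightarrow>\<^sub>E {..<m}"
    define U where "U = (\<lambda>g. {x::'a. \<forall>b\<in>Basis. real (g b) / real m \<le> x \<bullet> b \<and> x \<bullet> b \<le> (real (g b) + 1) / real m})"
    have finI: "finite I" unfolding I_def by (intro finite_PiE) auto
    have near: "norm (x - y) \<le> real ?n / real m" if "x \<in> U g" "y \<in> U g" for x y :: 'a and g
    proof -
      have "norm (x - y) \<le> (\<Sum>b\<in>Basis. \<bar>(x - y) \<bullet> b\<bar>)" by (rule norm_le_l1)
      also have "\<dots> \<le> (\<Sum>b\<in>(Basis :: 'a set). 1 / real m)"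
      proof (rule sum_mono)
        fix b :: 'a assume b: "b \<in> Basis"
        have "x \<bullet> b - y \<bullet> b \<le> (real (g b) + 1) / real m - real (g b) / real m"
          "y \<bullet> b - x \<bullet> b \<le> (real (g b) + 1) / real m - real (g b) / real m"
          using that b unfolding U_def by (auto intro!: diff_mono)
        moreover have "(real (g b) + 1) / real m - real (g b) / real m = 1 / real m"
          by (simp add: add_divide_distrib)
        ultimately show "\<bar>(x - y) \<bullet> b\<bar> \<le> 1 / real m" by (simp add: inner_diff_left abs_le_iff)
      qed
      finally show ?thesis by simp
    qed
    have diam: "diameter (U g) \<le> real ?n / real m" for g
      using near by (intro diameter_le) auto
    have bdd: "bounded (U g)" for g
      unfolding bounded_two_points using near[of _ g] by (auto simp: dist_norm)
    have cov: "cbox 0 One \<subseteq> (\<Union>g\<in>I. U g)"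
    proof
      fix x :: 'a assume x: "x \<in> cbox 0 One"
      \<comment> \<open>the minimum assigns points on the upper faces of the cube to the last cells of the grid\<close>
      define g where "g = (\<lambda>b\<in>Basis. min (nat \<lfloor>real m * (x \<bullet> b)\<rfloor>) (m - 1))"
      have "g \<in> I" using m0 by (auto simp: g_def I_def)
      moreover have "x \<in> U g" unfolding U_def
      proof (intro CollectI ballI)
        fix b :: 'a assume b: "b \<in> Basis"
        have xb: "0 \<le> x \<bullet> b" "x \<bullet> b \<le> 1" using x b by (auto simp: mem_box)
        define r where "r = real m * (x \<bullet> b)"
        have r: "0 \<le> r" "r \<le> real m" using xb m0 by (auto simp: r_def mult_left_le)
        have "real (g b) \<le> r \<and> r \<le> real (g b) + 1"
        proof (cases "nat \<lfloor>r\<rfloor> \<le> m - 1")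
          case True
          then have "g b = nat \<lfloor>r\<rfloor>" using b by (simp add: g_def r_def)
          then show ?thesis using r(1) by linarith
        next
          case False
          then have gb: "g b = m - 1" using b by (simp add: g_def r_def)
          have "real m \<le> r" using False r(1) m0 by linarith
          then show ?thesis using r(2) gb m0 by (simp add: of_nat_diff)
        qed
        then show "real (g b) / real m \<le> x \<bullet> b \<and> x \<bullet> b \<le> (real (g b) + 1) / real m"
          using m0 by (simp add: r_def field_simps)
      qed
      ultimately show "x \<in> (\<Union>g\<in>I. U g)" by blast
    qed
    have "hausdorff_premeasure ?n \<delta> (cbox 0 One :: 'a set) \<le> (\<Sum>g\<in>I. ennreal (diameter (U g) ^ ?n))"
      using diam bdd nm \<delta> by (intro premeasure_le_finite_cover[OF _ _ finI cov]) (auto intro: order_trans)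
    also have "\<dots> \<le> (\<Sum>g\<in>I. ennreal ((real ?n / real m) ^ ?n))"
      by (intro sum_mono ennreal_leI power_mono diam diameter_ge_0 bdd)
    also have "\<dots> = ennreal (real (card I) * (real ?n / real m) ^ ?n)"
      by (simp add: ennreal_mult ennreal_of_nat_eq_real_of_nat)
    also have "card I = m ^ ?n" by (simp add: I_def card_PiE)
    also have "real (m ^ ?n) * (real ?n / real m) ^ ?n = real ?n ^ ?n"
      using m0 by (simp add: power_divide)
    finally show "hausdorff_premeasure ?n \<delta> (cbox 0 One :: 'a set) \<le> ennreal (real ?n ^ ?n)" .
  qed
  also have "\<dots> < \<infinity>" by simp
  finally show ?thesis .
qed

text \<open>
  A set of diameter \<open>d\<close> lies in a cube of side \<open>2 d\<close>, so Lebesgue measure bounds the sum over a cover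
  from below.
\<close>

lemma hausdorff_unit_cube_pos:
  "hausdorff_measure DIM('a) (cbox 0 One :: 'a::euclidean_space set) > 0"
proof -
  let ?n = "DIM('a)"
  have "ennreal (1 / 2 ^ ?n) \<le> hausdorff_premeasure ?n 1 (cbox 0 One :: 'a set)"
  proof (rule premeasure_greatest)
    fix U assume U: "(cbox 0 One :: 'a set) \<subseteq> (\<Union>i::nat. U i)" "\<And>i. bounded (U i)" "\<And>i. diameter (U i) \<le> 1"
    have "\<exists>B. U i \<subseteq> B \<and> B \<in> sets lborel \<and> emeasure lborel B \<le> ennreal (2 ^ ?n) * ennreal (diameter (U i) ^ ?n)" for i
    proof (cases "U i = {}")
      case False
      then obtain x where x: "x \<in> U i" by blast
      define d where "d = diameter (U i)"
      have d: "d \<ge> 0" using diameter_ge_0[OF U(2)] by (simp add: d_def)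
      have sub: "U i \<subseteq> cbox (x - d *\<^sub>R One) (x + d *\<^sub>R One)"
      proof
        fix y assume y: "y \<in> U i"
        have "norm (y - x) \<le> d" using diameter_bounded_bound[OF U(2) y x] by (simp add: d_def dist_norm)
        then have "\<bar>(y - x) \<bullet> b\<bar> \<le> d" if "b \<in> Basis" for b
          using Basis_le_norm[OF that, of "y - x"] by simp
        then show "y \<in> cbox (x - d *\<^sub>R One) (x + d *\<^sub>R One)"
          by (auto simp: mem_box inner_diff_left inner_add_left abs_le_iff) (smt (verit))+
      qed
      have "emeasure lborel (cbox (x - d *\<^sub>R One) (x + d *\<^sub>R One)) = ennreal (\<Prod>b\<in>(Basis :: 'a set). 2 * d)"
        using d by (subst emeasure_lborel_cbox) (auto simp: inner_diff_left inner_add_left intro!: arg_cong[where f = ennreal] prod.cong)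
      also have "\<dots> = ennreal (2 ^ ?n) * ennreal (d ^ ?n)"
        using d by (simp add: ennreal_mult'[symmetric] power_mult_distrib)
      finally show ?thesis using sub unfolding d_def by (intro exI[of _ "cbox (x - d *\<^sub>R One) (x + d *\<^sub>R One)"]) (auto simp: d_def)
    qed (intro exI[of _ "{}"], auto)
    then obtain B where B: "\<And>i. U i \<subseteq> B i" "\<And>i. B i \<in> sets lborel"
        "\<And>i. emeasure lborel (B i) \<le> ennreal (2 ^ ?n) * ennreal (diameter (U i) ^ ?n)" by metis
    have "1 = emeasure lborel (cbox 0 One :: 'a set)" by (simp add: emeasure_lborel_cbox_eq)
    also have "\<dots> \<le> emeasure lborel (\<Union>i. B i)"
      using U(1) B(1,2) by (intro emeasure_mono) (auto, blast)
    also have "\<dots> \<le> (\<Sum>i. emeasure lborel (B i))"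
      using B(2) by (intro emeasure_subadditive_countably) auto
    also have "\<dots> \<le> (\<Sum>i. ennreal (2 ^ ?n) * ennreal (diameter (U i) ^ ?n))"
      using B(3) by (intro suminf_le) auto
    also have "\<dots> = ennreal (2 ^ ?n) * (\<Sum>i. ennreal (diameter (U i) ^ ?n))" by simp
    finally have "ennreal (1 / 2 ^ ?n) * 1 \<le> ennreal (1 / 2 ^ ?n) * (ennreal (2 ^ ?n) * (\<Sum>i. ennreal (diameter (U i) ^ ?n)))"
      by (rule mult_left_mono) simp
    also have "\<dots> = (\<Sum>i. ennreal (diameter (U i) ^ ?n))"
      by (simp add: mult.assoc[symmetric] ennreal_mult'[symmetric] del: ennreal_numeral)
    finally show "ennreal (1 / 2 ^ ?n) \<le> (\<Sum>i. ennreal (diameter (U i) ^ ?n))" by simp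
  qed
  also have "\<dots> \<le> hausdorff_measure ?n (cbox 0 One :: 'a set)" by (rule premeasure_le_hausdorff) simp
  finally show ?thesis by (rule less_le_trans[rotated]) simp
qed

definition cube_const :: "'a::euclidean_space itself \<Rightarrow> real" where
  "cube_const _ = enn2real (hausdorff_measure DIM('a) (cbox 0 One :: 'a set))"

lemma cube_const:
  "cube_const TYPE('a::euclidean_space) > 0"
  "hausdorff_measure DIM('a) (cbox 0 One :: 'a set) = ennreal (cube_const TYPE('a))"
  using hausdorff_unit_cube_pos[where 'a = 'a] hausdorff_unit_cube_finite[where 'a = 'a]
  by (auto simp: cube_const_def enn2real_positive_iff)

lemma hausdorff_scaled:
  fixes u :: "'a::real_normed_vector"
  assumes "s > 0"
  shows "hausdorff_measure n ((\<lambda>x. u + s *\<^sub>R x) ` A) = ennreal (s ^ n) * hausdorff_measure n A"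
proof (rule antisym)
  let ?f = "\<lambda>x. u + s *\<^sub>R x"
  have n: "norm (?f x - ?f y) = s * norm (x - y)" for x y
    using assms by (simp flip: scaleR_diff_right)
  show "hausdorff_measure n (?f ` A) \<le> ennreal (s ^ n) * hausdorff_measure n A"
    by (rule hausdorff_lipschitz_image[OF assms]) (simp only: n order_refl)
  have "hausdorff_measure n ((\<lambda>y. (1 / s) *\<^sub>R (y - u)) ` ?f ` A) \<le> ennreal ((1 / s) ^ n) * hausdorff_measure n (?f ` A)"
    by (rule hausdorff_lipschitz_image) (use assms in \<open>auto simp flip: scaleR_diff_right\<close>)
  also have "(\<lambda>y. (1 / s) *\<^sub>R (y - u)) ` ?f ` A = A" using assms by (auto simp: image_image)
  finally have "ennreal (s ^ n) * hausdorff_measure n A \<le> ennreal (s ^ n) * (ennreal ((1 / s) ^ n) * hausdorff_measure n (?f ` A))"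
    by (rule mult_left_mono) simp
  also have "\<dots> = hausdorff_measure n (?f ` A)"
    using assms by (simp add: mult.assoc[symmetric] ennreal_mult'[symmetric] power_one_over)
  finally show "ennreal (s ^ n) * hausdorff_measure n A \<le> hausdorff_measure n (?f ` A)" .
qed

lemma hausdorff_cube:
  fixes u v :: "'a::euclidean_space"
  assumes "s > 0" "\<And>b. b \<in> Basis \<Longrightarrow> v \<bullet> b - u \<bullet> b = s"
  shows "hausdorff_measure DIM('a) (cbox u v) = ennreal (cube_const TYPE('a)) * emeasure lebesgue (cbox u v)"
proof -
  have v: "v = u + s *\<^sub>R One"
    by (rule euclidean_eqI) (use assms(2) in \<open>simp add: inner_add_left algebra_simps\<close>)
  have "cbox u v = (\<lambda>x. u + s *\<^sub>R x) ` cbox 0 One"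
  proof (rule equalityI; rule subsetI)
    fix y assume y: "y \<in> cbox u v"
    have "(1 / s) *\<^sub>R (y - u) \<in> cbox 0 One"
      using y assms(1) by (auto simp: v mem_box inner_add_left inner_diff_left field_simps)
    moreover have "y = u + s *\<^sub>R ((1 / s) *\<^sub>R (y - u))" using assms(1) by simp
    ultimately show "y \<in> (\<lambda>x. u + s *\<^sub>R x) ` cbox 0 One" by blast
  next
    fix y assume "y \<in> (\<lambda>x. u + s *\<^sub>R x) ` cbox 0 One"
    then show "y \<in> cbox u v" using assms(1) by (auto simp: v mem_box inner_add_left mult_left_le)
  qed
  then have "hausdorff_measure DIM('a) (cbox u v) = ennreal (s ^ DIM('a)) * ennreal (cube_const TYPE('a))"
    by (simp add: hausdorff_scaled[OF assms(1)] cube_const(2))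
  moreover have "emeasure lebesgue (cbox u v) = ennreal (s ^ DIM('a))"
  proof -
    have "emeasure lborel (cbox u v) = ennreal (\<Prod>b\<in>(Basis :: 'a set). (v - u) \<bullet> b)"
      by (rule emeasure_lborel_cbox) (use assms in fastforce)
    also have "(\<Prod>b\<in>(Basis :: 'a set). (v - u) \<bullet> b) = s ^ DIM('a)"
      using assms(2) by (simp add: inner_diff_left)
    finally show ?thesis by simp
  qed
  ultimately show ?thesis by (simp add: mult.commute)
qed

lemma bounded_subset_cube:
  fixes S :: "'a::euclidean_space set"
  assumes "bounded S"
  obtains u v s where "s > 0" "\<And>b. b \<in> Basis \<Longrightarrow> v \<bullet> b - u \<bullet> b = s" "S \<subseteq> cbox u v"
proof -
  obtain r where r: "r > 0" "\<And>x. x \<in> S \<Longrightarrow> norm x \<le> r" using assms bounded_pos by blast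
  have "S \<subseteq> cbox (- r *\<^sub>R One) (r *\<^sub>R One)"
  proof
    fix x assume "x \<in> S"
    then have "\<bar>x \<bullet> b\<bar> \<le> r" if "b \<in> Basis" for b
      using Basis_le_norm[OF that, of x] r(2) by fastforce
    then show "x \<in> cbox (- r *\<^sub>R One) (r *\<^sub>R One)" by (auto simp: mem_box abs_le_iff) (smt (verit))+
  qed
  then show ?thesis using r(1) by (intro that[of "2 * r" "r *\<^sub>R One" "- r *\<^sub>R One"]) (auto)
qed

text \<open>
  Cubes of any size have the same ratio of Hausdorff to Lebesgue measure, by scaling, and \<open>S\<close> is covered by
  countably many dyadic cubes of total volume close to that of \<open>S\<close>.
\<close>

lemma hausdorff_le_lebesgue:
  fixes S :: "'a::euclidean_space set"
  assumes "S \<in> lmeasurable" "bounded S"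
  shows "hausdorff_measure DIM('a) S \<le> ennreal (cube_const TYPE('a)) * emeasure lebesgue S"
proof (rule ennreal_le_epsilon)
  fix e :: real assume e: "e > 0"
  let ?c = "cube_const TYPE('a)"
  define d where "d = e / ?c"
  have d: "d > 0" using e cube_const(1)[where 'a = 'a] by (simp add: d_def)
  obtain u v s where s: "s > 0" "\<And>b. b \<in> Basis \<Longrightarrow> v \<bullet> b - u \<bullet> b = s" "S \<subseteq> cbox u v"
    using bounded_subset_cube[OF assms(2)] by metis
  obtain D where D: "countable D"
        "\<And>K. K \<in> D \<Longrightarrow> K \<subseteq> cbox u v \<and> K \<noteq> {} \<and> (\<exists>c d. K = cbox c d)"
        "pairwise (\<lambda>A B. interior A \<inter> interior B = {}) D"
        "\<And>a b. cbox a b \<in> D \<Longrightarrow> \<exists>n. \<forall>i\<in>Basis. b \<bullet> i - a \<bullet> i = (v \<bullet> i - u \<bullet> i) / 2 ^ n"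
        "S \<subseteq> \<Union> D" "\<Union> D \<in> lmeasurable" "measure lebesgue (\<Union> D) \<le> measure lebesgue S + d"
    using measurable_outer_intervals_bounded[OF assms(1) s(3) d] by metis
  have K: "hausdorff_measure DIM('a) K = ennreal ?c * emeasure lebesgue (interior K)" if KD: "K \<in> D" for K
  proof -
    obtain a b where ab: "K = cbox a b" using D(2)[OF KD] by blast
    obtain n where n: "\<forall>i\<in>Basis. b \<bullet> i - a \<bullet> i = (v \<bullet> i - u \<bullet> i) / 2 ^ n" using D(4) KD ab by blast
    have "hausdorff_measure DIM('a) K = ennreal ?c * emeasure lebesgue K"
      unfolding ab by (rule hausdorff_cube[of "s / 2 ^ n"]) (use s n in auto)
    also have "emeasure lebesgue K = emeasure lebesgue (interior K)"
      unfolding ab interior_cbox by (simp add: emeasure_lborel_box_eq emeasure_lborel_cbox_eq)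
    finally show ?thesis .
  qed
  have "hausdorff_measure DIM('a) S \<le> hausdorff_measure DIM('a) (\<Union>D)" by (rule hausdorff_mono[OF D(5)])
  also have "\<dots> \<le> (\<integral>\<^sup>+K. hausdorff_measure DIM('a) K \<partial>count_space D)"
    by (rule hausdorff_subadditive_countable_family[OF _ D(1)]) simp
  also have "\<dots> = (\<integral>\<^sup>+K. ennreal ?c * emeasure lebesgue (interior K) \<partial>count_space D)"
    by (intro nn_integral_cong) (simp add: K)
  also have "\<dots> = ennreal ?c * (\<integral>\<^sup>+K. emeasure lebesgue (interior K) \<partial>count_space D)"
    by (simp add: nn_integral_cmult)
  also have "(\<integral>\<^sup>+K. emeasure lebesgue (interior K) \<partial>count_space D) = emeasure lebesgue (\<Union>K\<in>D. interior K)"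
  proof (rule emeasure_UN_countable[symmetric, OF _ D(1)])
    show "disjoint_family_on interior D"
      using D(3) by (auto simp: disjoint_family_on_def pairwise_def)
  qed auto
  also have "\<dots> \<le> emeasure lebesgue (\<Union>D)"
    by (rule emeasure_mono) (use interior_subset in fast, rule fmeasurableD[OF D(6)])
  also have "\<dots> \<le> ennreal (measure lebesgue S + d)"
    using D(6,7) by (simp add: emeasure_eq_measure2 ennreal_leI)
  also have "\<dots> = emeasure lebesgue S + ennreal d"
    using assms(1) d by (simp add: emeasure_eq_measure2)
  also have "ennreal ?c * (emeasure lebesgue S + ennreal d) = ennreal ?c * emeasure lebesgue S + ennreal e"
    using cube_const(1)[where 'a = 'a] e by (simp add: distrib_left ennreal_mult'[symmetric] d_def)
  finally show "hausdorff_measure DIM('a) S \<le> ennreal ?c * emeasure lebesgue S + ennreal e"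
    by (simp add: mult_left_mono)
qed

text \<open>
  Within a cube \<open>Q\<close> containing \<open>S\<close>, the upper bound for \<open>Q - S\<close> is a lower bound for \<open>S\<close>, since both measures
  agree on \<open>Q\<close> up to the constant.
\<close>

lemma hausdorff_eq_lebesgue:
  fixes S :: "'a::euclidean_space set"
  assumes "S \<in> lmeasurable" "bounded S"
  shows "hausdorff_measure DIM('a) S = ennreal (cube_const TYPE('a)) * emeasure lebesgue S"
proof (rule antisym[OF hausdorff_le_lebesgue[OF assms]])
  let ?c = "ennreal (cube_const TYPE('a))"
  obtain u v s where s: "s > 0" "\<And>b. b \<in> Basis \<Longrightarrow> v \<bullet> b - u \<bullet> b = s" "S \<subseteq> cbox u v"
    using bounded_subset_cube[OF assms(2)] by metis
  let ?Q = "cbox u v" let ?R = "cbox u v - S"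
  have R: "?R \<in> lmeasurable" "bounded ?R" using assms(1) by (auto intro: fmeasurable.Diff bounded_diff)
  have "emeasure lebesgue ?Q = emeasure lebesgue ?R + emeasure lebesgue S"
    using plus_emeasure[of S lebesgue ?R] assms(1) R(1) s(3)
    by (simp add: fmeasurableD Un_absorb1 Un_Diff_cancel add.commute)
  then have "?c * emeasure lebesgue ?R + ?c * emeasure lebesgue S = hausdorff_measure DIM('a) ?Q"
    by (simp only: hausdorff_cube[OF s(1,2)] distrib_left)
  also have "\<dots> \<le> hausdorff_measure DIM('a) (?R \<union> S)" by (rule hausdorff_mono) blast
  also have "\<dots> \<le> hausdorff_measure DIM('a) ?R + hausdorff_measure DIM('a) S"
    by (rule hausdorff_subadditive) simp
  also have "\<dots> \<le> ?c * emeasure lebesgue ?R + hausdorff_measure DIM('a) S"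
    by (rule add_right_mono[OF hausdorff_le_lebesgue[OF R]])
  finally have "?c * emeasure lebesgue ?R = \<infinity> \<or> ?c * emeasure lebesgue S \<le> hausdorff_measure DIM('a) S"
    by (simp add: ennreal_add_left_cancel_le)
  moreover have "?c * emeasure lebesgue ?R \<noteq> \<infinity>"
    using R(1) by (simp add: emeasure_eq_measure2 ennreal_mult'[symmetric] ennreal_mult_eq_top_iff)
  ultimately show "?c * emeasure lebesgue S \<le> hausdorff_measure DIM('a) S" by blast
qed

lemma hausdorff_lipschitz_image_le:
  fixes f :: "'a::euclidean_space \<Rightarrow> 'b::euclidean_space"
  assumes "S \<in> lmeasurable" "bounded S" "L > 0"
    and "\<And>x y. \<lbrakk>x \<in> S; y \<in> S\<rbrakk> \<Longrightarrow> norm (f x - f y) \<le> L * norm (x - y)"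
  shows "hausdorff_measure DIM('a) (f ` S) \<le> ennreal (L ^ DIM('a) * cube_const TYPE('a) * measure lebesgue S)"
proof -
  have "hausdorff_measure DIM('a) (f ` S) \<le> ennreal (L ^ DIM('a)) * hausdorff_measure DIM('a) S"
    by (rule hausdorff_lipschitz_image[OF assms(3,4)])
  also have "\<dots> = ennreal (L ^ DIM('a) * cube_const TYPE('a) * measure lebesgue S)"
    using assms(1-3) cube_const(1)[where 'a = 'a]
    by (simp add: hausdorff_eq_lebesgue emeasure_eq_measure2 ennreal_mult less_imp_le mult.assoc)
  finally show ?thesis .
qed

text \<open>
  Replacing \<open>A\<close> and \<open>B\<close> by compact subsets costs little: a set of small Lebesgue measure has a Lipschitz
  image of small Hausdorff measure. Disjoint compact images are separated.
\<close>

lemma hausdorff_disjoint_images: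
  fixes f g :: "'a::euclidean_space \<Rightarrow> 'b::euclidean_space"
  assumes A: "A \<in> lmeasurable" "bounded A" and B: "B \<in> lmeasurable" "bounded B" and "L > 0"
    and f: "\<And>x y. \<lbrakk>x \<in> A; y \<in> A\<rbrakk> \<Longrightarrow> norm (f x - f y) \<le> L * norm (x - y)"
    and g: "\<And>x y. \<lbrakk>x \<in> B; y \<in> B\<rbrakk> \<Longrightarrow> norm (g x - g y) \<le> L * norm (x - y)"
    and disj: "f ` A \<inter> g ` B = {}"
  shows "hausdorff_measure DIM('a) (f ` A \<union> g ` B) = hausdorff_measure DIM('a) (f ` A) + hausdorff_measure DIM('a) (g ` B)"
proof (rule antisym)
  let ?H = "hausdorff_measure DIM('a) :: 'b set \<Rightarrow> ennreal"
  have n: "1 \<le> DIM('a)" by (simp add: Suc_leI)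
  show "?H (f ` A \<union> g ` B) \<le> ?H (f ` A) + ?H (g ` B)"
    by (rule hausdorff_subadditive[OF n])
  have approx: "\<exists>T. compact T \<and> T \<subseteq> S \<and> ?H (h ` S) \<le> ?H (h ` T) + ennreal e"
    if S: "S \<in> lmeasurable" "bounded S" and h: "\<And>x y. \<lbrakk>x \<in> S; y \<in> S\<rbrakk> \<Longrightarrow> norm (h x - h y) \<le> L * norm (x - y)"
      and e: "e > 0" for S and h :: "'a \<Rightarrow> 'b" and e :: real
  proof -
    define k where "k = L ^ DIM('a) * cube_const TYPE('a)"
    have k: "k > 0" using \<open>L > 0\<close> cube_const(1)[where 'a = 'a] by (simp add: k_def)
    obtain T where T: "closed T" "T \<subseteq> S" "S - T \<in> lmeasurable" "emeasure lebesgue (S - T) < ennreal (e / k)"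
      using sets_lebesgue_inner_closed[of S "e / k"] S(1) e k by (auto simp: fmeasurableD)
    have "compact T" using T(1,2) S(2) by (auto simp: compact_eq_bounded_closed intro: bounded_subset)
    have "?H (h ` S) \<le> ?H (h ` T \<union> h ` (S - T))" using T(2) by (intro hausdorff_mono) blast
    also have "\<dots> \<le> ?H (h ` T) + ?H (h ` (S - T))" by (rule hausdorff_subadditive[OF n])
    also have "?H (h ` (S - T)) \<le> ennreal (k * measure lebesgue (S - T))"
      unfolding k_def using T(3) S(2) h \<open>L > 0\<close> by (intro hausdorff_lipschitz_image_le) (auto intro: bounded_diff)
    also have "\<dots> \<le> ennreal e"
    proof (rule ennreal_leI)
      have "measure lebesgue (S - T) < e / k"
        using T(3,4) e k by (simp add: emeasure_eq_measure2 ennreal_less_iff)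
      then show "k * measure lebesgue (S - T) \<le> e" using k by (simp add: field_simps)
    qed
    finally have "?H (h ` S) \<le> ?H (h ` T) + ennreal e" by (simp add: add_left_mono)
    then show ?thesis using \<open>compact T\<close> T(2) by blast
  qed
  have cont: "continuous_on S h" if "\<And>x y. \<lbrakk>x \<in> S; y \<in> S\<rbrakk> \<Longrightarrow> norm (h x - h y) \<le> L * norm (x - y)"
    for S and h :: "'a \<Rightarrow> 'b"
    by (rule lipschitz_on_continuous_on[of L]) (use that \<open>L > 0\<close> in \<open>auto simp: lipschitz_on_def dist_norm\<close>)
  show "?H (f ` A) + ?H (g ` B) \<le> ?H (f ` A \<union> g ` B)"
  proof (rule ennreal_le_epsilon)
    fix e :: real assume e: "e > 0"
    obtain T where T: "compact T" "T \<subseteq> A" "?H (f ` A) \<le> ?H (f ` T) + ennreal (e / 2)"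
      using approx[OF A f, of "e / 2"] e by auto
    obtain R where R: "compact R" "R \<subseteq> B" "?H (g ` B) \<le> ?H (g ` R) + ennreal (e / 2)"
      using approx[OF B g, of "e / 2"] e by auto
    have "?H (f ` A) + ?H (g ` B) \<le> (?H (f ` T) + ennreal (e / 2)) + (?H (g ` R) + ennreal (e / 2))"
      by (rule add_mono[OF T(3) R(3)])
    also have "\<dots> = (?H (f ` T) + ?H (g ` R)) + ennreal e"
      using e by (simp add: ac_simps flip: ennreal_plus)
    also have "?H (f ` T) + ?H (g ` R) \<le> ?H (f ` T \<union> g ` R)"
    proof (rule hausdorff_disjoint_compact[OF n])
      show "compact (f ` T)"
        by (intro compact_continuous_image cont T(1) f) (use T(2) in blast)+
      show "compact (g ` R)"
        by (intro compact_continuous_image cont R(1) g) (use R(2) in blast)+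
      show "f ` T \<inter> g ` R = {}" using disj T(2) R(2) by blast
    qed
    also have "\<dots> \<le> ?H (f ` A \<union> g ` B)" using T(2) R(2) by (intro hausdorff_mono) blast
    finally show "?H (f ` A) + ?H (g ` B) \<le> ?H (f ` A \<union> g ` B) + ennreal e" by (simp add: add_right_mono)
  qed
qed

lemma hausdorff_image_countably_additive:
  fixes f :: "'a::euclidean_space \<Rightarrow> 'b::euclidean_space"
  assumes S: "bounded S" and E: "\<And>i. E i \<in> lmeasurable" "\<And>i. E i \<subseteq> S" "disjoint_family E" and L: "L > 0"
    and f: "\<And>x y. \<lbrakk>x \<in> S; y \<in> S\<rbrakk> \<Longrightarrow> norm (f x - f y) \<le> L * norm (x - y)" and inj: "inj_on f S"
  shows "hausdorff_measure DIM('a) (f ` (\<Union>i::nat. E i)) = (\<Sum>i. hausdorff_measure DIM('a) (f ` E i))"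
proof (rule antisym)
  let ?H = "hausdorff_measure DIM('a) :: 'b set \<Rightarrow> ennreal"
  show "?H (f ` (\<Union>i. E i)) \<le> (\<Sum>i. ?H (f ` E i))"
    unfolding image_UN by (rule hausdorff_countable_subadditive)
  have fin: "?H (f ` (\<Union>i<k. E i)) = (\<Sum>i<k. ?H (f ` E i))" for k
  proof (induction k)
    case 0
    then show ?case by (simp add: hausdorff_empty Suc_leI)
  next
    case (Suc k)
    have sub: "(\<Union>i<k. E i) \<subseteq> S" using E(2) by blast
    have "?H (f ` (\<Union>i<Suc k. E i)) = ?H (f ` (\<Union>i<k. E i) \<union> f ` E k)"
      by (simp add: lessThan_Suc image_Un Un_commute)
    also have "\<dots> = ?H (f ` (\<Union>i<k. E i)) + ?H (f ` E k)"
    proof (rule hausdorff_disjoint_images[OF _ _ _ _ L])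
      have "E i \<inter> E k = {}" if "i < k" for i
        by (rule disjoint_family_onD[OF E(3)]) (use that in simp_all)
      then have "(\<Union>i<k. E i) \<inter> E k = {}" by blast
      then show "f ` (\<Union>i<k. E i) \<inter> f ` E k = {}"
        using inj_on_image_Int[OF inj sub E(2)] by (metis image_empty)
      show "(\<Union>i<k. E i) \<in> lmeasurable" using E(1) by (intro fmeasurable.finite_UN) auto
      show "bounded (\<Union>i<k. E i)" "bounded (E k)" using bounded_subset[OF S] sub E(2) by auto
    qed (use E f sub in blast)+
    finally show ?case using Suc by simp
  qed
  show "(\<Sum>i. ?H (f ` E i)) \<le> ?H (f ` (\<Union>i. E i))"
    unfolding suminf_eq_SUP
    by (rule SUP_least) (unfold fin[symmetric], auto intro!: hausdorff_mono)
qed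

section \<open>The area formula\<close>

definition gram :: "(real ^ 'k \<Rightarrow> 'b::euclidean_space) \<Rightarrow> real ^ 'k ^ 'k" where
  "gram L = (\<chi> i j. L (axis i 1) \<bullet> L (axis j 1))"

text \<open>
  For linear injective \<open>L\<close>, the factor by which \<open>L\<close> multiplies volumes in dimension \<open>CARD('k)\<close>.
\<close>

definition gram_jacobian :: "(real ^ 'k::finite \<Rightarrow> 'b::euclidean_space) \<Rightarrow> real" where
  "gram_jacobian L = sqrt (Determinants.det (gram L))"

lemma gram_jacobian_square:
  fixes A :: "real ^ 'k::finite \<Rightarrow> real ^ 'k"
  shows "gram_jacobian A = \<bar>Determinants.det (matrix A)\<bar>"
proof -
  have "gram A = Finite_Cartesian_Product.transpose (matrix A) ** matrix A"
    by (simp add: gram_def Finite_Cartesian_Product.vec_eq_iff Finite_Cartesian_Product.transpose_def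
        matrix_matrix_mult_def matrix_def inner_vec_def)
  then have "Determinants.det (gram A) = (Determinants.det (matrix A))\<^sup>2"
    by (simp add: Determinants.det_mul Determinants.det_transpose power2_eq_square)
  then show ?thesis by (simp add: gram_jacobian_def)
qed

lemma linear_norm_preserving_inner:
  fixes h :: "'a::euclidean_space \<Rightarrow> 'b::euclidean_space"
  assumes "linear h" "subspace S" "\<And>x. x \<in> S \<Longrightarrow> norm (h x) = norm x" "x \<in> S" "y \<in> S"
  shows "h x \<bullet> h y = x \<bullet> y"
  using assms by (simp add: dot_norm subspace_add flip: linear_add[OF assms(1)])

text \<open>
  The range of \<open>L\<close> is isometric to the domain, which makes \<open>L\<close> a square matrix with the same Gram matrix.
\<close>

lemma ex_isometric_square:
  fixes L :: "real ^ 'k::finite \<Rightarrow> 'b::euclidean_space"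
  assumes "linear L" "inj L"
  obtains h :: "'b \<Rightarrow> real ^ 'k" where "linear h" "\<And>x y. norm (h (L x) - h (L y)) = norm (L x - L y)"
    "gram (h \<circ> L) = gram L"
proof -
  have "dim (range L) = dim (UNIV :: (real ^ 'k) set)"
    by (rule dim_image_eq[OF assms(1)]) (use assms(2) in \<open>simp add: inj_on_subset\<close>)
  moreover have sub: "subspace (range L)" by (rule linear_subspace_image[OF assms(1) subspace_UNIV])
  ultimately obtain h :: "'b \<Rightarrow> real ^ 'k" where h: "linear h" "\<And>x. x \<in> range L \<Longrightarrow> norm (h x) = norm x"
    using isometries_subspaces[OF sub subspace_UNIV] by metis
  have "norm (h (L x) - h (L y)) = norm (L x - L y)" for x y
  proof -
    have "norm (h (L (x - y))) = norm (L (x - y))" by (rule h(2)) simp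
    then show ?thesis by (simp add: linear_diff[OF h(1)] linear_diff[OF assms(1)])
  qed
  moreover have "gram (h \<circ> L) = gram L"
    by (simp add: gram_def linear_norm_preserving_inner[OF h(1) sub h(2)])
  ultimately show ?thesis using that h(1) by blast
qed

lemma hausdorff_linear_image:
  fixes L :: "real ^ 'k::{finite,wellorder} \<Rightarrow> 'b::euclidean_space"
  assumes "linear L" "inj L" "S \<in> lmeasurable" "bounded S"
  shows "hausdorff_measure CARD('k) (L ` S) =
    ennreal (cube_const TYPE(real ^ 'k::{finite,wellorder}) * gram_jacobian L * measure lebesgue S)"
proof -
  obtain h :: "'b \<Rightarrow> real ^ 'k::{finite,wellorder}" where h: "linear h" "\<And>x y. norm (h (L x) - h (L y)) = norm (L x - L y)"
    "gram (h \<circ> L) = gram L" by (rule ex_isometric_square[OF assms(1,2)]) blast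
  let ?A = "h \<circ> L"
  have lin: "linear ?A" using assms(1) h(1) by (rule linear_compose)
  have J: "gram_jacobian L = \<bar>Determinants.det (matrix ?A)\<bar>"
    using gram_jacobian_square[of ?A] h(3) by (simp add: gram_jacobian_def)
  have "hausdorff_measure CARD('k) (L ` S) = hausdorff_measure CARD('k) (h ` L ` S)"
    by (rule hausdorff_isometric_image[symmetric]) (use h(2) in auto)
  also have "h ` L ` S = ?A ` S" by (simp add: image_comp)
  also have "hausdorff_measure CARD('k) (?A ` S) = ennreal (cube_const TYPE(real ^ 'k::{finite,wellorder})) * emeasure lebesgue (?A ` S)"
  proof -
    have "bounded (?A ` S)" using assms(4) lin bounded_linear_image linear_conv_bounded_linear by blast
    then show ?thesis using hausdorff_eq_lebesgue[OF measurable_linear_image[OF lin assms(3)]] by simp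
  qed
  also have "emeasure lebesgue (?A ` S) = ennreal (gram_jacobian L * measure lebesgue S)"
    using measurable_linear_image[OF lin assms(3)] measure_linear_image[OF lin assms(3)] J
    by (simp add: emeasure_eq_measure2)
  finally show ?thesis using cube_const(1)[where 'a = "real ^ 'k::{finite,wellorder}"] J
    by (simp add: ennreal_mult' mult.assoc)
qed

lemma gram_jacobian_pos:
  fixes L :: "real ^ 'k::finite \<Rightarrow> 'b::euclidean_space"
  assumes "linear L" "inj L"
  shows "gram_jacobian L > 0"
proof -
  obtain h :: "'b \<Rightarrow> real ^ 'k" where h: "linear h" "\<And>x y. norm (h (L x) - h (L y)) = norm (L x - L y)"
    "gram (h \<circ> L) = gram L" by (rule ex_isometric_square[OF assms(1,2)]) blast
  let ?A = "h \<circ> L"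
  have lin: "linear ?A" using assms(1) h(1) by (rule linear_compose)
  have "inj ?A"
  proof (rule injI)
    fix x y assume "?A x = ?A y"
    then have "L x = L y" using h(2)[of x y] by simp
    then show "x = y" using assms(2) by (simp add: inj_eq)
  qed
  then have "Determinants.det (matrix ?A) \<noteq> 0" using det_nz_iff_inj[OF lin] by blast
  then show ?thesis using gram_jacobian_square[of ?A] h(3) by (simp add: gram_jacobian_def)
qed

lemma continuous_on_det:
  fixes A :: "'x::topological_space \<Rightarrow> real ^ 'k ^ 'k::finite"
  assumes "\<And>i j. continuous_on S (\<lambda>x. A x $ i $ j)"
  shows "continuous_on S (\<lambda>x. Determinants.det (A x))"
  unfolding Determinants.det_def by (intro continuous_intros assms)

lemma continuous_on_gram_jacobian:
  fixes f' :: "'x::topological_space \<Rightarrow> real ^ 'k::finite \<Rightarrow> 'b::euclidean_space"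
  assumes "\<And>v. continuous_on S (\<lambda>x. f' x v)"
  shows "continuous_on S (\<lambda>x. gram_jacobian (f' x))"
  unfolding gram_jacobian_def
  by (intro continuous_on_real_sqrt continuous_on_det) (simp add: gram_def, intro continuous_intros assms)

lemma ennreal_cancel_factor:
  assumes "d > 0" "A \<ge> 0" "c > 0" "m \<ge> 0"
  shows "ennreal (A / d) * (ennreal c * ennreal (d * m)) = ennreal A * ennreal (c * m)"
proof -
  have "A / d * (c * (d * m)) = A * (c * m)" using assms(1) by simp
  then show ?thesis using assms by (simp add: ennreal_mult'[symmetric])
qed

text \<open>
  Near \<open>x0\<close> the map \<open>f\<close> differs from its derivative \<open>L\<close> at \<open>x0\<close> by an \<open>\<epsilon> B\<close>-Lipschitz map, where \<open>B\<close> bounds \<open>L\<close>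
  from below. So \<open>f\<close> distorts the distances in the image of \<open>L\<close> by factors between \<open>1 - \<epsilon>\<close> and \<open>1 + \<epsilon>\<close>,
  and its Hausdorff measures differ from those of the linear image accordingly. The denominators
  account for replacing the Jacobian at \<open>x0\<close> by that at nearby points.
\<close>

lemma local_area_estimate:
  fixes f :: "real ^ 'k::{finite,wellorder} \<Rightarrow> 'b::euclidean_space"
  assumes \<Omega>: "open \<Omega>" "x0 \<in> \<Omega>"
    and der: "\<And>x. x \<in> \<Omega> \<Longrightarrow> (f has_derivative f' x) (at x)"
    and cont: "\<And>v. continuous_on \<Omega> (\<lambda>x. f' x v)"
    and inj': "inj (f' x0)" and \<epsilon>: "0 < \<epsilon>" "\<epsilon> < 1"
  defines "c \<equiv> cube_const TYPE(real ^ 'k::{finite,wellorder})"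
  obtains r where "r > 0" "ball x0 r \<subseteq> \<Omega>"
    "\<And>E. \<lbrakk>E \<in> sets borel; E \<subseteq> ball x0 r\<rbrakk> \<Longrightarrow> hausdorff_measure CARD('k) (f ` E) \<le>
       ennreal ((1 + \<epsilon>) ^ CARD('k) / (1 - \<epsilon>)) * (ennreal c * (\<integral>\<^sup>+x\<in>E. ennreal (gram_jacobian (f' x)) \<partial>lborel))"
    "\<And>E. \<lbrakk>E \<in> sets borel; E \<subseteq> ball x0 r\<rbrakk> \<Longrightarrow>
       ennreal ((1 - \<epsilon>) ^ CARD('k) / (1 + \<epsilon>)) * (ennreal c * (\<integral>\<^sup>+x\<in>E. ennreal (gram_jacobian (f' x)) \<partial>lborel))
         \<le> hausdorff_measure CARD('k) (f ` E)"
proof -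
  let ?n = "CARD('k)" and ?L = "f' x0"
  let ?J = "\<lambda>x. gram_jacobian (f' x)"
  have c: "c > 0" unfolding c_def by (rule cube_const)
  have lin: "linear (f' x)" if "x \<in> \<Omega>" for x using der[OF that] has_derivative_linear by blast
  note linL = lin[OF \<Omega>(2)]
  obtain B where B: "B > 0" "\<And>v. B * norm v \<le> norm (?L v)"
    using linear_inj_bounded_below_pos[OF linL inj'] by blast
  have J0: "?J x0 > 0" by (rule gram_jacobian_pos[OF linL inj'])
  have "isCont ?J x0"
    using continuous_on_gram_jacobian[of \<Omega> f', OF cont] \<Omega>(2) unfolding continuous_on_eq_continuous_at[OF \<Omega>(1)] by blast
  then obtain r1 where r1: "r1 > 0" "\<And>x. dist x x0 < r1 \<Longrightarrow> \<bar>?J x - ?J x0\<bar> < \<epsilon> * ?J x0"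
    using mult_pos_pos[OF \<epsilon>(1) J0] unfolding continuous_at_eps_delta dist_real_def by blast
  define s where "s = (\<lambda>x. \<Sum>b\<in>Basis. norm (f' x b - ?L b))"
  have "continuous_on \<Omega> s" unfolding s_def by (intro continuous_intros cont)
  then have "isCont s x0" using \<Omega>(2) unfolding continuous_on_eq_continuous_at[OF \<Omega>(1)] by blast
  moreover have "s x0 = 0" by (simp add: s_def)
  ultimately obtain r2 where r2: "r2 > 0" "\<And>x. dist x x0 < r2 \<Longrightarrow> \<bar>s x\<bar> < \<epsilon> * B"
    using mult_pos_pos[OF \<epsilon>(1) B(1)] unfolding continuous_at_eps_delta dist_real_def by (metis diff_zero)
  obtain r3 where r3: "r3 > 0" "ball x0 r3 \<subseteq> \<Omega>" using \<Omega> openE by blast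
  define r where "r = min r1 (min r2 r3)"
  have r: "r > 0" "ball x0 r \<subseteq> \<Omega>" using r1(1) r2(1) r3 by (auto simp: r_def)
  have near: "\<bar>?J x - ?J x0\<bar> < \<epsilon> * ?J x0" "s x < \<epsilon> * B" if "x \<in> ball x0 r" for x
    using r1(2)[of x] r2(2)[of x] that by (auto simp: r_def dist_commute)
  have diff: "norm ((f x - ?L x) - (f y - ?L y)) \<le> \<epsilon> * norm (?L x - ?L y)" if "x \<in> ball x0 r" "y \<in> ball x0 r" for x y
  proof -
    have "norm ((\<lambda>x. f x - ?L x) x - (\<lambda>x. f x - ?L x) y) \<le> (\<epsilon> * B) * norm (x - y)"
    proof (rule differentiable_bound[OF convex_ball _ _ that])
      fix z assume z: "z \<in> ball x0 r"
      then have z': "z \<in> \<Omega>" using r(2) by blast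
      have bl: "bounded_linear ?L" using linL linear_conv_bounded_linear by blast
      show "((\<lambda>x. f x - ?L x) has_derivative (\<lambda>v. f' z v - ?L v)) (at z within ball x0 r)"
        by (intro has_derivative_diff has_derivative_at_withinI[OF der[OF z']]
            bounded_linear_imp_has_derivative[OF bl])
      have "bounded_linear (\<lambda>v. f' z v - ?L v)"
        using bl lin[OF z'] linear_conv_bounded_linear bounded_linear_sub by blast
      then have "onorm (\<lambda>v. f' z v - ?L v) \<le> s z" unfolding s_def by (rule onorm_componentwise)
      then show "onorm (\<lambda>v. f' z v - ?L v) \<le> \<epsilon> * B" using near(2)[OF z] by simp
    qed
    also have "\<epsilon> * B * norm (x - y) \<le> \<epsilon> * norm (?L (x - y))"
      using B(2)[of "x - y"] \<epsilon> by (simp add: mult.assoc)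
    finally show ?thesis by (simp add: linear_diff[OF linL])
  qed
  have up: "norm (f x - f y) \<le> (1 + \<epsilon>) * norm (?L x - ?L y)" if "x \<in> ball x0 r" "y \<in> ball x0 r" for x y
    using diff[OF that] norm_triangle_ineq[of "(f x - ?L x) - (f y - ?L y)" "?L x - ?L y"]
    by (simp add: algebra_simps)
  have lo: "(1 - \<epsilon>) * norm (?L x - ?L y) \<le> norm (f x - f y)" if "x \<in> ball x0 r" "y \<in> ball x0 r" for x y
    using diff[OF that] norm_triangle_ineq2[of "?L x - ?L y" "- ((f x - ?L x) - (f y - ?L y))"]
    by (simp add: algebra_simps norm_minus_commute)
  show ?thesis
  proof (rule that[OF r])
    fix E assume E: "E \<in> sets borel" "E \<subseteq> ball x0 r"
    let ?m = "measure lebesgue E" and ?I = "\<integral>\<^sup>+x\<in>E. ennreal (?J x) \<partial>lborel"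
    have bE: "bounded E" using E(2) bounded_subset bounded_ball by blast
    have mE: "E \<in> lmeasurable" using bE E(1) by (intro bounded_set_imp_lmeasurable) auto
    have em: "emeasure lborel E = ennreal ?m"
      using emeasure_eq_measure2[OF mE] E(1) by (simp add: emeasure_completion)
    have const: "(\<integral>\<^sup>+x\<in>E. ennreal k \<partial>lborel) = ennreal (k * ?m)" if "k \<ge> 0" for k
      using E(1) em that by (simp add: nn_integral_cmult_indicator ennreal_mult)
    have I_lo: "ennreal ((1 - \<epsilon>) * ?J x0 * ?m) \<le> ?I"
    proof -
      have "ennreal ((1 - \<epsilon>) * ?J x0 * ?m) = (\<integral>\<^sup>+x\<in>E. ennreal ((1 - \<epsilon>) * ?J x0) \<partial>lborel)"
        using \<epsilon> J0 by (subst const) auto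
      also have "\<dots> \<le> ?I"
      proof (intro nn_integral_mono)
        fix x
        have "(1 - \<epsilon>) * ?J x0 \<le> ?J x" if "x \<in> E"
          using near(1)[OF subsetD[OF E(2) that]] by (auto simp: algebra_simps abs_less_iff)
        then show "ennreal ((1 - \<epsilon>) * ?J x0) * indicator E x \<le> ennreal (?J x) * indicator E x"
          by (auto simp: indicator_def intro: ennreal_leI)
      qed
      finally show ?thesis .
    qed
    have I_up: "?I \<le> ennreal ((1 + \<epsilon>) * ?J x0 * ?m)"
    proof -
      have "?I \<le> (\<integral>\<^sup>+x\<in>E. ennreal ((1 + \<epsilon>) * ?J x0) \<partial>lborel)"
      proof (intro nn_integral_mono)
        fix x
        have "?J x \<le> (1 + \<epsilon>) * ?J x0" if "x \<in> E"
          using near(1)[OF subsetD[OF E(2) that]] by (auto simp: algebra_simps abs_less_iff)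
        then show "ennreal (?J x) * indicator E x \<le> ennreal ((1 + \<epsilon>) * ?J x0) * indicator E x"
          by (auto simp: indicator_def intro: ennreal_leI)
      qed
      also have "\<dots> = ennreal ((1 + \<epsilon>) * ?J x0 * ?m)"
        using \<epsilon> J0 by (subst const) auto
      finally show ?thesis .
    qed
    have HL: "hausdorff_measure ?n (?L ` E) = ennreal (c * ?J x0 * ?m)"
      unfolding c_def by (rule hausdorff_linear_image[OF linL inj' mE bE])
    let ?g = "\<lambda>y. f (inv_into UNIV ?L y)"
    have fE: "f ` E = ?g ` ?L ` E" using inj' by (simp add: image_image inv_f_f)
    have "hausdorff_measure ?n (f ` E) \<le> ennreal ((1 + \<epsilon>) ^ ?n) * hausdorff_measure ?n (?L ` E)"
      unfolding fE
    proof (rule hausdorff_lipschitz_image)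
      fix x y assume "x \<in> ?L ` E" "y \<in> ?L ` E"
      then obtain x' y' where "x = ?L x'" "y = ?L y'" "x' \<in> E" "y' \<in> E" by blast
      then show "norm (?g x - ?g y) \<le> (1 + \<epsilon>) * norm (x - y)"
        using up[OF subsetD[OF E(2)] subsetD[OF E(2)], of x' y'] inj' by (simp add: inv_f_f)
    qed (use \<epsilon> in simp)
    also have "\<dots> = ennreal ((1 + \<epsilon>) ^ ?n / (1 - \<epsilon>)) * (ennreal c * ennreal ((1 - \<epsilon>) * ?J x0 * ?m))"
      unfolding HL using ennreal_cancel_factor[of "1 - \<epsilon>" "(1 + \<epsilon>) ^ ?n" c "?J x0 * ?m"] \<epsilon> c J0
      by (simp add: mult.assoc)
    also have "\<dots> \<le> ennreal ((1 + \<epsilon>) ^ ?n / (1 - \<epsilon>)) * (ennreal c * ?I)"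
      by (intro mult_left_mono I_lo) auto
    finally show "hausdorff_measure ?n (f ` E) \<le> ennreal ((1 + \<epsilon>) ^ ?n / (1 - \<epsilon>)) * (ennreal c * ?I)" .
    have injE: "inj_on f E"
    proof (rule inj_onI)
      fix x y assume xy: "x \<in> E" "y \<in> E" "f x = f y"
      then have "(1 - \<epsilon>) * norm (?L x - ?L y) \<le> 0" using lo[OF subsetD[OF E(2)] subsetD[OF E(2)], of x y] by simp
      then have "?L x = ?L y" using \<epsilon> by (simp add: mult_le_0_iff)
      then show "x = y" using inj' by (simp add: inj_eq)
    qed
    let ?h = "\<lambda>y. ?L (the_inv_into E f y)"
    have LE: "?L ` E = ?h ` f ` E" using the_inv_into_f_f[OF injE] by (simp add: image_image)
    have "hausdorff_measure ?n (?L ` E) \<le> ennreal ((1 / (1 - \<epsilon>)) ^ ?n) * hausdorff_measure ?n (f ` E)"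
      unfolding LE
    proof (rule hausdorff_lipschitz_image)
      fix x y assume "x \<in> f ` E" "y \<in> f ` E"
      then obtain x' y' where x': "x = f x'" "y = f y'" "x' \<in> E" "y' \<in> E" by blast
      then have "(1 - \<epsilon>) * norm (?L x' - ?L y') \<le> norm (x - y)" using lo[OF subsetD[OF E(2)] subsetD[OF E(2)], of x' y'] by simp
      then have "norm (?L x' - ?L y') \<le> 1 / (1 - \<epsilon>) * norm (x - y)" using \<epsilon> by (simp add: field_simps)
      then show "norm (?h x - ?h y) \<le> 1 / (1 - \<epsilon>) * norm (x - y)"
        using x' the_inv_into_f_f[OF injE] by simp
    qed (use \<epsilon> in simp)
    then have "ennreal ((1 - \<epsilon>) ^ ?n) * ennreal (c * ?J x0 * ?m) \<le>
        ennreal ((1 - \<epsilon>) ^ ?n) * (ennreal ((1 / (1 - \<epsilon>)) ^ ?n) * hausdorff_measure ?n (f ` E))"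
      unfolding HL by (rule mult_left_mono) simp
    also have "\<dots> = hausdorff_measure ?n (f ` E)"
      using \<epsilon> by (simp add: mult.assoc[symmetric] ennreal_mult'[symmetric] power_one_over)
    finally have *: "ennreal ((1 - \<epsilon>) ^ ?n) * ennreal (c * ?J x0 * ?m) \<le> hausdorff_measure ?n (f ` E)" .
    have "ennreal ((1 - \<epsilon>) ^ ?n / (1 + \<epsilon>)) * (ennreal c * ?I) \<le>
        ennreal ((1 - \<epsilon>) ^ ?n / (1 + \<epsilon>)) * (ennreal c * ennreal ((1 + \<epsilon>) * ?J x0 * ?m))"
      by (intro mult_left_mono I_up) auto
    also have "\<dots> = ennreal ((1 - \<epsilon>) ^ ?n) * ennreal (c * ?J x0 * ?m)"
      using ennreal_cancel_factor[of "1 + \<epsilon>" "(1 - \<epsilon>) ^ ?n" c "?J x0 * ?m"] \<epsilon> c J0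
      by (simp add: mult.assoc)
    finally show "ennreal ((1 - \<epsilon>) ^ ?n / (1 + \<epsilon>)) * (ennreal c * ?I) \<le> hausdorff_measure ?n (f ` E)"
      using * by (rule order_trans)
  qed
qed

text \<open>
  The domain is cut into countably many Borel pieces on which the local estimate holds for a given \<open>\<epsilon>\<close>. Both sides
  are additive over the pieces, and \<open>\<epsilon>\<close> tends to zero at the end. The Lipschitz condition makes the
  measure of images countably additive.
\<close>

theorem area_formula:
  fixes f :: "real ^ 'k::{finite,wellorder} \<Rightarrow> 'b::euclidean_space"
  assumes \<Omega>: "open \<Omega>" "bounded \<Omega>"
    and der: "\<And>x. x \<in> \<Omega> \<Longrightarrow> (f has_derivative f' x) (at x)"
    and cont: "\<And>v. continuous_on \<Omega> (\<lambda>x. f' x v)"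
    and inj': "\<And>x. x \<in> \<Omega> \<Longrightarrow> inj (f' x)" and inj: "inj_on f \<Omega>"
    and L: "L > 0" "\<And>x y. \<lbrakk>x \<in> \<Omega>; y \<in> \<Omega>\<rbrakk> \<Longrightarrow> norm (f x - f y) \<le> L * norm (x - y)"
  shows "hausdorff_measure CARD('k) (f ` \<Omega>) =
    ennreal (cube_const TYPE(real ^ 'k::{finite,wellorder})) * (\<integral>\<^sup>+x\<in>\<Omega>. ennreal (gram_jacobian (f' x)) \<partial>lborel)"
proof (cases "\<Omega> = {}")
  case True
  then show ?thesis by (simp add: hausdorff_empty Suc_leI)
next
  case False
  let ?H = "hausdorff_measure CARD('k) :: 'b set \<Rightarrow> ennreal"
  let ?n = "CARD('k)" and ?J = "\<lambda>x. ennreal (gram_jacobian (f' x))"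
  define X where "X = ennreal (cube_const TYPE(real ^ 'k::{finite,wellorder})) * (\<integral>\<^sup>+x\<in>\<Omega>. ?J x \<partial>lborel)"
  have est: "?H (f ` \<Omega>) \<le> ennreal ((1 + \<epsilon>) ^ ?n / (1 - \<epsilon>)) * X \<and>
      ennreal ((1 - \<epsilon>) ^ ?n / (1 + \<epsilon>)) * X \<le> ?H (f ` \<Omega>)" if \<epsilon>: "0 < \<epsilon>" "\<epsilon> < 1" for \<epsilon>
  proof -
    let ?K = "ennreal ((1 + \<epsilon>) ^ ?n / (1 - \<epsilon>))" and ?k = "ennreal ((1 - \<epsilon>) ^ ?n / (1 + \<epsilon>))"
    let ?c = "ennreal (cube_const TYPE(real ^ 'k::{finite,wellorder}))"
    define good where "good = (\<lambda>B. open B \<and> B \<subseteq> \<Omega> \<and> (\<forall>E. E \<in> sets borel \<and> E \<subseteq> B \<longrightarrow>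
        ?H (f ` E) \<le> ?K * (?c * (\<integral>\<^sup>+x\<in>E. ?J x \<partial>lborel)) \<and>
        ?k * (?c * (\<integral>\<^sup>+x\<in>E. ?J x \<partial>lborel)) \<le> ?H (f ` E)))"
    have ex: "\<exists>B. x \<in> B \<and> good B" if x: "x \<in> \<Omega>" for x
    proof (rule local_area_estimate[OF \<Omega>(1) x der cont inj'[OF x] \<epsilon>])
      fix r :: real
      assume "r > 0" "ball x r \<subseteq> \<Omega>"
        "\<And>E. \<lbrakk>E \<in> sets borel; E \<subseteq> ball x r\<rbrakk> \<Longrightarrow> ?H (f ` E) \<le> ?K * (?c * (\<integral>\<^sup>+x\<in>E. ?J x \<partial>lborel))"
        "\<And>E. \<lbrakk>E \<in> sets borel; E \<subseteq> ball x r\<rbrakk> \<Longrightarrow> ?k * (?c * (\<integral>\<^sup>+x\<in>E. ?J x \<partial>lborel)) \<le> ?H (f ` E)"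
      then show ?thesis unfolding good_def by (intro exI[of _ "ball x r"]) simp
    qed
    obtain F where F: "F \<subseteq> Collect good" "countable F" "\<Union>F = \<Union>(Collect good)"
      using Lindelof[of "Collect good"] by (auto simp: good_def)
    have goodD: "open B" "B \<subseteq> \<Omega>"
        "\<And>E. \<lbrakk>E \<in> sets borel; E \<subseteq> B\<rbrakk> \<Longrightarrow> ?H (f ` E) \<le> ?K * (?c * (\<integral>\<^sup>+x\<in>E. ?J x \<partial>lborel))"
        "\<And>E. \<lbrakk>E \<in> sets borel; E \<subseteq> B\<rbrakk> \<Longrightarrow> ?k * (?c * (\<integral>\<^sup>+x\<in>E. ?J x \<partial>lborel)) \<le> ?H (f ` E)"
      if "good B" for B
      using that unfolding good_def by blast+
    have "\<Union>(Collect good) = \<Omega>" using ex goodD(2) by blast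
    then have UF: "\<Union>F = \<Omega>" using F(3) by simp
    then have "F \<noteq> {}" using False by auto
    define A where "A = from_nat_into F"
    have A: "A i \<in> F" for i unfolding A_def by (rule from_nat_into[OF \<open>F \<noteq> {}\<close>])
    have rangeA: "range A = F" unfolding A_def by (rule range_from_nat_into[OF \<open>F \<noteq> {}\<close> F(2)])
    define E where "E = disjointed A"
    have goodA: "good (A i)" for i using A F(1) by blast
    have EA: "E i \<subseteq> A i" for i unfolding E_def by (rule disjointed_subset)
    have A_borel: "range A \<subseteq> sets borel" using goodA by (auto intro: borel_open goodD(1))
    have Eb: "E i \<in> sets borel" for i
      using sets.range_disjointed_sets[OF A_borel] unfolding E_def by blast
    have E\<Omega>: "E i \<subseteq> \<Omega>" for i using EA[of i] goodD(2)[OF goodA[of i]] by blast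
    have dE: "disjoint_family E" unfolding E_def by (rule disjoint_family_disjointed)
    have UE: "(\<Union>i. E i) = \<Omega>" unfolding E_def UN_disjointed_eq using rangeA UF by simp
    have mE: "E i \<in> lmeasurable" for i
      using Eb[of i] bounded_subset[OF \<Omega>(2) E\<Omega>[of i]] by (intro bounded_set_imp_lmeasurable) auto
    have H: "?H (f ` \<Omega>) = (\<Sum>i. ?H (f ` E i))"
      using hausdorff_image_countably_additive[OF \<Omega>(2) mE E\<Omega> dE L inj] by (simp add: UE)
    define j where "j = (\<lambda>x. ennreal (indicat_real \<Omega> x *\<^sub>R gram_jacobian (f' x)))"
    have j: "j \<in> borel_measurable lborel"
      unfolding j_def using borel_measurable_continuous_on_indicator[OF _ continuous_on_gram_jacobian[of \<Omega> f', OF cont]] \<Omega>(1)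
      by simp
    have jE: "(\<integral>\<^sup>+x\<in>E'. ?J x \<partial>lborel) = emeasure (density lborel j) E'" if "E' \<in> sets borel" "E' \<subseteq> \<Omega>" for E'
      using that by (subst emeasure_density[OF j]) (auto intro!: nn_integral_cong simp: j_def indicator_def)
    have "(\<Sum>i. emeasure (density lborel j) (E i)) = emeasure (density lborel j) (\<Union>i. E i)"
      by (rule suminf_emeasure) (use Eb dE in auto)
    then have I: "(\<Sum>i. \<integral>\<^sup>+x\<in>E i. ?J x \<partial>lborel) = (\<integral>\<^sup>+x\<in>\<Omega>. ?J x \<partial>lborel)"
      using jE[OF Eb E\<Omega>] jE[of \<Omega>] \<Omega>(1) UE by simp
    have X: "X = (\<Sum>i. ?c * (\<integral>\<^sup>+x\<in>E i. ?J x \<partial>lborel))" unfolding X_def I[symmetric] by simp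
    have "?H (f ` \<Omega>) \<le> (\<Sum>i. ?K * (?c * (\<integral>\<^sup>+x\<in>E i. ?J x \<partial>lborel)))"
      unfolding H by (intro suminf_le goodD(3)[OF goodA Eb EA]) auto
    moreover have "(\<Sum>i. ?k * (?c * (\<integral>\<^sup>+x\<in>E i. ?J x \<partial>lborel))) \<le> ?H (f ` \<Omega>)"
      unfolding H by (intro suminf_le goodD(4)[OF goodA Eb EA]) auto
    ultimately show ?thesis unfolding X by simp
  qed
  have lim: "((\<lambda>\<epsilon>. ennreal (q \<epsilon>) * X) \<longlongrightarrow> X) (at_right 0)" if "(q \<longlongrightarrow> 1) (at_right 0)" for q :: "real \<Rightarrow> real"
  proof -
    have "((\<lambda>\<epsilon>. ennreal (q \<epsilon>)) \<longlongrightarrow> ennreal 1) (at_right 0)" using that by (rule tendsto_ennrealI)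
    then have "((\<lambda>\<epsilon>. ennreal (q \<epsilon>) * X) \<longlongrightarrow> ennreal 1 * X) (at_right 0)"
      by (rule tendsto_mult_ennreal) auto
    then show ?thesis by simp
  qed
  have ev: "eventually (\<lambda>\<epsilon>::real. 0 < \<epsilon> \<and> \<epsilon> < 1) (at_right 0)"
    unfolding eventually_at_right_field by (intro exI[of _ 1]) auto
  have "?H (f ` \<Omega>) = X"
  proof (rule antisym)
    have "((\<lambda>\<epsilon>::real. (1 + \<epsilon>) ^ ?n / (1 - \<epsilon>)) \<longlongrightarrow> (1 + 0) ^ ?n / (1 - 0)) (at_right 0)"
      by (intro tendsto_intros) auto
    then have "((\<lambda>\<epsilon>. ennreal ((1 + \<epsilon>) ^ ?n / (1 - \<epsilon>)) * X) \<longlongrightarrow> X) (at_right 0)" by (intro lim) simp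
    then show "?H (f ` \<Omega>) \<le> X"
      by (rule tendsto_lowerbound) (use ev est in \<open>auto elim!: eventually_mono\<close>)
    have "((\<lambda>\<epsilon>::real. (1 - \<epsilon>) ^ ?n / (1 + \<epsilon>)) \<longlongrightarrow> (1 - 0) ^ ?n / (1 + 0)) (at_right 0)"
      by (intro tendsto_intros) auto
    then have "((\<lambda>\<epsilon>. ennreal ((1 - \<epsilon>) ^ ?n / (1 + \<epsilon>)) * X) \<longlongrightarrow> X) (at_right 0)" by (intro lim) simp
    then show "X \<le> ?H (f ` \<Omega>)"
      by (rule tendsto_upperbound) (use ev est in \<open>auto elim!: eventually_mono\<close>)
  qed
  then show ?thesis by (simp add: X_def)
qed

section \<open>Determinants over different index sets\<close>

text \<open>
  The matrix \<open>B\<close> is \<open>C\<close> with rows and columns rescaled by \<open>s\<close>. Transporting permutations along \<open>\<sigma>\<close> identifies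
  the two Leibniz sums.
\<close>

lemma det_reindex:
  fixes B :: "real ^ 'k ^ 'k::finite" and C :: "real Matrix.mat"
  assumes \<sigma>: "bij_betw \<sigma> {0..<n} (UNIV :: 'k set)" and C: "C \<in> carrier_mat n n"
    and B: "\<And>p q. \<lbrakk>p < n; q < n\<rbrakk> \<Longrightarrow> B $ \<sigma> p $ \<sigma> q = s p * s q * C $$ (p, q)"
  shows "Determinants.det B = (\<Prod>p=0..<n. s p)\<^sup>2 * Determinant.det C"
proof -
  let ?A = "{0..<n}"
  let ?m = "map_permutation ?A \<sigma>"
  let ?\<tau> = "the_inv_into ?A \<sigma>"
  have inj: "inj_on \<sigma> ?A" using \<sigma> by (rule bij_betw_imp_inj_on)
  have \<tau>: "bij_betw ?\<tau> UNIV ?A" by (rule bij_betw_the_inv_into[OF \<sigma>])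
  have bij: "bij_betw ?m {\<pi>. \<pi> permutes ?A} {\<pi>. \<pi> permutes (UNIV :: 'k set)}"
  proof (rule bij_betwI[where g = "map_permutation UNIV ?\<tau>"])
    show "?m \<in> {\<pi>. \<pi> permutes ?A} \<rightarrow> {\<pi>. \<pi> permutes UNIV}"
      using map_permutation_permutes[OF \<sigma>] by blast
    show "map_permutation UNIV ?\<tau> \<in> {\<pi>. \<pi> permutes UNIV} \<rightarrow> {\<pi>. \<pi> permutes ?A}"
      using map_permutation_permutes[OF \<tau>] by blast
    show "map_permutation UNIV ?\<tau> (?m \<pi>) = \<pi>" if "\<pi> \<in> {\<pi>. \<pi> permutes ?A}" for \<pi>
      by (rule map_permutation_compose_inv[OF \<sigma>]) (use that the_inv_into_f_f[OF inj] in auto)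
    show "?m (map_permutation UNIV ?\<tau> \<pi>) = \<pi>" if "\<pi> \<in> {\<pi>. \<pi> permutes UNIV}" for \<pi>
      by (rule map_permutation_compose_inv[OF \<tau>]) (use that f_the_inv_into_f_bij_betw[OF \<sigma>] in auto)
  qed
  have "Determinants.det B = (\<Sum>\<pi>\<in>{\<pi>. \<pi> permutes ?A}. of_int (sign (?m \<pi>)) * (\<Prod>k\<in>UNIV. B $ k $ ?m \<pi> k))"
    unfolding Determinants.det_def by (rule sum.reindex_bij_betw[OF bij, symmetric])
  also have "\<dots> = (\<Sum>\<pi>\<in>{\<pi>. \<pi> permutes ?A}. (\<Prod>p\<in>?A. s p)\<^sup>2 * (of_int (sign \<pi>) * (\<Prod>p\<in>?A. C $$ (p, \<pi> p))))"
  proof (rule sum.cong[OF refl])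
    fix \<pi> assume "\<pi> \<in> {\<pi>. \<pi> permutes ?A}"
    then have \<pi>: "\<pi> permutes ?A" by simp
    have "(\<Prod>k\<in>UNIV. B $ k $ ?m \<pi> k) = (\<Prod>p\<in>?A. B $ \<sigma> p $ ?m \<pi> (\<sigma> p))"
      by (rule prod.reindex_bij_betw[OF \<sigma>, symmetric])
    also have "\<dots> = (\<Prod>p\<in>?A. s p * s (\<pi> p) * C $$ (p, \<pi> p))"
    proof (rule prod.cong[OF refl])
      fix p assume p: "p \<in> ?A"
      have "\<pi> p \<in> ?A" using \<pi> p by (simp add: permutes_in_image)
      then show "B $ \<sigma> p $ ?m \<pi> (\<sigma> p) = s p * s (\<pi> p) * C $$ (p, \<pi> p)"
        using p by (simp add: map_permutation_apply[OF inj] B)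
    qed
    also have "\<dots> = (\<Prod>p\<in>?A. s p) * (\<Prod>p\<in>?A. s (\<pi> p)) * (\<Prod>p\<in>?A. C $$ (p, \<pi> p))"
      by (simp add: prod.distrib)
    also have "(\<Prod>p\<in>?A. s (\<pi> p)) = (\<Prod>p\<in>?A. s p)"
      using prod.permute[OF \<pi>, of s] by (simp add: comp_def)
    finally show "of_int (sign (?m \<pi>)) * (\<Prod>k\<in>UNIV. B $ k $ ?m \<pi> k) =
        (\<Prod>p\<in>?A. s p)\<^sup>2 * (of_int (sign \<pi>) * (\<Prod>p\<in>?A. C $$ (p, \<pi> p)))"
      using sign_map_permutation[OF inj \<pi>] by (simp add: power2_eq_square)
  qed
  also have "\<dots> = (\<Prod>p\<in>?A. s p)\<^sup>2 * Determinant.det C"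
    using C by (simp add: det_def' sum_distrib_left)
  finally show ?thesis .
qed

section \<open>Dirichlet integrals\<close>

lemma deriv_divided_power:
  fixes s t :: real
  shows "((\<lambda>t. (s - t) ^ Suc k / fact (Suc k)) has_real_derivative - ((s - t) ^ k / fact k)) (at t)"
proof -
  have "((\<lambda>t. (s - t) ^ Suc k) has_real_derivative real (Suc k) * (-1 * (s - t) ^ (Suc k - Suc 0))) (at t)"
    by (rule DERIV_power) (auto intro!: derivative_eq_intros)
  then have "((\<lambda>t. (s - t) ^ Suc k / fact (Suc k)) has_real_derivative
      real (Suc k) * (-1 * (s - t) ^ (Suc k - Suc 0)) / fact (Suc k)) (at t)"
    by (rule DERIV_cdivide)
  moreover have "real (Suc k) * (-1 * (s - t) ^ (Suc k - Suc 0)) / fact (Suc k) = - ((s - t) ^ k / fact k)"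
    by (simp add: fact_Suc del: of_nat_Suc)
  ultimately show ?thesis by (simp only:)
qed

lemma beta_integral:
  fixes s :: real
  assumes "s \<ge> 0"
  shows "(\<integral>\<^sup>+t. ennreal ((if e then t else 1) * (s - t) ^ m / fact m) * indicator {0..s} t \<partial>lborel) =
    ennreal (s ^ (m + (if e then 2 else 1)) / fact (m + (if e then 2 else 1)))"
proof (cases e)
  case False
  have "(\<integral>\<^sup>+t. ennreal ((s - t) ^ m / fact m) * indicator {0..s} t \<partial>lborel) =
      (- ((s - s) ^ Suc m / fact (Suc m))) - (- ((s - 0) ^ Suc m / fact (Suc m)))"
  proof (rule nn_integral_FTC_Icc[where F = "\<lambda>t. - ((s - t) ^ Suc m / fact (Suc m))"])
    fix t assume "t \<in> {0..s}"
    show "((\<lambda>t. - ((s - t) ^ Suc m / fact (Suc m))) has_real_derivative (s - t) ^ m / fact m) (at t)"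
      using DERIV_minus[OF deriv_divided_power[of s m t]] by (simp only: minus_minus)
  qed (use assms in auto)
  then show ?thesis using False by simp
next
  case True
  let ?F = "\<lambda>t. - (t * ((s - t) ^ Suc m / fact (Suc m)) + (s - t) ^ Suc (Suc m) / fact (Suc (Suc m)))"
  have "(\<integral>\<^sup>+t. ennreal (t * (s - t) ^ m / fact m) * indicator {0..s} t \<partial>lborel) = ?F s - ?F 0"
  proof (rule nn_integral_FTC_Icc)
    fix t assume t: "t \<in> {0..s}"
    have "(?F has_real_derivative - ((1 * ((s - t) ^ Suc m / fact (Suc m)) + - ((s - t) ^ m / fact m) * t) + - ((s - t) ^ Suc m / fact (Suc m)))) (at t)"
      by (intro DERIV_minus DERIV_add DERIV_mult DERIV_ident deriv_divided_power)
    then show "(?F has_real_derivative t * (s - t) ^ m / fact m) (at t)" by (simp add: mult.commute)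
    show "0 \<le> t * (s - t) ^ m / fact m" using t by simp
  qed (use assms in auto)
  also have "?F s - ?F 0 = s ^ Suc (Suc m) / fact (Suc (Suc m))" by simp
  finally show ?thesis using True by (simp add: numeral_2_eq_2)
qed

interpretation lborel_product: product_sigma_finite "\<lambda>_ :: nat. lborel :: real measure"
  by standard

lemma simplex_pred_measurable:
  assumes "finite W"
  shows "Measurable.pred (PiM W (\<lambda>_. lborel)) (\<lambda>w :: nat \<Rightarrow> real. (\<forall>i\<in>W. 0 \<le> w i) \<and> sum w W \<le> s)"
proof -
  have c: "(\<lambda>w. w i) \<in> borel_measurable (PiM W (\<lambda>_. lborel :: real measure))" if "i \<in> W" for i
    using measurable_component_singleton[OF that, of "\<lambda>_. lborel"] by simp
  have "(\<lambda>w. sum w W) \<in> borel_measurable (PiM W (\<lambda>_. lborel :: real measure))"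
    using c by (rule borel_measurable_sum)
  moreover have "Measurable.pred (PiM W (\<lambda>_. lborel :: real measure)) (\<lambda>w. \<forall>i\<in>W. 0 \<le> w i)"
    using assms c by (intro pred_intros_finite) (auto intro: borel_measurable_le)
  ultimately show ?thesis by measurable
qed

lemma prod_measurable:
  assumes "V \<subseteq> W"
  shows "(\<lambda>w. \<Prod>i\<in>V. w i) \<in> borel_measurable (PiM W (\<lambda>_. lborel :: real measure))"
proof (rule borel_measurable_prod)
  fix i assume "i \<in> V"
  then show "(\<lambda>w. w i) \<in> borel_measurable (PiM W (\<lambda>_. lborel :: real measure))"
    using measurable_component_singleton[of i W "\<lambda>_. lborel"] assms by auto
qed

text \<open>
  Each variable raises the degree by one, or by two if it occurs as a factor in the integrand, as
  integrating it out is a beta integral.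
\<close>

lemma dirichlet_integral:
  fixes W :: "nat set"
  assumes "finite W" "s \<ge> 0"
  shows "(\<integral>\<^sup>+w. (if (\<forall>i\<in>W. 0 \<le> w i) \<and> sum w W \<le> s then ennreal (\<Prod>i\<in>W \<inter> V. w i) else 0) \<partial>PiM W (\<lambda>_. lborel)) =
    ennreal (s ^ (card W + card (W \<inter> V)) / fact (card W + card (W \<inter> V)))"
  using assms
proof (induction W arbitrary: s rule: finite_induct)
  case empty
  then show ?case by (simp add: space_PiM_empty lborel_product.nn_integral_empty)
next
  case (insert i W)
  let ?d = "card W + card (W \<inter> V)"
  let ?f = "\<lambda>s w. if (\<forall>i\<in>W. 0 \<le> w i) \<and> sum w W \<le> s then ennreal (\<Prod>i\<in>W \<inter> V. w i) else 0"
  let ?g = "\<lambda>w. if (\<forall>j\<in>insert i W. 0 \<le> w j) \<and> sum w (insert i W) \<le> s then ennreal (\<Prod>j\<in>insert i W \<inter> V. w j) else 0"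
  have fin: "finite (insert i W)" using insert.hyps by simp
  have m: "?g \<in> borel_measurable (PiM (insert i W) (\<lambda>_. lborel))"
    by (intro measurable_If simplex_pred_measurable[OF fin, unfolded Measurable.pred_def] measurable_compose[OF prod_measurable measurable_ennreal])
       auto
  have "(\<integral>\<^sup>+w. ?g w \<partial>PiM (insert i W) (\<lambda>_. lborel)) =
      (\<integral>\<^sup>+t. (\<integral>\<^sup>+w. ?g (w(i := t)) \<partial>PiM W (\<lambda>_. lborel)) \<partial>lborel)"
    by (rule lborel_product.product_nn_integral_insert_rev[OF insert.hyps m])
  also have "\<dots> = (\<integral>\<^sup>+t. ennreal ((if i \<in> V then t else 1) * (s - t) ^ ?d / fact ?d) * indicator {0..s} t \<partial>lborel)"
  proof (rule nn_integral_cong)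
    fix t :: real
    have s: "sum (w(i := t)) (insert i W) = t + sum w W" for w
      using insert.hyps by (simp add: sum.insert) (rule sum.cong, auto)
    have p: "(\<Prod>j\<in>insert i W \<inter> V. (w(i := t)) j) = (if i \<in> V then t else 1) * (\<Prod>j\<in>W \<inter> V. w j)" for w :: "nat \<Rightarrow> real"
    proof -
      have e: "(\<Prod>j\<in>W \<inter> V. (w(i := t)) j) = (\<Prod>j\<in>W \<inter> V. w j)" using insert.hyps by (intro prod.cong) auto
      show ?thesis
      proof (cases "i \<in> V")
        case True
        then have "insert i W \<inter> V = insert i (W \<inter> V)" by blast
        then show ?thesis using True insert.hyps e by simp
      qed (use e in simp)
    qed
    have a: "(\<forall>j\<in>insert i W. 0 \<le> (w(i := t)) j) \<longleftrightarrow> 0 \<le> t \<and> (\<forall>j\<in>W. 0 \<le> w j)" for w :: "nat \<Rightarrow> real"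
      using insert.hyps by auto
    have g: "?g (w(i := t)) = ennreal (if i \<in> V then t else 1) * indicator {0..} t * ?f (s - t) w" for w
      unfolding s p a by (auto simp: indicator_def ennreal_mult'[symmetric] le_diff_eq add.commute)
    have mf: "?f (s - t) \<in> borel_measurable (PiM W (\<lambda>_. lborel))"
      by (intro measurable_If simplex_pred_measurable[OF insert.hyps(1), unfolded Measurable.pred_def] measurable_compose[OF prod_measurable measurable_ennreal])
         auto
    show "(\<integral>\<^sup>+w. ?g (w(i := t)) \<partial>PiM W (\<lambda>_. lborel)) =
        ennreal ((if i \<in> V then t else 1) * (s - t) ^ ?d / fact ?d) * indicator {0..s} t"
    proof (cases "0 \<le> t \<and> t \<le> s")
      case True
      have "(\<integral>\<^sup>+w. ?g (w(i := t)) \<partial>PiM W (\<lambda>_. lborel)) = ennreal (if i \<in> V then t else 1) * indicator {0..} t * (\<integral>\<^sup>+w. ?f (s - t) w \<partial>PiM W (\<lambda>_. lborel))"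
        unfolding g by (rule nn_integral_cmult[OF mf])
      also have "(\<integral>\<^sup>+w. ?f (s - t) w \<partial>PiM W (\<lambda>_. lborel)) = ennreal ((s - t) ^ ?d / fact ?d)"
        by (rule insert.IH) (use True in simp)
      finally show ?thesis using True by (auto simp: ennreal_mult'[symmetric])
    next
      case False
      have "?g (w(i := t)) = 0" for w
      proof (cases "0 \<le> t")
        case True
        then have "\<not> ((\<forall>i\<in>W. 0 \<le> w i) \<and> sum w W \<le> s - t)" using False sum_nonneg[of W w] by auto
        then show ?thesis unfolding g by auto
      next
        case False
        then show ?thesis unfolding g by (simp add: indicator_def)
      qed
      then show ?thesis using False by (auto simp: indicator_def)
    qed
  qed
  also have "\<dots> = ennreal (s ^ (?d + (if i \<in> V then 2 else 1)) / fact (?d + (if i \<in> V then 2 else 1)))"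
    by (rule beta_integral[OF insert.prems])
  also have "?d + (if i \<in> V then 2 else 1) = card (insert i W) + card (insert i W \<inter> V)"
  proof (cases "i \<in> V")
    case True
    then have "insert i W \<inter> V = insert i (W \<inter> V)" by blast
    then show ?thesis using True insert.hyps by simp
  qed (use insert.hyps in simp)
  finally show ?case .
qed

text \<open>
  If the dependent weight \<open>b w p0 = 1 - sum w W\<close> is a factor, it is written as the integral of \<open>1\<close> over an
  additional variable in \<open>[0, 1 - sum w W]\<close>. So in both cases the exponent is \<open>card W + card V\<close>.
\<close>

lemma dirichlet_integral_barycentric:
  fixes W :: "nat set"
  assumes "finite W" "p0 \<notin> W" "V \<subseteq> insert p0 W"
  defines "b \<equiv> \<lambda>w i. if i = p0 then 1 - sum w W else w i"
  shows "(\<integral>\<^sup>+w. (if \<forall>i\<in>insert p0 W. 0 \<le> b w i then ennreal (\<Prod>i\<in>V. b w i) else 0) \<partial>PiM W (\<lambda>_. lborel)) =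
    ennreal (1 / fact (card W + card V))"
proof (cases "p0 \<in> V")
  case False
  have "(\<integral>\<^sup>+w. (if \<forall>i\<in>insert p0 W. 0 \<le> b w i then ennreal (\<Prod>i\<in>V. b w i) else 0) \<partial>PiM W (\<lambda>_. lborel)) =
      (\<integral>\<^sup>+w. (if (\<forall>i\<in>W. 0 \<le> w i) \<and> sum w W \<le> 1 then ennreal (\<Prod>i\<in>W \<inter> V. w i) else 0) \<partial>PiM W (\<lambda>_. lborel))"
  proof (rule nn_integral_cong)
    fix w :: "nat \<Rightarrow> real"
    have "W \<inter> V = V" using assms(3) False by blast
    moreover have "(\<Prod>i\<in>V. b w i) = (\<Prod>i\<in>V. w i)" using False by (intro prod.cong) (auto simp: b_def)
    moreover have "(\<forall>i\<in>insert p0 W. 0 \<le> b w i) \<longleftrightarrow> (\<forall>i\<in>W. 0 \<le> w i) \<and> sum w W \<le> 1"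
      using assms(2) by (auto simp: b_def)
    ultimately show "(if \<forall>i\<in>insert p0 W. 0 \<le> b w i then ennreal (\<Prod>i\<in>V. b w i) else 0) =
        (if (\<forall>i\<in>W. 0 \<le> w i) \<and> sum w W \<le> 1 then ennreal (\<Prod>i\<in>W \<inter> V. w i) else 0)" by simp
  qed
  also have "\<dots> = ennreal (1 / fact (card W + card (W \<inter> V)))"
    using dirichlet_integral[OF assms(1), of 1 V] by simp
  also have "W \<inter> V = V" using assms(3) False by blast
  finally show ?thesis .
next
  case True
  define V' where "V' = V - {p0}"
  have V': "V' \<subseteq> W" "V = insert p0 V'" "p0 \<notin> V'" using assms(3) True by (auto simp: V'_def)
  have finV': "finite V'" using V'(1) assms(1) finite_subset by blast
  let ?P = "insert p0 W"
  let ?g = "\<lambda>w. if (\<forall>j\<in>?P. 0 \<le> w j) \<and> sum w ?P \<le> 1 then ennreal (\<Prod>j\<in>?P \<inter> V'. w j) else 0"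
  have fin: "finite ?P" using assms(1) by simp
  have m: "?g \<in> borel_measurable (PiM ?P (\<lambda>_. lborel))"
    by (intro measurable_If simplex_pred_measurable[OF fin, unfolded Measurable.pred_def] measurable_compose[OF prod_measurable measurable_ennreal])
       auto
  have PV: "?P \<inter> V' = V'" using V'(1) by blast
  have "ennreal (1 / fact (card ?P + card (?P \<inter> V'))) = (\<integral>\<^sup>+w. ?g w \<partial>PiM ?P (\<lambda>_. lborel))"
    using dirichlet_integral[OF fin, of 1 V'] by simp
  also have "\<dots> = (\<integral>\<^sup>+w. (\<integral>\<^sup>+t. ?g (w(p0 := t)) \<partial>lborel) \<partial>PiM W (\<lambda>_. lborel))"
    by (rule lborel_product.product_nn_integral_insert[OF assms(1,2) m])
  also have "\<dots> = (\<integral>\<^sup>+w. (if \<forall>i\<in>?P. 0 \<le> b w i then ennreal (\<Prod>i\<in>V. b w i) else 0) \<partial>PiM W (\<lambda>_. lborel))"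
  proof (rule nn_integral_cong)
    fix w :: "nat \<Rightarrow> real"
    let ?r = "1 - sum w W"
    have s: "sum (w(p0 := t)) ?P = t + sum w W" for t
      using assms(1,2) by (simp add: sum.insert) (rule sum.cong, auto)
    have p: "(\<Prod>j\<in>?P \<inter> V'. (w(p0 := t)) j) = (\<Prod>j\<in>V'. w j)" for t
      unfolding PV using V'(3) by (intro prod.cong) auto
    have a: "(\<forall>j\<in>?P. 0 \<le> (w(p0 := t)) j) \<longleftrightarrow> 0 \<le> t \<and> (\<forall>j\<in>W. 0 \<le> w j)" for t
      using assms(2) by auto
    have g: "?g (w(p0 := t)) = (if \<forall>j\<in>W. 0 \<le> w j then ennreal (\<Prod>j\<in>V'. w j) else 0) * indicator {0..?r} t" for t
      unfolding s p a by (auto simp: indicator_def)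
    have "(\<integral>\<^sup>+t. ?g (w(p0 := t)) \<partial>lborel) = (if \<forall>j\<in>W. 0 \<le> w j then ennreal (\<Prod>j\<in>V'. w j) else 0) * emeasure lborel {0..?r}"
      unfolding g by (rule nn_integral_cmult_indicator) simp
    also have "emeasure lborel {0..?r} = (if 0 \<le> ?r then ennreal ?r else 0)" by simp
    also have "(if \<forall>j\<in>W. 0 \<le> w j then ennreal (\<Prod>j\<in>V'. w j) else 0) * (if 0 \<le> ?r then ennreal ?r else 0) =
        (if \<forall>i\<in>?P. 0 \<le> b w i then ennreal (\<Prod>i\<in>V. b w i) else 0)"
    proof -
      have "(\<Prod>i\<in>V. b w i) = ?r * (\<Prod>j\<in>V'. w j)"
      proof -
        have "(\<Prod>i\<in>V'. b w i) = (\<Prod>j\<in>V'. w j)" using V'(3) by (intro prod.cong) (auto simp: b_def)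
        then show ?thesis unfolding V'(2) using finV' V'(3) by (simp add: b_def)
      qed
      moreover have "(\<forall>i\<in>?P. 0 \<le> b w i) \<longleftrightarrow> 0 \<le> ?r \<and> (\<forall>i\<in>W. 0 \<le> w i)"
        using assms(2) by (auto simp: b_def)
      moreover have "ennreal (?r * (\<Prod>j\<in>V'. w j)) = ennreal (\<Prod>j\<in>V'. w j) * ennreal ?r" if "0 \<le> ?r" "\<forall>i\<in>W. 0 \<le> w i"
        using that V'(1) by (subst ennreal_mult) (auto intro!: prod_nonneg simp: mult.commute)
      ultimately show ?thesis by auto
    qed
    finally show "(\<integral>\<^sup>+t. ?g (w(p0 := t)) \<partial>lborel) = (if \<forall>i\<in>?P. 0 \<le> b w i then ennreal (\<Prod>i\<in>V. b w i) else 0)" .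
  qed
  also have "card ?P + card (?P \<inter> V') = card W + card V"
    unfolding PV using assms(1,2) V' finV' by simp
  finally show ?thesis by simp
qed

section \<open>Splitting the coordinates of a Euclidean space\<close>

lemma prod_Basis_vec: "(\<Prod>b\<in>Basis. v \<bullet> b) = (\<Prod>k\<in>UNIV. v $ k)" for v :: "real ^ 'k::finite"
proof -
  have "(Basis :: (real ^ 'k) set) = (\<lambda>k. axis k 1) ` UNIV" by (auto simp: Basis_vec_def)
  then have "(\<Prod>b\<in>Basis. v \<bullet> b) = (\<Prod>b\<in>(\<lambda>k. axis k 1) ` UNIV. v \<bullet> b)" by (simp only:)
  also have "\<dots> = (\<Prod>k\<in>UNIV. v \<bullet> axis k 1)"
    by (rule prod.reindex_cong[of "\<lambda>k. axis k 1"]) (auto simp: inj_on_def axis_eq_axis)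
  finally show ?thesis by (simp add: inner_axis)
qed

definition join_coords :: "nat set \<Rightarrow> nat set \<Rightarrow> (nat \<Rightarrow> 'k) \<Rightarrow> (nat \<Rightarrow> 'k) \<Rightarrow> (nat \<Rightarrow> real) \<times> (nat \<Rightarrow> real) \<Rightarrow> real ^ 'k" where
  "join_coords W M \<kappa> \<xi> = (\<lambda>(w, x). \<chi> k. if k \<in> \<kappa> ` W then w (the_inv_into W \<kappa> k) else x (the_inv_into M \<xi> k))"

locale coordinate_split =
  fixes W M :: "nat set" and \<kappa> \<xi> :: "nat \<Rightarrow> 'k::finite"
  assumes finW: "finite W" and finM: "finite M" and inj\<kappa>: "inj_on \<kappa> W" and inj\<xi>: "inj_on \<xi> M"
    and disj: "\<kappa> ` W \<inter> \<xi> ` M = {}" and cover: "\<kappa> ` W \<union> \<xi> ` M = UNIV"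
begin

lemma join_weight [simp]: "i \<in> W \<Longrightarrow> join_coords W M \<kappa> \<xi> (w, x) $ \<kappa> i = w i"
  by (simp add: join_coords_def the_inv_into_f_f[OF inj\<kappa>])

lemma join_point [simp]: "i \<in> M \<Longrightarrow> join_coords W M \<kappa> \<xi> (w, x) $ \<xi> i = x i"
  using disj by (auto simp: join_coords_def the_inv_into_f_f[OF inj\<xi>])

lemma all_coords: "(\<forall>k. Q k) \<longleftrightarrow> (\<forall>i\<in>W. Q (\<kappa> i)) \<and> (\<forall>i\<in>M. Q (\<xi> i))"
  using cover by (metis UNIV_I UnE imageE)

lemma prod_coords: "(\<Prod>k\<in>UNIV. h k) = (\<Prod>i\<in>W. h (\<kappa> i)) * (\<Prod>i\<in>M. h (\<xi> i))" for h :: "'k \<Rightarrow> real"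
proof -
  have "(\<Prod>k\<in>UNIV. h k) = (\<Prod>k\<in>\<kappa> ` W. h k) * (\<Prod>k\<in>\<xi> ` M. h k)"
    unfolding cover[symmetric] by (rule prod.union_disjoint) (use finW finM disj in auto)
  then show ?thesis by (simp add: prod.reindex[OF inj\<kappa>] prod.reindex[OF inj\<xi>])
qed

lemma join_measurable:
  "join_coords W M \<kappa> \<xi> \<in> borel_measurable (PiM W (\<lambda>_. lborel :: real measure) \<Otimes>\<^sub>M PiM M (\<lambda>_. lborel :: real measure))"
  (is "_ \<in> borel_measurable ?N")
proof -
  have 1: "(\<lambda>p. fst p i) \<in> borel_measurable ?N" if "i \<in> W" for i
    using measurable_compose[OF measurable_fst measurable_component_singleton[OF that, of "\<lambda>_. lborel"]] by simp
  have 2: "(\<lambda>p. snd p i) \<in> borel_measurable ?N" if "i \<in> M" for i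
    using measurable_compose[OF measurable_snd measurable_component_singleton[OF that, of "\<lambda>_. lborel"]] by simp
  have "(\<lambda>p. join_coords W M \<kappa> \<xi> p $ k) \<in> borel_measurable ?N" for k
  proof (cases "k \<in> \<kappa> ` W")
    case True
    then obtain i where i: "i \<in> W" "k = \<kappa> i" by blast
    have "(\<lambda>p. join_coords W M \<kappa> \<xi> p $ k) = (\<lambda>p. fst p i)"
      by (rule ext) (use i in \<open>auto simp: split_beta join_weight[of i "fst _" "snd _", simplified]\<close>)
    then show ?thesis using 1[OF i(1)] by simp
  next
    case False
    then obtain i where i: "i \<in> M" "k = \<xi> i" using cover by blast
    have "(\<lambda>p. join_coords W M \<kappa> \<xi> p $ k) = (\<lambda>p. snd p i)"
      by (rule ext) (use i in \<open>auto simp: split_beta join_point[of i "fst _" "snd _", simplified]\<close>)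
    then show ?thesis using 2[OF i(1)] by simp
  qed
  then have "(\<lambda>p. join_coords W M \<kappa> \<xi> p \<bullet> b) \<in> borel_measurable ?N" if "b \<in> Basis" for b
    using that by (auto simp: Basis_vec_def inner_axis)
  then show ?thesis unfolding borel_measurable_euclidean_space[where f = "join_coords W M \<kappa> \<xi>"] by blast
qed

text \<open>
  Both measures agree on boxes, which are products of boxes in the two groups of coordinates.
\<close>

lemma lborel_eq_join:
  "lborel = distr (PiM W (\<lambda>_. lborel) \<Otimes>\<^sub>M PiM M (\<lambda>_. lborel)) borel (join_coords W M \<kappa> \<xi>)"
  (is "_ = distr ?N borel ?T")
proof (rule lborel_eqI)
  fix l u :: "real ^ 'k" assume "\<And>b. b \<in> Basis \<Longrightarrow> l \<bullet> b \<le> u \<bullet> b"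
  then have lu: "l $ k \<le> u $ k" for k by (metis inner_axis' axis_in_Basis_iff Basis_real_def insertI1 inner_commute mult_1 inner_real_def real_inner_1_right)
  interpret M: finite_product_sigma_finite "\<lambda>_ :: nat. lborel :: real measure" M by standard (rule finM)
  let ?A = "PiE W (\<lambda>i. {l $ \<kappa> i<..<u $ \<kappa> i})" and ?B = "PiE M (\<lambda>i. {l $ \<xi> i<..<u $ \<xi> i})"
  have pre: "?T -` box l u \<inter> space ?N = ?A \<times> ?B"
  proof -
    have "?T (w, x) \<in> box l u \<longleftrightarrow> (\<forall>i\<in>W. l $ \<kappa> i < w i \<and> w i < u $ \<kappa> i) \<and> (\<forall>i\<in>M. l $ \<xi> i < x i \<and> x i < u $ \<xi> i)" for w x
      unfolding mem_box_cart all_coords by simp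
    then show ?thesis
      by (auto simp: space_pair_measure space_PiM PiE_iff)
  qed
  have sets: "?A \<in> sets (PiM W (\<lambda>_. lborel))" "?B \<in> sets (PiM M (\<lambda>_. lborel))"
    using finW finM by (auto intro!: sets_PiM_I_finite)
  have "emeasure (distr ?N borel ?T) (box l u) = emeasure ?N (?A \<times> ?B)"
    using join_measurable by (simp add: emeasure_distr pre)
  also have "\<dots> = emeasure (PiM W (\<lambda>_. lborel)) ?A * emeasure (PiM M (\<lambda>_. lborel)) ?B"
    by (rule M.emeasure_pair_measure_Times[OF sets])
  also have "\<dots> = (\<Prod>i\<in>W. ennreal (u $ \<kappa> i - l $ \<kappa> i)) * (\<Prod>i\<in>M. ennreal (u $ \<xi> i - l $ \<xi> i))"
    using finW finM lu by (simp add: lborel_product.emeasure_PiM)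
  also have "\<dots> = ennreal (\<Prod>k\<in>UNIV. (u - l) $ k)"
    using lu by (simp add: prod_coords prod_ennreal ennreal_mult' prod_nonneg)
  finally show "emeasure (distr ?N borel ?T) (box l u) = ennreal (prod ((\<bullet>) (u - l)) Basis)"
    by (simp add: prod_Basis_vec)
qed simp

lemma nn_integral_split:
  assumes "h \<in> borel_measurable borel"
  shows "(\<integral>\<^sup>+v. h v \<partial>lborel) = (\<integral>\<^sup>+x. (\<integral>\<^sup>+w. h (join_coords W M \<kappa> \<xi> (w, x)) \<partial>PiM W (\<lambda>_. lborel)) \<partial>PiM M (\<lambda>_. lborel))"
proof -
  let ?N = "PiM W (\<lambda>_. lborel :: real measure) \<Otimes>\<^sub>M PiM M (\<lambda>_. lborel :: real measure)"
  interpret W: finite_product_sigma_finite "\<lambda>_ :: nat. lborel :: real measure" W by standard (rule finW)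
  interpret M: finite_product_sigma_finite "\<lambda>_ :: nat. lborel :: real measure" M by standard (rule finM)
  interpret pair_sigma_finite "PiM W (\<lambda>_. lborel :: real measure)" "PiM M (\<lambda>_. lborel :: real measure)" ..
  have "(\<integral>\<^sup>+v. h v \<partial>lborel) = (\<integral>\<^sup>+v. h v \<partial>distr ?N borel (join_coords W M \<kappa> \<xi>))"
    using lborel_eq_join by simp
  also have "\<dots> = (\<integral>\<^sup>+p. h (join_coords W M \<kappa> \<xi> p) \<partial>?N)"
    by (rule nn_integral_distr) (use join_measurable assms in auto)
  also have "\<dots> = (\<integral>\<^sup>+x. (\<integral>\<^sup>+w. h (join_coords W M \<kappa> \<xi> (w, x)) \<partial>PiM W (\<lambda>_. lborel)) \<partial>PiM M (\<lambda>_. lborel))"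
    using nn_integral_snd[OF measurable_compose[OF join_measurable assms]] by simp
  finally show ?thesis .
qed

end

section \<open>The area swept out by a family of simplices\<close>

context torsion_curve
begin

lemma \<gamma>_deriv_interior: "t \<in> {a<..<b} \<Longrightarrow> (\<gamma> has_vector_derivative \<gamma>' t) (at t)"
  using \<gamma>_deriv[of t] at_within_interior[of t "{a..b}"] by (simp add: interior_atLeastAtMost_real)

lemma ex_curve_bounds:
  obtains B where "B > 0" "\<And>t. t \<in> {a..b} \<Longrightarrow> norm (\<gamma> t) \<le> B"
    "\<And>s t. \<lbrakk>s \<in> {a..b}; t \<in> {a..b}\<rbrakk> \<Longrightarrow> norm (\<gamma> s - \<gamma> t) \<le> B * \<bar>s - t\<bar>"
proof -
  have "bounded (\<gamma> ` {a..b})" "bounded (\<gamma>' ` {a..b})"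
    by (intro compact_imp_bounded compact_continuous_image \<gamma>_cont \<gamma>'_cont compact_Icc)+
  then obtain B1 B2 where B: "B1 > 0" "\<And>t. t \<in> {a..b} \<Longrightarrow> norm (\<gamma> t) \<le> B1"
      "B2 > 0" "\<And>t. t \<in> {a..b} \<Longrightarrow> norm (\<gamma>' t) \<le> B2"
    unfolding bounded_pos by (metis imageI)
  have lip: "norm (\<gamma> s - \<gamma> t) \<le> B2 * norm (s - t)" if "s \<in> {a..b}" "t \<in> {a..b}" for s t
  proof (rule differentiable_bound[OF _ _ _ that])
    show "(\<gamma> has_derivative (\<lambda>h. h *\<^sub>R \<gamma>' r)) (at r within {a..b})" if "r \<in> {a..b}" for r
      using \<gamma>_deriv[OF that] by (simp add: has_vector_derivative_def)
    show "onorm (\<lambda>h. h *\<^sub>R \<gamma>' r) \<le> B2" if "r \<in> {a..b}" for r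
      by (rule onorm_le) (use B(4)[OF that] in \<open>simp add: mult.commute[of B2] mult_left_mono\<close>)
  qed auto
  show ?thesis
  proof (rule that[of "max B1 B2"])
    show "norm (\<gamma> t) \<le> max B1 B2" if "t \<in> {a..b}" for t using B(2)[OF that] by simp
    show "norm (\<gamma> s - \<gamma> t) \<le> max B1 B2 * \<bar>s - t\<bar>" if "s \<in> {a..b}" "t \<in> {a..b}" for s t
    proof -
      have "B2 * norm (s - t) \<le> max B1 B2 * norm (s - t)" by (intro mult_right_mono) auto
      then show ?thesis using lip[OF that] by simp
    qed
  qed (use B in simp)
qed

end

lemma negligible_finite_UN:
  "finite A \<Longrightarrow> (\<And>i. i \<in> A \<Longrightarrow> negligible (X i)) \<Longrightarrow> negligible (\<Union>i\<in>A. X i)"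
  by (rule negligible_Union) auto

context simplex_family
begin

definition mat_of :: "(nat \<Rightarrow> real) \<Rightarrow> real Matrix.mat" where
  "mat_of x = columns (map (\<lambda>i. \<gamma> (node x i) - \<gamma> (node x p0)) (sorted_list_of_set (P - {p0})) @
     map (\<lambda>i. \<gamma>' (x i)) (sorted_list_of_set M))"

end

text \<open>
  The parameters of a family are made the coordinates of a Euclidean space: \<open>\<kappa> i\<close> is the coordinate
  holding the weight of the vertex \<open>i\<close>, and \<open>\<xi> i\<close> the one holding the position of the moving vertex
  \<open>i\<close>.
\<close>

locale simplex_param = simplex_family \<gamma> a b P M p0 e + coordinate_split "P - {p0}" M \<kappa> \<xi>
  for \<gamma> :: "real \<Rightarrow> real ^ 'm::{finite,linorder}" and a b :: real
    and P M :: "nat set" and p0 :: nat and e :: "nat \<Rightarrow> real"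
    and \<kappa> \<xi> :: "nat \<Rightarrow> 'k::{finite,wellorder}"
begin

abbreviation W where "W \<equiv> P - {p0}"

definition wts :: "real ^ 'k::{finite,wellorder} \<Rightarrow> nat \<Rightarrow> real" where "wts v i = v $ \<kappa> i"
definition pts :: "real ^ 'k::{finite,wellorder} \<Rightarrow> nat \<Rightarrow> real" where "pts v i = v $ \<xi> i"

abbreviation wt where "wt v i \<equiv> weight (wts v) i"
abbreviation nd where "nd v i \<equiv> node (pts v) i"

definition param :: "real ^ 'k::{finite,wellorder} \<Rightarrow> real ^ 'm::{finite,linorder}" where
  "param v = hull_point (wts v) (pts v)"

definition \<Omega> :: "(real ^ 'k::{finite,wellorder}) set" where "\<Omega> = {v. generic (wts v) (pts v)}"
definition C :: "(real ^ 'k::{finite,wellorder}) set" where "C = {v. admissible (wts v) (pts v)}"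

text \<open>
  For \<open>u = wt v\<close> and \<open>x = pts v\<close> this is the derivative of \<open>param\<close> at \<open>v \<in> \<Omega>\<close>. With \<open>u = 1\<close> its Gram matrix is that of the
  columns in \<open>mat_of x\<close>.
\<close>

definition tangent_map :: "(nat \<Rightarrow> real) \<Rightarrow> (nat \<Rightarrow> real) \<Rightarrow> real ^ 'k::{finite,wellorder} \<Rightarrow> real ^ 'm::{finite,linorder}" where
  "tangent_map u x h = (\<Sum>i\<in>W. h $ \<kappa> i *\<^sub>R (\<gamma> (node x i) - \<gamma> (node x p0))) + (\<Sum>i\<in>M. h $ \<xi> i *\<^sub>R u i *\<^sub>R \<gamma>' (x i))"

lemma card_k: "CARD('k) = card W + card M"
proof -
  have "CARD('k) = card (\<kappa> ` W) + card (\<xi> ` M)"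
    unfolding cover[symmetric] by (rule card_Un_disjoint) (use finW finM disj in auto)
  then show ?thesis by (simp add: card_image[OF inj\<kappa>] card_image[OF inj\<xi>])
qed

lemma card_W: "card P = Suc (card W)"
  by (rule card.remove[OF finite_P p0])

lemma wt_eq: "wt v i = (if i = p0 then 1 - (\<Sum>j\<in>W. v $ \<kappa> j) else v $ \<kappa> i)"
  by (simp add: weight_def wts_def)

lemma wt_cont: "continuous_on S (\<lambda>v. wt v i)"
  unfolding wt_eq by (cases "i = p0") (auto intro!: continuous_intros)

lemma pts_cont: "continuous_on S (\<lambda>v. pts v i)"
  unfolding pts_def by (intro continuous_intros)

lemma C_bounds:
  assumes "v \<in> C"
  shows "i \<in> P \<Longrightarrow> 0 \<le> wt v i" "i \<in> P \<Longrightarrow> wt v i \<le> 1" "i \<in> M \<Longrightarrow> pts v i \<in> {a..b}" "i \<in> P \<Longrightarrow> nd v i \<in> {a..b}"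
proof -
  show nn: "0 \<le> wt v i" if "i \<in> P" for i using assms that unfolding C_def admissible_def by blast
  show "wt v i \<le> 1" if "i \<in> P"
  proof -
    have "wt v i \<le> (\<Sum>j\<in>P. wt v j)"
      by (rule member_le_sum[OF that _ finite_P]) (use nn in blast)
    then show ?thesis by (simp only: sum_weight)
  qed
  show pt: "pts v i \<in> {a..b}" if "i \<in> M" for i
    using assms that unfolding C_def admissible_def ordered_points_def by simp
  show "nd v i \<in> {a..b}" if "i \<in> P"
    using pt[of i] e_ends[of i] that ab by (auto simp: node_def)
qed

lemma \<Omega>_sub_C: "\<Omega> \<subseteq> C"
  unfolding \<Omega>_def C_def generic_def admissible_def ordered_points_def
  by (auto intro: less_imp_le strict_mono_on_imp_mono_on)

lemma open_\<Omega>: "open \<Omega>"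
proof -
  have "\<Omega> = (\<Inter>i\<in>P. {v. 0 < wt v i}) \<inter> (\<Inter>i\<in>M. \<Inter>j\<in>{j\<in>M. i < j}. {v. pts v i < pts v j}) \<inter>
      (\<Inter>i\<in>M. {v. a < pts v i} \<inter> {v. pts v i < b})"
    unfolding \<Omega>_def generic_def strict_mono_on_def by auto
  moreover have "open \<dots>"
    using finite_P finite_M
    by (intro open_Int open_INT ballI open_Collect_less continuous_intros wt_cont pts_cont) auto
  ultimately show ?thesis by simp
qed

lemma closed_C: "closed C"
proof -
  have "C = (\<Inter>i\<in>P. {v. 0 \<le> wt v i}) \<inter> (\<Inter>i\<in>M. \<Inter>j\<in>{j\<in>M. i \<le> j}. {v. pts v i \<le> pts v j}) \<inter>
      (\<Inter>i\<in>M. {v. a \<le> pts v i} \<inter> {v. pts v i \<le> b})"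
    unfolding C_def admissible_def ordered_points_def monotone_on_def by auto
  moreover have "closed \<dots>"
    by (intro closed_Int closed_INT ballI closed_Collect_le continuous_intros wt_cont pts_cont)
  ultimately show ?thesis by simp
qed

lemma bounded_C: "bounded C"
proof -
  have "norm v \<le> real CARD('k) * (1 + \<bar>a\<bar> + \<bar>b\<bar>)" if v: "v \<in> C" for v
  proof -
    have "\<forall>k. \<bar>v $ k\<bar> \<le> 1 + \<bar>a\<bar> + \<bar>b\<bar>"
      unfolding all_coords
    proof (intro conjI ballI)
      fix i assume "i \<in> W"
      then show "\<bar>v $ \<kappa> i\<bar> \<le> 1 + \<bar>a\<bar> + \<bar>b\<bar>"
        using C_bounds(1,2)[OF v, of i] by (auto simp: wt_eq)
    next
      fix i assume "i \<in> M"
      then show "\<bar>v $ \<xi> i\<bar> \<le> 1 + \<bar>a\<bar> + \<bar>b\<bar>"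
        using C_bounds(3)[OF v, of i] by (auto simp: pts_def abs_le_iff)
    qed
    then have "(\<Sum>k\<in>UNIV. \<bar>v $ k\<bar>) \<le> (\<Sum>k\<in>(UNIV :: 'k set). 1 + \<bar>a\<bar> + \<bar>b\<bar>)" by (intro sum_mono) blast
    then show ?thesis using norm_le_l1_cart[of v] by simp
  qed
  then show ?thesis by (auto simp: bounded_iff)
qed

lemma param_deriv:
  assumes "v \<in> \<Omega>"
  shows "(param has_derivative tangent_map (wt v) (pts v)) (at v)"
proof -
  define dw :: "nat \<Rightarrow> real ^ 'k::{finite,wellorder} \<Rightarrow> real" where
    "dw = (\<lambda>i h. if i = p0 then - (\<Sum>j\<in>W. h $ \<kappa> j) else h $ \<kappa> i)"
  define dn :: "nat \<Rightarrow> real ^ 'k::{finite,wellorder} \<Rightarrow> real ^ 'm::{finite,linorder}" where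
    "dn = (\<lambda>i h. if i \<in> M then h $ \<xi> i *\<^sub>R \<gamma>' (pts v i) else 0)"
  have coord: "((\<lambda>v. v $ k) has_derivative (\<lambda>h. h $ k)) (at v)" for k
    by (rule bounded_linear_imp_has_derivative[OF bounded_linear_vec_nth])
  have dw: "((\<lambda>v. wt v i) has_derivative dw i) (at v)" for i
  proof (cases "i = p0")
    case True
    then show ?thesis unfolding wt_eq dw_def
      using has_derivative_diff[OF has_derivative_const has_derivative_sum[of W, OF coord]] by simp
  next
    case False
    then show ?thesis unfolding wt_eq dw_def using coord by simp
  qed
  have dn: "((\<lambda>v. \<gamma> (nd v i)) has_derivative dn i) (at v)" for i
  proof (cases "i \<in> M")
    case True
    then have "v $ \<xi> i \<in> {a<..<b}" using assms unfolding \<Omega>_def generic_def pts_def by simp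
    from \<gamma>_deriv_interior[OF this]
    have "(\<gamma> has_derivative (\<lambda>h. h *\<^sub>R \<gamma>' (v $ \<xi> i))) (at (v $ \<xi> i))" by (simp add: has_vector_derivative_def)
    from has_derivative_compose[OF coord this] show ?thesis
      using True by (simp add: node_def pts_def dn_def)
  next
    case False
    then show ?thesis by (simp add: node_def dn_def)
  qed
  have "((\<lambda>v. \<Sum>i\<in>P. wt v i *\<^sub>R \<gamma> (nd v i)) has_derivative (\<lambda>h. \<Sum>i\<in>P. wt v i *\<^sub>R dn i h + dw i h *\<^sub>R \<gamma> (nd v i))) (at v)"
    by (intro has_derivative_sum has_derivative_scaleR dw dn)
  moreover have "(\<Sum>i\<in>P. wt v i *\<^sub>R dn i h + dw i h *\<^sub>R \<gamma> (nd v i)) = tangent_map (wt v) (pts v) h" for h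
  proof -
    have "(\<Sum>i\<in>P. wt v i *\<^sub>R dn i h) = (\<Sum>i\<in>M. wt v i *\<^sub>R dn i h)"
      using finite_P M_sub by (intro sum.mono_neutral_right) (auto simp: dn_def)
    also have "\<dots> = (\<Sum>i\<in>M. h $ \<xi> i *\<^sub>R wt v i *\<^sub>R \<gamma>' (pts v i))"
      by (rule sum.cong) (auto simp: dn_def)
    finally have 1: "(\<Sum>i\<in>P. wt v i *\<^sub>R dn i h) = (\<Sum>i\<in>M. h $ \<xi> i *\<^sub>R wt v i *\<^sub>R \<gamma>' (pts v i))" .
    have "(\<Sum>i\<in>P. dw i h *\<^sub>R \<gamma> (nd v i)) = dw p0 h *\<^sub>R \<gamma> (nd v p0) + (\<Sum>i\<in>W. dw i h *\<^sub>R \<gamma> (nd v i))"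
      by (rule sum.remove[OF finite_P p0])
    also have "(\<Sum>i\<in>W. dw i h *\<^sub>R \<gamma> (nd v i)) = (\<Sum>i\<in>W. h $ \<kappa> i *\<^sub>R \<gamma> (nd v i))"
      by (rule sum.cong) (auto simp: dw_def)
    also have "dw p0 h *\<^sub>R \<gamma> (nd v p0) + (\<Sum>i\<in>W. h $ \<kappa> i *\<^sub>R \<gamma> (nd v i)) =
        (\<Sum>i\<in>W. h $ \<kappa> i *\<^sub>R (\<gamma> (nd v i) - \<gamma> (nd v p0)))"
      by (simp add: dw_def scaleR_diff_right sum_subtractf scaleR_sum_left)
    finally show ?thesis unfolding sum.distrib 1 tangent_map_def by simp
  qed
  ultimately show ?thesis unfolding param_def[abs_def] hull_point_def by simp
qed

lemma tangent_map_cont: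
  assumes "\<And>i. continuous_on C (\<lambda>v. u v i)"
  shows "continuous_on C (\<lambda>v. tangent_map (u v) (pts v) h)"
proof -
  have 1: "continuous_on C (\<lambda>v. \<gamma> (nd v i))" if "i \<in> P" for i
  proof (cases "i \<in> M")
    case True
    then show ?thesis
      unfolding node_def using C_bounds(3) by (auto intro!: continuous_on_compose2[OF \<gamma>_cont pts_cont])
  qed (simp add: node_def)
  have 2: "continuous_on C (\<lambda>v. \<gamma>' (pts v i))" if "i \<in> M" for i
    using C_bounds(3)[OF _ that] by (auto intro!: continuous_on_compose2[OF \<gamma>'_cont pts_cont])
  show ?thesis unfolding tangent_map_def
    by (intro continuous_intros 1 2 assms p0) auto
qed

lemma tangent_map_inj:
  assumes "v \<in> \<Omega>"
  shows "inj (tangent_map (wt v) (pts v))"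
proof -
  have lin: "linear (tangent_map (wt v) (pts v))"
    using param_deriv[OF assms] has_derivative_linear by blast
  have "h = 0" if h: "tangent_map (wt v) (pts v) h = 0" for h
  proof -
    have "(\<forall>i\<in>W. h $ \<kappa> i = 0) \<and> (\<forall>i\<in>M. h $ \<xi> i = 0)"
      by (rule tangent_independent[of "wts v" "pts v"])
         (use assms h in \<open>auto simp: \<Omega>_def tangent_map_def\<close>)
    then have "\<forall>k. h $ k = 0" unfolding all_coords .
    then show ?thesis by (simp add: Finite_Cartesian_Product.vec_eq_iff)
  qed
  then show ?thesis using linear_injective_0[OF lin] by blast
qed

lemma param_inj: "inj_on param \<Omega>"
proof (rule inj_onI)
  fix v v' assume v: "v \<in> \<Omega>" "v' \<in> \<Omega>" "param v = param v'"
  have "(\<forall>i\<in>W. wts v i = wts v' i) \<and> (\<forall>i\<in>M. pts v i = pts v' i)"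
    by (rule generic_inj) (use v in \<open>auto simp: \<Omega>_def param_def\<close>)
  then have "\<forall>k. v $ k = v' $ k" unfolding all_coords wts_def pts_def .
  then show "v = v'" by (simp add: Finite_Cartesian_Product.vec_eq_iff)
qed

lemma param_lipschitz:
  obtains L where "L > 0" "\<And>v v'. \<lbrakk>v \<in> C; v' \<in> C\<rbrakk> \<Longrightarrow> norm (param v - param v') \<le> L * norm (v - v')"
proof -
  obtain B where B: "B > 0" "\<And>t. t \<in> {a..b} \<Longrightarrow> norm (\<gamma> t) \<le> B"
    "\<And>s t. \<lbrakk>s \<in> {a..b}; t \<in> {a..b}\<rbrakk> \<Longrightarrow> norm (\<gamma> s - \<gamma> t) \<le> B * \<bar>s - t\<bar>" by (rule ex_curve_bounds) blast
  define q where "q = real (card P) * B + B"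
  have q: "q > 0" unfolding q_def using B(1) by (intro add_nonneg_pos) auto
  have coord: "\<bar>v $ k - v' $ k\<bar> \<le> norm (v - v')" for v v' :: "real ^ 'k::{finite,wellorder}" and k
    using component_le_norm_cart[of "v - v'" k] by simp
  have wtl: "\<bar>wt v i - wt v' i\<bar> \<le> real (card P) * norm (v - v')" if "i \<in> P" for v v' i
  proof (cases "i = p0")
    case True
    have "\<bar>wt v i - wt v' i\<bar> = \<bar>\<Sum>j\<in>W. v' $ \<kappa> j - v $ \<kappa> j\<bar>" using True by (simp add: wt_eq sum_subtractf)
    also have "\<dots> \<le> (\<Sum>j\<in>W. norm (v - v'))"
      using coord[of v' _ v] by (intro order_trans[OF sum_abs] sum_mono) (simp add: norm_minus_commute)
    also have "\<dots> \<le> real (card P) * norm (v - v')" using card_W by (simp add: mult_right_mono)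
    finally show ?thesis .
  next
    case False
    have "1 * norm (v - v') \<le> real (card P) * norm (v - v')" using card_W by (intro mult_right_mono) auto
    then show ?thesis using False coord[of v "\<kappa> i" v'] by (simp add: wt_eq)
  qed
  have ndl: "\<bar>nd v i - nd v' i\<bar> \<le> norm (v - v')" for v v' i
    using coord[of v "\<xi> i" v'] by (simp add: node_def pts_def)
  show ?thesis
  proof (rule that[of "real (card P) * q"])
    show "0 < real (card P) * q" using q card_W by simp
    fix v v' assume v: "v \<in> C" "v' \<in> C"
    have "norm (wt v i *\<^sub>R \<gamma> (nd v i) - wt v' i *\<^sub>R \<gamma> (nd v' i)) \<le> q * norm (v - v')" if i: "i \<in> P" for i
    proof -
      have "wt v i *\<^sub>R \<gamma> (nd v i) - wt v' i *\<^sub>R \<gamma> (nd v' i) =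
          (wt v i - wt v' i) *\<^sub>R \<gamma> (nd v i) + wt v' i *\<^sub>R (\<gamma> (nd v i) - \<gamma> (nd v' i))"
        by (simp add: algebra_simps)
      then have "norm (wt v i *\<^sub>R \<gamma> (nd v i) - wt v' i *\<^sub>R \<gamma> (nd v' i)) \<le>
          \<bar>wt v i - wt v' i\<bar> * norm (\<gamma> (nd v i)) + \<bar>wt v' i\<bar> * norm (\<gamma> (nd v i) - \<gamma> (nd v' i))"
        by (metis norm_scaleR norm_triangle_ineq)
      also have "\<dots> \<le> (real (card P) * norm (v - v')) * B + 1 * (B * norm (v - v'))"
      proof (intro add_mono mult_mono)
        show "norm (\<gamma> (nd v i) - \<gamma> (nd v' i)) \<le> B * norm (v - v')"
        proof (rule order_trans[OF B(3)[OF C_bounds(4)[OF v(1) i] C_bounds(4)[OF v(2) i]]])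
          show "B * \<bar>nd v i - nd v' i\<bar> \<le> B * norm (v - v')"
            by (rule mult_left_mono[OF ndl]) (use B(1) in simp)
        qed
      qed (use wtl[OF i] B C_bounds[OF v(1)] C_bounds[OF v(2)] i in auto)
      finally show ?thesis by (simp add: q_def algebra_simps)
    qed
    then have "(\<Sum>i\<in>P. norm (wt v i *\<^sub>R \<gamma> (nd v i) - wt v' i *\<^sub>R \<gamma> (nd v' i))) \<le> (\<Sum>i\<in>P. q * norm (v - v'))"
      by (rule sum_mono)
    moreover have "norm (param v - param v') \<le> (\<Sum>i\<in>P. norm (wt v i *\<^sub>R \<gamma> (nd v i) - wt v' i *\<^sub>R \<gamma> (nd v' i)))"
      unfolding param_def hull_point_def sum_subtractf[symmetric] by (rule norm_sum)
    ultimately show "norm (param v - param v') \<le> real (card P) * q * norm (v - v')" by simp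
  qed
qed

text \<open>
  A degenerate parameter has a vanishing weight, two equal moving vertices, or a moving vertex at an end;
  each of these is a hyperplane.
\<close>

lemma negligible_degenerate: "negligible (C - \<Omega>)"
proof -
  have hyp: "negligible {v :: real ^ 'k::{finite,wellorder}. v $ k = d}" for k d
    using negligible_hyperplane[of "axis k 1 :: real ^ 'k::{finite,wellorder}" d] by (simp add: inner_axis' axis_eq_0_iff)
  have wt0: "negligible {v. wt v i = 0}" for i
  proof (cases "i = p0")
    case True
    have "negligible {v :: real ^ 'k::{finite,wellorder}. (\<Sum>j\<in>W. axis (\<kappa> j) 1) \<bullet> v = 1}"
      by (rule negligible_hyperplane) simp
    moreover have "{v. wt v i = 0} = {v. (\<Sum>j\<in>W. axis (\<kappa> j) 1) \<bullet> v = 1}"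
      using True by (auto simp: wt_eq inner_sum_left inner_axis')
    ultimately show ?thesis by simp
  next
    case False
    then show ?thesis using hyp[of "\<kappa> i" 0] by (simp add: wt_eq)
  qed
  have eq: "negligible {v. pts v i = pts v j}" if "i \<in> M" "j \<in> M" "i < j" for i j
  proof -
    have ne: "\<xi> i \<noteq> \<xi> j" using inj\<xi> that by (metis inj_on_eq_iff less_irrefl)
    then have "(axis (\<xi> i) 1 - axis (\<xi> j) 1 :: real ^ 'k::{finite,wellorder}) \<noteq> 0" by (simp add: axis_eq_axis)
    then have "negligible {v :: real ^ 'k::{finite,wellorder}. (axis (\<xi> i) 1 - axis (\<xi> j) 1) \<bullet> v = 0}"
      by (intro negligible_hyperplane) simp
    then show ?thesis by (simp add: pts_def inner_diff_left inner_axis')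
  qed
  have "C - \<Omega> \<subseteq> (\<Union>i\<in>P. {v. wt v i = 0}) \<union> (\<Union>i\<in>M. \<Union>j\<in>{j\<in>M. i < j}. {v. pts v i = pts v j}) \<union>
      (\<Union>i\<in>M. {v. pts v i = a} \<union> {v. pts v i = b})" (is "_ \<subseteq> ?N")
  proof (rule subsetI, rule ccontr)
    fix v assume v: "v \<in> C - \<Omega>" "v \<notin> ?N"
    have adm: "admissible (wts v) (pts v)" using v(1) by (simp add: C_def)
    have 1: "0 < wt v i" if "i \<in> P" for i
    proof -
      have "wt v i \<noteq> 0" using v(2) that by blast
      then show ?thesis using adm that unfolding admissible_def by (simp add: order_less_le)
    qed
    have 2: "pts v i < pts v j" if "i \<in> M" "j \<in> M" "i < j" for i j
    proof -
      have "pts v i \<noteq> pts v j" using v(2) that by blast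
      moreover have "pts v i \<le> pts v j" using adm that unfolding admissible_def ordered_points_def monotone_on_def by simp
      ultimately show ?thesis by simp
    qed
    have 3: "a < pts v i \<and> pts v i < b" if "i \<in> M" for i
    proof -
      have "pts v i \<noteq> a" "pts v i \<noteq> b" using v(2) that by blast+
      moreover have "a \<le> pts v i \<and> pts v i \<le> b" using adm that unfolding admissible_def ordered_points_def by simp
      ultimately show ?thesis by simp
    qed
    have "v \<in> \<Omega>" unfolding \<Omega>_def generic_def strict_mono_on_def using 1 2 3 by blast
    then show False using v(1) by blast
  qed
  moreover have "negligible ?N"
    using finite_P finite_M wt0 eq hyp
    by (intro negligible_Un negligible_finite_UN) (auto simp: pts_def)
  ultimately show ?thesis using negligible_subset by blast
qed

text \<open>
  The matrix of \<open>tangent_map u x\<close> is \<open>mat_of x\<close> with the tangent columns scaled by \<open>u\<close>.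
\<close>

lemma tangent_map_jacobian:
  assumes "\<And>i. i \<in> M \<Longrightarrow> u i \<ge> 0"
  shows "gram_jacobian (tangent_map u x) = (\<Prod>i\<in>M. u i) * gram_sqrt (mat_of x)"
proof -
  define ws where "ws = sorted_list_of_set W"
  define ms where "ms = sorted_list_of_set M"
  define cs where "cs = map (\<lambda>i. \<gamma> (node x i) - \<gamma> (node x p0)) ws @ map (\<lambda>i. \<gamma>' (x i)) ms"
  let ?n = "CARD('k)"
  have ws: "set ws = W" "distinct ws" "length ws = card W"
    and ms: "set ms = M" "distinct ms" "length ms = card M"
    using finW finM by (auto simp: ws_def ms_def)
  have n: "length ws + length ms = ?n" using ws ms card_k by simp
  define \<sigma> where "\<sigma> = (\<lambda>p. (map \<kappa> ws @ map \<xi> ms) ! p)"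
  have "bij_betw ((!) (map \<kappa> ws @ map \<xi> ms)) {..<length (map \<kappa> ws @ map \<xi> ms)} (set (map \<kappa> ws @ map \<xi> ms))"
  proof (rule bij_betw_nth)
    show "distinct (map \<kappa> ws @ map \<xi> ms)"
      using ws ms inj\<kappa> inj\<xi> disj by (auto simp: distinct_map)
  qed auto
  then have \<sigma>: "bij_betw \<sigma> {0..<?n} UNIV"
    using ws(1) ms(1) n cover by (simp add: \<sigma>_def[abs_def] lessThan_atLeast0)
  \<comment> \<open>the scaling factors of the columns\<close>
  define s where "s = (\<lambda>p. if p < length ws then 1 else u (ms ! (p - length ws)))"
  have img: "tangent_map u x (axis (\<sigma> p) 1) = s p *\<^sub>R (cs ! p)" if "p < ?n" for p
  proof (cases "p < length ws")
    case True
    define i where "i = ws ! p"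
    have i: "i \<in> W" using True ws(1) nth_mem unfolding i_def by blast
    have \<sigma>p: "\<sigma> p = \<kappa> i" using True by (simp add: \<sigma>_def i_def nth_append)
    have a1: "axis (\<kappa> i) (1::real) $ \<kappa> j = (if j = i then 1 else 0)" if "j \<in> W" for j
      using inj\<kappa> i that by (auto simp: axis_def inj_on_eq_iff)
    have a2: "axis (\<kappa> i) (1::real) $ \<xi> j = 0" if "j \<in> M" for j
      using disj i that by (auto simp: axis_def)
    have "tangent_map u x (axis (\<sigma> p) 1) = (\<Sum>j\<in>W. (if j = i then 1 else 0) *\<^sub>R (\<gamma> (node x j) - \<gamma> (node x p0))) + (\<Sum>j\<in>M. 0)"
      unfolding tangent_map_def \<sigma>p by (intro arg_cong2[where f = "(+)"] sum.cong) (auto simp: a1 a2)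
    also have "\<dots> = (\<Sum>j\<in>W. if j = i then \<gamma> (node x j) - \<gamma> (node x p0) else 0)"
      by (simp, intro sum.cong) auto
    also have "\<dots> = \<gamma> (node x i) - \<gamma> (node x p0)" using i finW by simp
    finally show ?thesis using True by (simp add: s_def cs_def nth_append i_def)
  next
    case False
    define q where "q = p - length ws"
    have q: "q < length ms" "p = length ws + q" using False that n by (auto simp: q_def)
    define i where "i = ms ! q"
    have i: "i \<in> M" using q ms(1) nth_mem unfolding i_def by blast
    have \<sigma>p: "\<sigma> p = \<xi> i" using q by (simp add: \<sigma>_def i_def nth_append)
    have a1: "axis (\<xi> i) (1::real) $ \<kappa> j = 0" if "j \<in> W" for j
      using disj i that by (auto simp: axis_def)
    have a2: "axis (\<xi> i) (1::real) $ \<xi> j = (if j = i then 1 else 0)" if "j \<in> M" for j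
      using inj\<xi> i that by (auto simp: axis_def inj_on_eq_iff)
    have "tangent_map u x (axis (\<sigma> p) 1) = (\<Sum>j\<in>W. 0) + (\<Sum>j\<in>M. (if j = i then 1 else 0) *\<^sub>R u j *\<^sub>R \<gamma>' (x j))"
      unfolding tangent_map_def \<sigma>p by (intro arg_cong2[where f = "(+)"] sum.cong) (auto simp: a1 a2)
    also have "\<dots> = (\<Sum>j\<in>M. if j = i then u j *\<^sub>R \<gamma>' (x j) else 0)"
      by (simp, intro sum.cong) auto
    also have "\<dots> = u i *\<^sub>R \<gamma>' (x i)" using i finM by simp
    finally show ?thesis using False q by (simp add: s_def cs_def nth_append i_def)
  qed
  have lcs: "length cs = ?n" using n by (simp add: cs_def)
  have mat: "mat_of x = columns cs" by (simp add: mat_of_def cs_def ws_def ms_def)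
  let ?Q = "transpose_mat (columns cs) * columns cs"
  have Q: "?Q \<in> carrier_mat ?n ?n" using lcs by (intro carrier_matI) auto
  have Q_ix: "?Q $$ (p, q) = cs ! p \<bullet> cs ! q" if "p < ?n" "q < ?n" for p q
    using that lcs by (simp add: scalar_prod_def columns_index inner_eq_sum_nth_index lessThan_atLeast0)
  have "Determinants.det (gram (tangent_map u x)) = (\<Prod>p=0..<?n. s p)\<^sup>2 * Determinant.det ?Q"
    by (rule det_reindex[OF \<sigma> Q]) (simp add: gram_def img Q_ix)
  also have "(\<Prod>p=0..<?n. s p) = (\<Prod>i\<in>M. u i)"
  proof -
    have "(\<Prod>p=0..<?n. s p) = prod_list (map s [0..<?n])" using prod.distinct_set_conv_list[of "[0..<?n]" s] by (simp only: set_upt distinct_upt)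
    also have "map s [0..<?n] = replicate (length ws) 1 @ map u ms"
      by (rule nth_equalityI) (use n in \<open>auto simp: s_def nth_append\<close>)
    also have "prod_list \<dots> = (\<Prod>i\<in>M. u i)"
      using prod.distinct_set_conv_list[OF ms(2), of u] by (simp add: ms(1))
    finally show ?thesis .
  qed
  finally show ?thesis
    using assms by (simp add: gram_jacobian_def gram_sqrt_def mat real_sqrt_mult prod_nonneg)
qed

definition area_density :: "real ^ 'k::{finite,wellorder} \<Rightarrow> ennreal" where
  "area_density v = ennreal (indicat_real C v *\<^sub>R gram_jacobian (tangent_map (wt v) (pts v)))"

lemma area_density_measurable: "area_density \<in> borel_measurable borel"
proof -
  have "continuous_on C (\<lambda>v. gram_jacobian (tangent_map (wt v) (pts v)))"
    by (intro continuous_on_gram_jacobian tangent_map_cont wt_cont)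
  then show ?thesis unfolding area_density_def[abs_def]
    using borel_measurable_continuous_on_indicator[of C "\<lambda>v. gram_jacobian (tangent_map (wt v) (pts v))"] closed_C
    by simp
qed

lemma area_density_join:
  "area_density (join_coords W M \<kappa> \<xi> (w, x)) =
    (if \<forall>i\<in>P. 0 \<le> weight w i then ennreal (\<Prod>i\<in>M. weight w i) else 0) *
      (ennreal (gram_sqrt (mat_of x)) * indicator (ordered_points M a b) x)"
proof -
  let ?T = "join_coords W M \<kappa> \<xi>" and ?J = "\<lambda>v. gram_jacobian (tangent_map (wt v) (pts v))"
  have wts_T: "weight (wts (?T (w, x))) i = weight w i" if "i \<in> P" for i
    unfolding weight_def wts_def using that by simp
  have pts_T: "pts (?T (w, x)) i = x i" if "i \<in> M" for i
    unfolding pts_def using that by simp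
    have C_iff: "?T (w, x) \<in> C \<longleftrightarrow> (\<forall>i\<in>P. 0 \<le> weight w i) \<and> x \<in> ordered_points M a b"
      unfolding C_def admissible_def ordered_points_def monotone_on_def
      using wts_T pts_T by auto
    have node_T: "node (pts (?T (w, x))) i = node x i" for i
      unfolding node_def using pts_T by simp
    have mat_T: "mat_of (pts (?T (w, x))) = mat_of x"
    proof -
      have "map (\<lambda>i. \<gamma>' (pts (?T (w, x)) i)) (sorted_list_of_set M) = map (\<lambda>i. \<gamma>' (x i)) (sorted_list_of_set M)"
        using pts_T finM by simp
      then show ?thesis unfolding mat_of_def node_T by (simp only:)
    qed
    show ?thesis
    proof (cases "?T (w, x) \<in> C")
      case True
      then have *: "\<forall>i\<in>P. 0 \<le> weight w i" "x \<in> ordered_points M a b" using C_iff by auto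
      have wM: "weight (wts (?T (w, x))) i = weight w i" if "i \<in> M" for i using wts_T that M_sub by blast
      have "?J (?T (w, x)) = (\<Prod>i\<in>M. weight (wts (?T (w, x))) i) * gram_sqrt (mat_of (pts (?T (w, x))))"
        by (rule tangent_map_jacobian) (use C_bounds(1)[OF True] M_sub in blast)
      also have "\<dots> = (\<Prod>i\<in>M. weight w i) * gram_sqrt (mat_of x)" unfolding mat_T using wM by simp
      finally have J: "?J (?T (w, x)) = (\<Prod>i\<in>M. weight w i) * gram_sqrt (mat_of x)" .
      have "0 \<le> (\<Prod>i\<in>M. weight w i)" using *(1) M_sub by (intro prod_nonneg) blast
      then show ?thesis using True * J by (simp add: area_density_def ennreal_mult')
    next
      case False
      then show ?thesis using C_iff by (auto simp: area_density_def indicator_def)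
    qed
qed

text \<open>
  The integrand is, up to a positive factor, the section of the Borel function \<open>area_density\<close> at a fixed
  vector \<open>w0\<close> of positive weights; the equal weights \<open>1 / card P\<close> are convenient.
\<close>

lemma integrand_measurable:
  "(\<lambda>x. ennreal (gram_sqrt (mat_of x)) * indicator (ordered_points M a b) x) \<in> borel_measurable (PiM M (\<lambda>_. lborel :: real measure))"
proof -
  define r where "r = 1 / real (card P)"
  have r: "r > 0" using card_W by (simp add: r_def)
  define w0 where "w0 = (\<lambda>i\<in>W. r)"
  have weight_w0: "weight w0 i = r" if "i \<in> P" for i
  proof -
    have "sum w0 W = real (card W) * r" by (simp add: w0_def)
    moreover have "1 - real (card W) * r = r" using card_W by (simp add: r_def field_simps)
    ultimately show ?thesis using that by (simp add: weight_def w0_def)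
  qed
    have "(\<lambda>x. (w0, x)) \<in> measurable (PiM M (\<lambda>_. lborel :: real measure)) (PiM W (\<lambda>_. lborel) \<Otimes>\<^sub>M PiM M (\<lambda>_. lborel))"
      by (rule measurable_Pair1') (simp add: space_PiM w0_def)
    from measurable_compose[OF this measurable_compose[OF join_measurable area_density_measurable]]
    have "(\<lambda>x. area_density (join_coords W M \<kappa> \<xi> (w0, x))) \<in> borel_measurable (PiM M (\<lambda>_. lborel :: real measure))" .
    then have m: "(\<lambda>x. ennreal (1 / r ^ card M) * area_density (join_coords W M \<kappa> \<xi> (w0, x))) \<in> borel_measurable (PiM M (\<lambda>_. lborel :: real measure))"
      by measurable
    have pr: "(\<Prod>i\<in>M. weight w0 i) = r ^ card M"
      using weight_w0 M_sub by (simp add: subset_eq)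
    have "ennreal (1 / r ^ card M) * area_density (join_coords W M \<kappa> \<xi> (w0, x)) = ennreal (gram_sqrt (mat_of x)) * indicator (ordered_points M a b) x" for x
    proof -
      have "area_density (join_coords W M \<kappa> \<xi> (w0, x)) = ennreal (r ^ card M) * (ennreal (gram_sqrt (mat_of x)) * indicator (ordered_points M a b) x)"
        unfolding area_density_join pr using weight_w0 r by simp
      moreover have "ennreal (1 / r ^ card M) * ennreal (r ^ card M) = 1"
        using r by (simp add: ennreal_mult'[symmetric])
      ultimately show ?thesis by (simp add: mult.assoc[symmetric])
    qed
    with m show ?thesis by simp
qed

text \<open>
  By the area formula and Fubini's theorem: the integrand factors into a function of the weights,
  with the Dirichlet integral \<open>1 / n!\<close>, and a function of the moving vertices.
\<close>

lemma hausdorff_param_\<Omega>: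
  "hausdorff_measure CARD('k) (param ` \<Omega>) = ennreal (cube_const TYPE(real ^ 'k::{finite,wellorder})) *
     (ennreal (1 / fact CARD('k)) * (\<integral>\<^sup>+x\<in>ordered_points M a b. ennreal (gram_sqrt (mat_of x)) \<partial>lebesgue_on_vars M))"
proof -
  obtain L where L: "L > 0" "\<And>v v'. \<lbrakk>v \<in> C; v' \<in> C\<rbrakk> \<Longrightarrow> norm (param v - param v') \<le> L * norm (v - v')"
    by (rule param_lipschitz) blast
  let ?J = "\<lambda>v. gram_jacobian (tangent_map (wt v) (pts v))"
  have bnd: "bounded \<Omega>" using bounded_subset[OF bounded_C \<Omega>_sub_C] .
  have 1: "hausdorff_measure CARD('k) (param ` \<Omega>) =
      ennreal (cube_const TYPE(real ^ 'k::{finite,wellorder})) * (\<integral>\<^sup>+v\<in>\<Omega>. ennreal (?J v) \<partial>lborel)"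
  proof (rule area_formula[OF open_\<Omega> bnd param_deriv _ tangent_map_inj param_inj L(1)])
    show "continuous_on \<Omega> (\<lambda>v. tangent_map (wt v) (pts v) h)" for h
      by (rule continuous_on_subset[OF tangent_map_cont \<Omega>_sub_C]) (rule wt_cont)
    show "norm (param v - param v') \<le> L * norm (v - v')" if "v \<in> \<Omega>" "v' \<in> \<Omega>" for v v'
      using L(2) that \<Omega>_sub_C by blast
  qed
  have "C - \<Omega> \<in> null_sets lborel"
  proof -
    have "C - \<Omega> \<in> sets lborel" using closed_C open_\<Omega> by simp
    moreover have "C - \<Omega> \<in> null_sets lebesgue" using negligible_degenerate negligible_iff_null_sets by blast
    ultimately show ?thesis using null_sets_completion_iff by blast
  qed
  then have "AE v in lborel. v \<notin> C - \<Omega>" by (rule AE_not_in)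
  then have 2: "(\<integral>\<^sup>+v\<in>\<Omega>. ennreal (?J v) \<partial>lborel) = (\<integral>\<^sup>+v. area_density v \<partial>lborel)"
    by (intro nn_integral_cong_AE) (use \<Omega>_sub_C in \<open>auto simp: area_density_def indicator_def elim!: eventually_mono\<close>)
  let ?T = "join_coords W M \<kappa> \<xi>"
  have 3: "(\<integral>\<^sup>+v. area_density v \<partial>lborel) = (\<integral>\<^sup>+x. (\<integral>\<^sup>+w. (if \<forall>i\<in>P. 0 \<le> weight w i then ennreal (\<Prod>i\<in>M. weight w i) else 0) *
      (ennreal (gram_sqrt (mat_of x)) * indicator (ordered_points M a b) x) \<partial>PiM W (\<lambda>_. lborel)) \<partial>PiM M (\<lambda>_. lborel))"
    unfolding nn_integral_split[OF area_density_measurable] area_density_join ..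
  have wm: "(\<lambda>w. if \<forall>i\<in>P. 0 \<le> weight w i then ennreal (\<Prod>i\<in>M. weight w i) else 0) \<in> borel_measurable (PiM W (\<lambda>_. lborel))"
  proof -
    have c: "(\<lambda>w. w i) \<in> borel_measurable (PiM W (\<lambda>_. lborel :: real measure))" if "i \<in> W" for i
      using measurable_component_singleton[OF that, of "\<lambda>_. lborel"] by simp
    have wt_m: "(\<lambda>w. weight w i) \<in> borel_measurable (PiM W (\<lambda>_. lborel :: real measure))" if "i \<in> P" for i
      using that c by (cases "i = p0") (auto simp: weight_def intro!: borel_measurable_diff borel_measurable_sum)
    have p: "Measurable.pred (PiM W (\<lambda>_. lborel :: real measure)) (\<lambda>w. \<forall>i\<in>P. 0 \<le> weight w i)"
      using finite_P wt_m by (intro pred_intros_finite) (auto intro: borel_measurable_le)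
    have "(\<lambda>w. \<Prod>i\<in>M. weight w i) \<in> borel_measurable (PiM W (\<lambda>_. lborel :: real measure))"
      using wt_m M_sub by (intro borel_measurable_prod) blast
    with p show ?thesis by measurable
  qed
  have P: "insert p0 W = P" using p0 by blast
  have D: "(\<integral>\<^sup>+w. (if \<forall>i\<in>P. 0 \<le> weight w i then ennreal (\<Prod>i\<in>M. weight w i) else 0) \<partial>PiM W (\<lambda>_. lborel)) = ennreal (1 / fact CARD('k))"
  proof -
    have "p0 \<notin> W" "M \<subseteq> insert p0 W" using M_sub P by auto
    from dirichlet_integral_barycentric[OF finW this] show ?thesis unfolding P card_k weight_def .
  qed
  have "(\<integral>\<^sup>+v. area_density v \<partial>lborel) = (\<integral>\<^sup>+x. ennreal (1 / fact CARD('k)) * (ennreal (gram_sqrt (mat_of x)) * indicator (ordered_points M a b) x) \<partial>PiM M (\<lambda>_. lborel))"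
    unfolding 3 by (intro nn_integral_cong) (simp only: nn_integral_multc[OF wm] D)
  also have "\<dots> = ennreal (1 / fact CARD('k)) * (\<integral>\<^sup>+x\<in>ordered_points M a b. ennreal (gram_sqrt (mat_of x)) \<partial>lebesgue_on_vars M)"
    unfolding lebesgue_on_vars_def by (rule nn_integral_cmult[OF integrand_measurable])
  finally show ?thesis unfolding 1 2 by simp
qed

text \<open>
  Degenerate parameters form a null set, and \<open>param\<close> is Lipschitz up to the boundary.
\<close>

lemma hausdorff_param_C: "hausdorff_measure CARD('k) (param ` C) \<le> hausdorff_measure CARD('k) (param ` \<Omega>)"
proof -
  have n: "1 \<le> CARD('k)" by (simp add: Suc_leI)
  obtain L where L: "L > 0" "\<And>v v'. \<lbrakk>v \<in> C; v' \<in> C\<rbrakk> \<Longrightarrow> norm (param v - param v') \<le> L * norm (v - v')"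
    by (rule param_lipschitz) blast
  have N: "C - \<Omega> \<in> lmeasurable" "measure lebesgue (C - \<Omega>) = 0"
    using negligible_degenerate by (simp_all add: negligible_iff_measure)
  have "hausdorff_measure DIM(real ^ 'k::{finite,wellorder}) (param ` (C - \<Omega>)) \<le>
      ennreal (L ^ DIM(real ^ 'k::{finite,wellorder}) * cube_const TYPE(real ^ 'k::{finite,wellorder}) * measure lebesgue (C - \<Omega>))"
    by (rule hausdorff_lipschitz_image_le[OF N(1) bounded_diff[OF bounded_C] L(1)]) (use L(2) in blast)
  then have 0: "hausdorff_measure CARD('k) (param ` (C - \<Omega>)) = 0" using N(2) by simp
  have "hausdorff_measure CARD('k) (param ` C) \<le> hausdorff_measure CARD('k) (param ` \<Omega> \<union> param ` (C - \<Omega>))"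
    by (intro hausdorff_mono) blast
  also have "\<dots> \<le> hausdorff_measure CARD('k) (param ` \<Omega>) + hausdorff_measure CARD('k) (param ` (C - \<Omega>))"
    by (rule hausdorff_subadditive[OF n])
  finally show ?thesis using 0 by simp
qed

lemma param_surj:
  assumes "admissible w x"
  shows "hull_point w x \<in> param ` C"
proof -
  let ?v = "join_coords W M \<kappa> \<xi> (w, x)"
  have wts_T: "weight (wts ?v) i = weight w i" if "i \<in> P" for i
    unfolding weight_def wts_def using that by simp
  have pts_T: "pts ?v i = x i" if "i \<in> M" for i
    unfolding pts_def using that by simp
  have node_T: "node (pts ?v) i = node x i" for i
    unfolding node_def using pts_T by simp
  have "admissible (wts ?v) (pts ?v)"
    using assms wts_T pts_T unfolding admissible_def ordered_points_def monotone_on_def by simp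
  then have "?v \<in> C" by (simp add: C_def)
  moreover have "param ?v = hull_point w x"
    unfolding param_def hull_point_def node_T using wts_T by (intro sum.cong) auto
  ultimately show ?thesis by (metis image_eqI)
qed

end

section \<open>The area of the frontier\<close>

text \<open>
  An index type with \<open>n\<close> elements for the domain of the parametrizations, when \<open>'m\<close> has \<open>n + 1\<close>. The
  maximum keeps the type nonempty; a set of natural numbers brings along its well-order, which
  the change of variables formula for linear maps asks for.
\<close>

typedef 'm pred_index = "{..<max 1 (CARD('m) - 1)}"
  by (auto intro: exI[of _ 0])

instantiation pred_index :: (type) wellorder
begin

definition less_eq_pred_index :: "'a pred_index \<Rightarrow> 'a pred_index \<Rightarrow> bool" where
  "x \<le> y \<longleftrightarrow> Rep_pred_index x \<le> Rep_pred_index y"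

definition less_pred_index :: "'a pred_index \<Rightarrow> 'a pred_index \<Rightarrow> bool" where
  "x < y \<longleftrightarrow> Rep_pred_index x < Rep_pred_index y"

instance
proof
  fix P :: "'a pred_index \<Rightarrow> bool" and x
  assume step: "\<And>x. (\<And>y. y < x \<Longrightarrow> P y) \<Longrightarrow> P x"
  show "P x"
    by (induction "Rep_pred_index x" arbitrary: x rule: less_induct)
       (rule step, simp add: less_pred_index_def)
qed (auto simp: less_eq_pred_index_def less_pred_index_def Rep_pred_index_inject)

end

instance pred_index :: (type) finite
proof
  have "UNIV = (Abs_pred_index :: nat \<Rightarrow> 'a pred_index) ` {..<max 1 (CARD('a) - 1)}"
    by (rule type_definition.Abs_image[OF type_definition_pred_index, symmetric])
  then show "finite (UNIV :: 'a pred_index set)" by (metis finite_imageI finite_lessThan)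
qed

lemma card_pred_index: "CARD('m pred_index) = max 1 (CARD('m) - 1)"
  by (simp add: type_definition.card[OF type_definition_pred_index])

lemma ex_coordinate_split:
  assumes "finite W" "finite M" "card W + card M = CARD('k)"
  obtains \<kappa> \<xi> :: "nat \<Rightarrow> 'k::finite" where "coordinate_split W M \<kappa> \<xi>"
proof -
  define g where "g = (\<lambda>i::nat. if i \<in> W then Inl i else Inr i :: nat + nat)"
  have "card (W <+> M) = CARD('k)" using assms by (simp add: card_Plus)
  then obtain f :: "nat + nat \<Rightarrow> 'k" where f: "bij_betw f (W <+> M) UNIV"
    using assms(1,2) by (metis finite_Plus finite_class.finite_UNIV finite_same_card_bij)
  have "coordinate_split W M (f \<circ> Inl) (f \<circ> Inr)"
  proof
    show "inj_on (f \<circ> Inl) W" "inj_on (f \<circ> Inr) M"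
      using bij_betw_imp_inj_on[OF f] by (auto simp: inj_on_def)
    show "(f \<circ> Inl) ` W \<inter> (f \<circ> Inr) ` M = {}"
      using bij_betw_imp_inj_on[OF f] by (auto simp: inj_on_def)
    show "(f \<circ> Inl) ` W \<union> (f \<circ> Inr) ` M = UNIV"
      using bij_betw_imp_surj_on[OF f] by (simp add: Plus_def image_Un image_image comp_def)
  qed (use assms in auto)
  then show ?thesis using that by blast
qed

text \<open>
  The unit \<open>n\<close>-cube in the larger space is an isometric image of the unit cube of \<open>n\<close>-space; so the normalization
  in \<open>area\<close> is the constant of the area formula.
\<close>

lemma hausdorff_unit_cube:
  assumes "CARD('k) = n" "CARD('m) = n + 1"
  shows "hausdorff_measure n (unit_cube n :: (real ^ 'm::{finite,linorder}) set) =
    ennreal (cube_const TYPE(real ^ 'k::{finite,wellorder}))"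
proof -
  obtain \<sigma> where \<sigma>: "bij_betw \<sigma> {0..<n} (UNIV :: 'k set)"
    using ex_bij_betw_nat_finite[of "UNIV :: 'k set"] assms(1) by auto
  define pos where "pos = the_inv_into {..<CARD('m)} (nth_index :: nat \<Rightarrow> 'm)"
  have pos: "pos (nth_index j) = j" if "j < CARD('m)" for j
    unfolding pos_def by (rule the_inv_into_f_f[OF bij_betw_imp_inj_on[OF nth_index_bij]]) (use that in simp)
  define \<iota> :: "real ^ 'k::{finite,wellorder} \<Rightarrow> real ^ 'm::{finite,linorder}" where
    "\<iota> = (\<lambda>v. \<chi> i. if pos i < n then v $ \<sigma> (pos i) else 0)"
  have \<iota>: "\<iota> v $ nth_index j = (if j < n then v $ \<sigma> j else 0)" if "j < CARD('m)" for v j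
    using pos[OF that] by (simp add: \<iota>_def)
  have inner: "\<iota> v \<bullet> \<iota> v = v \<bullet> v" for v
  proof -
    have "\<iota> v \<bullet> \<iota> v = (\<Sum>j<Suc n. \<iota> v $ nth_index j * \<iota> v $ nth_index j)"
      using assms(2) by (simp add: inner_eq_sum_nth_index)
    also have "\<dots> = (\<Sum>j<n. v $ \<sigma> j * v $ \<sigma> j)"
      using assms(2) by (simp add: \<iota>)
    also have "\<dots> = (\<Sum>k\<in>UNIV. v $ k * v $ k)"
      using sum.reindex_bij_betw[OF \<sigma>, of "\<lambda>k. v $ k * v $ k"] by (simp add: lessThan_atLeast0)
    finally show ?thesis by (simp add: inner_vec_def)
  qed
  have diff: "\<iota> u - \<iota> v = \<iota> (u - v)" for u v
    by (simp add: \<iota>_def Finite_Cartesian_Product.vec_eq_iff)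
  have iso: "norm (\<iota> u - \<iota> v) = norm (u - v)" for u v
    unfolding diff norm_eq_sqrt_inner inner ..
  have box: "v \<in> cbox 0 One \<longleftrightarrow> (\<forall>k. 0 \<le> v $ k \<and> v $ k \<le> 1)" for v :: "real ^ 'k::{finite,wellorder}"
  proof -
    have "v \<in> cbox 0 One \<longleftrightarrow> (\<forall>b\<in>Basis. 0 \<le> v \<bullet> b \<and> v \<bullet> b \<le> 1)" by (auto simp: mem_box)
    then show ?thesis by (auto simp: Basis_vec_def inner_axis)
  qed
  have "unit_cube n = \<iota> ` cbox 0 One"
  proof (rule equalityI; rule subsetI)
    fix x :: "real ^ 'm::{finite,linorder}" assume x: "x \<in> unit_cube n"
    have xj: "x $ nth_index j \<in> (if j < n then {0..1} else {0})" if "j < CARD('m)" for j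
      using x that unfolding unit_cube_def by blast
    define v where "v = (\<chi> k. x $ nth_index (the_inv_into {0..<n} \<sigma> k))"
    have v: "v $ \<sigma> j = x $ nth_index j" if "j < n" for j
      using that bij_betw_imp_inj_on[OF \<sigma>] by (simp add: v_def the_inv_into_f_f)
    have "\<iota> v $ i = x $ i" for i
    proof -
      obtain j where j: "j < CARD('m)" "i = nth_index j"
        using bij_betw_imp_surj_on[OF nth_index_bij] by (metis UNIV_I imageE lessThan_iff)
      then show ?thesis using \<iota>[OF j(1)] v[of j] xj[OF j(1)] by auto
    qed
    then have "\<iota> v = x" by (simp add: Finite_Cartesian_Product.vec_eq_iff)
    moreover have "v \<in> cbox 0 One" unfolding box
    proof
      fix k
      obtain j where j: "j < n" "k = \<sigma> j" using bij_betw_imp_surj_on[OF \<sigma>] by (metis UNIV_I imageE atLeastLessThan_iff)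
      then show "0 \<le> v $ k \<and> v $ k \<le> 1" using xj[of j] v[of j] assms(2) by auto
    qed
    ultimately show "x \<in> \<iota> ` cbox 0 One" by blast
  next
    fix x assume "x \<in> \<iota> ` cbox 0 One"
    then obtain v where v: "x = \<iota> v" "\<forall>k. 0 \<le> v $ k \<and> v $ k \<le> 1" using box by blast
    show "x \<in> unit_cube n" unfolding unit_cube_def
    proof (intro CollectI allI impI)
      fix i assume "i < CARD('m)"
      then show "x $ nth_index i \<in> (if i < n then {0..1} else {0})"
        using v by (simp add: \<iota>)
    qed
  qed
  then have "hausdorff_measure n (unit_cube n :: (real ^ 'm::{finite,linorder}) set) = hausdorff_measure n (cbox 0 One :: (real ^ 'k::{finite,wellorder}) set)"
    using hausdorff_isometric_image[of "cbox 0 One" \<iota> n] iso by simp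
  then show ?thesis using cube_const(2)[where 'a = "real ^ 'k::{finite,wellorder}"] assms(1) by simp
qed

context simplex_param
begin

lemma linear_tangent_map: "linear (tangent_map u x)"
  by (rule linearI)
     (simp_all add: tangent_map_def scaleR_add_left sum.distrib scaleR_add_right scaleR_sum_right distrib_right mult.assoc)

text \<open>
  The columns of \<open>mat_of x\<close> are either independent, with a positive Gram determinant, or dependent, with a
  singular Gram matrix.
\<close>

lemma gram_sqrt_mat_of_nonneg: "gram_sqrt (mat_of x) \<ge> 0"
proof -
  let ?L = "tangent_map (\<lambda>_. 1) x"
  have "gram_jacobian ?L \<ge> 0"
  proof (cases "inj ?L")
    case True
    then show ?thesis using gram_jacobian_pos[OF linear_tangent_map True] by simp
  next
    case False
    then obtain h where h: "h \<noteq> 0" "?L h = 0"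
      using linear_injective_0[OF linear_tangent_map] by blast
    have "gram ?L *v h = 0"
    proof -
      have "(gram ?L *v h) $ i = ?L (axis i 1) \<bullet> ?L h" for i
      proof -
        have "?L h = ?L (\<Sum>j\<in>UNIV. h $ j *\<^sub>R axis j 1)"
          by (simp add: basis_expansion[of h, unfolded scalar_mult_eq_scaleR])
        also have "\<dots> = (\<Sum>j\<in>UNIV. h $ j *\<^sub>R ?L (axis j 1))"
          by (simp add: linear_sum[OF linear_tangent_map] linear_cmul[OF linear_tangent_map])
        finally show ?thesis
          by (simp add: gram_def matrix_vector_mult_def inner_sum_right mult.commute)
      qed
      then show ?thesis using h(2) by (simp add: Finite_Cartesian_Product.vec_eq_iff)
    qed
    then have "\<not> inj ((*v) (gram ?L))" using h(1) by (metis injD matrix_vector_mult_0_right)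
    then have "Determinants.det (gram ?L) = 0"
      using det_nz_iff_inj[of "(*v) (gram ?L)"] by (simp add: matrix_vector_mul_linear)
    then show ?thesis by (simp add: gram_jacobian_def)
  qed
  then show ?thesis using tangent_map_jacobian[of "\<lambda>_. 1" x] by simp
qed

end

lemma ex_param:
  fixes \<gamma> :: "real \<Rightarrow> real ^ 'm::{finite,linorder}"
  assumes n: "n \<ge> 1" "CARD('m) = n + 1" and F: "simplex_family \<gamma> a b P M p0 e"
  obtains \<kappa> \<xi> :: "nat \<Rightarrow> 'm pred_index" where "simplex_param \<gamma> a b P M p0 e \<kappa> \<xi>"
proof -
  interpret simplex_family \<gamma> a b P M p0 e by (rule F)
  have "CARD('m pred_index) = n" using n by (simp add: card_pred_index)
  then have "card (P - {p0}) + card M = CARD('m pred_index)"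
    using dim_eq n(2) card.remove[OF finite_P p0] by simp
  then obtain \<kappa> \<xi> :: "nat \<Rightarrow> 'm pred_index" where "coordinate_split (P - {p0}) M \<kappa> \<xi>"
    using ex_coordinate_split[of "P - {p0}" M] finite_P finite_M by (metis finite_Diff)
  then show ?thesis using that F simplex_param.intro by blast
qed

lemma family_integrand:
  fixes \<gamma> :: "real \<Rightarrow> real ^ 'm::{finite,linorder}"
  assumes n: "n \<ge> 1" "CARD('m) = n + 1" and F: "simplex_family \<gamma> a b P M p0 e"
  defines "g \<equiv> \<lambda>x. gram_sqrt (simplex_family.mat_of \<gamma> a b P M p0 e x)"
  shows "(\<lambda>x. ennreal (g x) * indicator (ordered_points M a b) x) \<in> borel_measurable (lebesgue_on_vars M)"
    and "g x \<ge> 0"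
proof -
  obtain \<kappa> \<xi> :: "nat \<Rightarrow> 'm pred_index" where "simplex_param \<gamma> a b P M p0 e \<kappa> \<xi>"
    using ex_param[OF n F] by blast
  then interpret simplex_param \<gamma> a b P M p0 e \<kappa> \<xi> .
  show "(\<lambda>x. ennreal (g x) * indicator (ordered_points M a b) x) \<in> borel_measurable (lebesgue_on_vars M)"
    unfolding g_def lebesgue_on_vars_def by (rule integrand_measurable)
  show "g x \<ge> 0" unfolding g_def by (rule gram_sqrt_mat_of_nonneg)
qed

text \<open>
  The closed families cover the frontier, and the generic parts of the families lie in it and are disjoint. The
  difference between closed and generic parts is a null set.
\<close>

theorem area_two_families:
  fixes \<gamma> :: "real \<Rightarrow> real ^ 'm::{finite,linorder}"
  assumes n: "n \<ge> 1" "CARD('m) = n + 1"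
    and A: "simplex_family \<gamma> a b P M p0 e" and B: "simplex_family \<gamma> a b P' M' p0' e'"
    and disj: "card (e ` (P - M) \<union> e' ` (P' - M')) + card M + card M' \<le> Suc CARD('m)"
      "e ` (P - M) \<noteq> e' ` (P' - M')"
    and cover: "\<And>Z. \<lbrakk>finite Z; Z \<subseteq> {a..b}; card Z + card (Z \<inter> {a<..<b}) \<le> CARD('m)\<rbrakk> \<Longrightarrow>
      card (Z - e ` (P - M)) \<le> card M \<or> card (Z - e' ` (P' - M')) \<le> card M'"
  defines "F \<equiv> \<lambda>x. gram_sqrt (simplex_family.mat_of \<gamma> a b P M p0 e x)"
    and "F' \<equiv> \<lambda>x. gram_sqrt (simplex_family.mat_of \<gamma> a b P' M' p0' e' x)"
  shows "area n (frontier (convex hull (\<gamma> ` {a..b}))) =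
      ennreal (1 / fact n) * (\<integral>\<^sup>+x\<in>ordered_points M a b. ennreal (F x) \<partial>lebesgue_on_vars M) +
      ennreal (1 / fact n) * (\<integral>\<^sup>+x\<in>ordered_points M' a b. ennreal (F' x) \<partial>lebesgue_on_vars M')"
proof -
  have k: "CARD('m pred_index) = n" using n by (simp add: card_pred_index)
  obtain \<kappa> \<xi> :: "nat \<Rightarrow> 'm pred_index" where pA: "simplex_param \<gamma> a b P M p0 e \<kappa> \<xi>"
    using ex_param[OF n A] by blast
  obtain \<kappa>' \<xi>' :: "nat \<Rightarrow> 'm pred_index" where pB: "simplex_param \<gamma> a b P' M' p0' e' \<kappa>' \<xi>'"
    using ex_param[OF n B] by blast
  interpret A: simplex_param \<gamma> a b P M p0 e \<kappa> \<xi> by (rule pA)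
  interpret B: simplex_param \<gamma> a b P' M' p0' e' \<kappa>' \<xi>' by (rule pB)
  let ?H = "hausdorff_measure n :: (real ^ 'm::{finite,linorder}) set \<Rightarrow> ennreal"
  let ?c = "ennreal (cube_const TYPE(real ^ 'm pred_index))"
  let ?I = "\<integral>\<^sup>+x\<in>ordered_points M a b. ennreal (F x) \<partial>lebesgue_on_vars M"
  let ?I' = "\<integral>\<^sup>+x\<in>ordered_points M' a b. ennreal (F' x) \<partial>lebesgue_on_vars M'"
  have HA: "?H (A.param ` A.\<Omega>) = ?c * (ennreal (1 / fact n) * ?I)"
    using A.hausdorff_param_\<Omega> unfolding k F_def .
  have HB: "?H (B.param ` B.\<Omega>) = ?c * (ennreal (1 / fact n) * ?I')"
    using B.hausdorff_param_\<Omega> unfolding k F'_def .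
  have upper: "?H (frontier A.K) \<le> ?H (A.param ` A.\<Omega>) + ?H (B.param ` B.\<Omega>)"
  proof -
    have "frontier A.K \<subseteq> A.param ` A.C \<union> B.param ` B.C"
    proof
      fix p assume "p \<in> frontier A.K"
      then show "p \<in> A.param ` A.C \<union> B.param ` B.C"
      proof (rule A.frontier_point_supported)
        fix Z \<mu>
        assume Z: "finite Z" "Z \<subseteq> {a..b}" "card Z + card (Z \<inter> {a<..<b}) \<le> CARD('m)"
          and \<mu>: "\<And>z. z \<in> Z \<Longrightarrow> \<mu> z \<ge> 0" "sum \<mu> Z = 1" and p: "p = (\<Sum>z\<in>Z. \<mu> z *\<^sub>R \<gamma> z)"
        consider "card (Z - e ` (P - M)) \<le> card M" | "card (Z - e' ` (P' - M')) \<le> card M'"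
          using cover[OF Z] by blast
        then show ?thesis
        proof cases
          case 1
          obtain w x where "A.admissible w x" "A.hull_point w x = p"
            using A.admissible_covers[OF Z(1,2) 1 \<mu>] unfolding p by blast
          then show ?thesis using A.param_surj by blast
        next
          case 2
          obtain w x where "B.admissible w x" "B.hull_point w x = p"
            using B.admissible_covers[OF Z(1,2) 2 \<mu>] unfolding p by blast
          then show ?thesis using B.param_surj by blast
        qed
      qed
    qed
    then have "?H (frontier A.K) \<le> ?H (A.param ` A.C \<union> B.param ` B.C)" by (rule hausdorff_mono)
    also have "\<dots> \<le> ?H (A.param ` A.C) + ?H (B.param ` B.C)" by (rule hausdorff_subadditive[OF n(1)])
    also have "\<dots> \<le> ?H (A.param ` A.\<Omega>) + ?H (B.param ` B.\<Omega>)"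
      using A.hausdorff_param_C B.hausdorff_param_C unfolding k by (rule add_mono)
    finally show ?thesis .
  qed
  have lower: "?H (A.param ` A.\<Omega>) + ?H (B.param ` B.\<Omega>) \<le> ?H (frontier A.K)"
  proof -
    obtain L where L: "L > 0" "\<And>v v'. \<lbrakk>v \<in> A.C; v' \<in> A.C\<rbrakk> \<Longrightarrow> norm (A.param v - A.param v') \<le> L * norm (v - v')"
      by (rule A.param_lipschitz) blast
    obtain L' where L': "L' > 0" "\<And>v v'. \<lbrakk>v \<in> B.C; v' \<in> B.C\<rbrakk> \<Longrightarrow> norm (B.param v - B.param v') \<le> L' * norm (v - v')"
      by (rule B.param_lipschitz) blast
    have "A.param ` A.\<Omega> \<inter> B.param ` B.\<Omega> = {}"
    proof (rule ccontr)
      assume "\<not> ?thesis"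
      then obtain v v' where "v \<in> A.\<Omega>" "v' \<in> B.\<Omega>" "A.param v = B.param v'" by blast
      then show False
        using generic_disjoint[OF A B disj, of "A.wts v" "A.pts v" "B.wts v'" "B.pts v'"]
        unfolding A.\<Omega>_def B.\<Omega>_def A.param_def B.param_def by blast
    qed
    have "?H (A.param ` A.\<Omega> \<union> B.param ` B.\<Omega>) = ?H (A.param ` A.\<Omega>) + ?H (B.param ` B.\<Omega>)"
    proof -
      have bA: "bounded A.\<Omega>" using A.bounded_C A.\<Omega>_sub_C bounded_subset by blast
      have bB: "bounded B.\<Omega>" using B.bounded_C B.\<Omega>_sub_C bounded_subset by blast
      have mA: "A.\<Omega> \<in> lmeasurable" using bA A.open_\<Omega> by (rule lmeasurable_open)
      have mB: "B.\<Omega> \<in> lmeasurable" using bB B.open_\<Omega> by (rule lmeasurable_open)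
      have lA: "norm (A.param v - A.param v') \<le> max L L' * norm (v - v')" if "v \<in> A.\<Omega>" "v' \<in> A.\<Omega>" for v v'
        using L(2)[of v v'] that A.\<Omega>_sub_C mult_right_mono[of L "max L L'" "norm (v - v')"] by fastforce
      have lB: "norm (B.param v - B.param v') \<le> max L L' * norm (v - v')" if "v \<in> B.\<Omega>" "v' \<in> B.\<Omega>" for v v'
        using L'(2)[of v v'] that B.\<Omega>_sub_C mult_right_mono[of L' "max L L'" "norm (v - v')"] by fastforce
      have "max L L' > 0" using L(1) by simp
      from hausdorff_disjoint_images[OF mA bA mB bB this lA lB \<open>A.param ` A.\<Omega> \<inter> B.param ` B.\<Omega> = {}\<close>]
      show ?thesis by (simp add: k)
    qed
    moreover have "A.param ` A.\<Omega> \<union> B.param ` B.\<Omega> \<subseteq> frontier A.K"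
      using A.generic_in_frontier B.generic_in_frontier
      unfolding A.\<Omega>_def B.\<Omega>_def A.param_def B.param_def by blast
    ultimately show ?thesis using hausdorff_mono by metis
  qed
  have H: "?H (frontier A.K) = (ennreal (1 / fact n) * ?I + ennreal (1 / fact n) * ?I') * ?c"
    using antisym[OF upper lower] unfolding HA HB by (simp add: distrib_left mult.commute)
  have "?H (unit_cube n) = ?c" by (rule hausdorff_unit_cube[OF k n(2)])
  moreover have "?c \<noteq> 0" "?c \<noteq> \<infinity>" using cube_const(1)[where 'a = "real ^ 'm pred_index"] by auto
  ultimately show "area n (frontier (convex hull (\<gamma> ` {a..b}))) = ennreal (1 / fact n) * ?I + ennreal (1 / fact n) * ?I'"
    unfolding area_def H by (simp add: ennreal_mult_divide_eq)
qed

lemma card_split_ends: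
  fixes a b :: real
  assumes "finite Z" "Z \<subseteq> {a..b}" "a < b"
  shows "card Z = card (Z \<inter> {a<..<b}) + (if a \<in> Z then 1 else 0) + (if b \<in> Z then 1 else 0)"
proof -
  have Z: "Z = (Z \<inter> {a<..<b}) \<union> (Z \<inter> {a, b})" using assms(2) by fastforce
  have "card Z = card (Z \<inter> {a<..<b}) + card (Z \<inter> {a, b})"
    by (subst Z, rule card_Un_disjoint) (use assms(1) in auto)
  also have "card (Z \<inter> {a, b}) = (if a \<in> Z then 1 else 0) + (if b \<in> Z then 1 else 0)"
    using assms(3) by (simp add: Int_insert_right)
  finally show ?thesis by simp
qed

text \<open>
  The last step is counting. Let \<open>i\<close> be the number of interior points of \<open>Z\<close> and \<open>j\<close> the number of ends of the
  interval in \<open>Z\<close>, with \<open>2 * i + j \<le> n + 1\<close>. For \<open>n = 2 l\<close>, the families with fixed vertex \<open>a\<close> and with fixed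
  vertex \<open>b\<close> serve the cases \<open>a \<in> Z\<close> and \<open>a \<notin> Z\<close>. For \<open>n = 2 l - 1\<close>, the family with both ends fixed serves \<open>j = 2\<close>,
  and the family without fixed vertices the other cases.
\<close>

theorem corollary2p8:
  fixes \<gamma> :: "real \<Rightarrow> real ^ 'm::{finite,linorder}"
    and a b :: real and n :: nat
  assumes "n \<ge> 1" and "CARD('m) = n + 1" and "a < b"
    and "C_k_on 1 \<gamma> {a..b}" and "C_k_on (n + 1) \<gamma> {a<..<b}"
    and "totally_positive_torsion \<gamma> a b"
  shows
    "(\<forall>l. n = 2 * l \<longrightarrow>
        area n (frontier (convex hull (\<gamma> ` {a..b}))) =
          ennreal (1 / fact n) *
          (\<integral>\<^sup>+x\<in>ordered_points {1..l} a b.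
             ennreal (gram_sqrt (S_mat \<gamma> a b l a x) + gram_sqrt (S_mat \<gamma> a b l b x))
           \<partial>lebesgue_on_vars {1..l})) \<and>
     (\<forall>l. n = 2 * l - 1 \<longrightarrow>
        area n (frontier (convex hull (\<gamma> ` {a..b}))) =
          ennreal (1 / fact n) *
          (\<integral>\<^sup>+x\<in>ordered_points {2..l} a b.
             ennreal (gram_sqrt (Psi_mat \<gamma> a b l x)) \<partial>lebesgue_on_vars {2..l}) +
          ennreal (1 / fact n) *
          (\<integral>\<^sup>+x\<in>ordered_points {1..l} a b.
             ennreal (gram_sqrt (Phi_mat \<gamma> a b l x)) \<partial>lebesgue_on_vars {1..l}))"
proof (intro conjI allI impI)
  note n = assms(1,2)
  have tc: "torsion_curve \<gamma> a b" by (intro torsion_curve.intro assms)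
  have ivl: "sorted_list_of_set {k..l} = [k..<l + 1]" for k l :: nat
    using sorted_list_of_set_range[of k "l + 1"] by (simp add: atLeastLessThanSuc_atLeastAtMost)
  {
    fix l assume l: "n = 2 * l"
    then have l1: "l \<ge> 1" using n(1) by simp
    have P: "{0..l} - {1..l} = {0}" "{0..l} - {0} = {1..l}" by auto
    have fam: "simplex_family \<gamma> a b {0..l} {1..l} 0 (\<lambda>_. r)" if "r \<in> {a, b}" for r
      by (intro simplex_family.intro tc simplex_family_axioms.intro) (use that n l P in auto)
    have mat: "simplex_family.mat_of \<gamma> a b {0..l} {1..l} 0 (\<lambda>_. r) x = S_mat \<gamma> a b l r x" if "r \<in> {a, b}" for r x
    proof -
      interpret simplex_family \<gamma> a b "{0..l}" "{1..l}" 0 "\<lambda>_. r" by (rule fam[OF that])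
      have "map (\<lambda>i. \<gamma> (node x i) - \<gamma> (node x 0)) [1..<l + 1] = map (\<lambda>i. \<gamma> (x i) - \<gamma> r) [1..<l + 1]"
        unfolding node_def by (rule map_cong) auto
      then show ?thesis unfolding mat_of_def S_mat_def P(2) ivl by (simp only:)
    qed
    have disj1: "card ((\<lambda>_. a) ` ({0..l} - {1..l}) \<union> (\<lambda>_. b) ` ({0..l} - {1..l})) + card {1..l} + card {1..l} \<le> Suc CARD('m)"
      unfolding P using n l by (simp add: card_insert_if)
    have disj2: "(\<lambda>_. a) ` ({0..l} - {1..l}) \<noteq> (\<lambda>_. b) ` ({0..l} - {1..l})"
      unfolding P using assms(3) by simp
    have cover: "card (Z - (\<lambda>_. a) ` ({0..l} - {1..l})) \<le> card {1..l} \<or> card (Z - (\<lambda>_. b) ` ({0..l} - {1..l})) \<le> card {1..l}"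
      if Z: "finite Z" "Z \<subseteq> {a..b}" "card Z + card (Z \<inter> {a<..<b}) \<le> CARD('m)" for Z
    proof (cases "a \<in> Z")
      case True
      then have "card (Z - {a}) \<le> l"
        using card_split_ends[OF Z(1,2) assms(3)] Z n l by (simp split: if_splits)
      then show ?thesis unfolding P by simp
    next
      case False
      then have "card (Z - {b}) \<le> l"
        using card_split_ends[OF Z(1,2) assms(3)] Z n l by (simp add: card_Diff_singleton_if split: if_splits)
      then show ?thesis unfolding P by simp
    qed
    have fa: "simplex_family \<gamma> a b {0..l} {1..l} 0 (\<lambda>_. a)" and fb: "simplex_family \<gamma> a b {0..l} {1..l} 0 (\<lambda>_. b)"
      using fam by auto
    have ma: "simplex_family.mat_of \<gamma> a b {0..l} {1..l} 0 (\<lambda>_. a) x = S_mat \<gamma> a b l a x"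
      and mb: "simplex_family.mat_of \<gamma> a b {0..l} {1..l} 0 (\<lambda>_. b) x = S_mat \<gamma> a b l b x" for x
      using mat by auto
    let ?ga = "\<lambda>x. ennreal (gram_sqrt (S_mat \<gamma> a b l a x)) * indicator (ordered_points {1..l} a b) x"
    let ?gb = "\<lambda>x. ennreal (gram_sqrt (S_mat \<gamma> a b l b x)) * indicator (ordered_points {1..l} a b) x"
    have "area n (frontier (convex hull (\<gamma> ` {a..b}))) =
        ennreal (1 / fact n) * integral\<^sup>N (lebesgue_on_vars {1..l}) ?ga +
        ennreal (1 / fact n) * integral\<^sup>N (lebesgue_on_vars {1..l}) ?gb"
      using area_two_families[OF n fa fb disj1 disj2 cover] unfolding ma mb .
    also have "\<dots> = ennreal (1 / fact n) * (\<integral>\<^sup>+x. ?ga x + ?gb x \<partial>lebesgue_on_vars {1..l})"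
      using nn_integral_add[OF family_integrand(1)[OF n fa] family_integrand(1)[OF n fb]]
      unfolding ma mb by (simp add: distrib_left)
    also have "(\<integral>\<^sup>+x. ?ga x + ?gb x \<partial>lebesgue_on_vars {1..l}) =
        (\<integral>\<^sup>+x\<in>ordered_points {1..l} a b.
             ennreal (gram_sqrt (S_mat \<gamma> a b l a x) + gram_sqrt (S_mat \<gamma> a b l b x)) \<partial>lebesgue_on_vars {1..l})"
      using family_integrand(2)[OF n fa] family_integrand(2)[OF n fb] unfolding ma mb
      by (intro nn_integral_cong) (simp add: ennreal_plus distrib_right)
    finally show "area n (frontier (convex hull (\<gamma> ` {a..b}))) =
          ennreal (1 / fact n) *
          (\<integral>\<^sup>+x\<in>ordered_points {1..l} a b.
             ennreal (gram_sqrt (S_mat \<gamma> a b l a x) + gram_sqrt (S_mat \<gamma> a b l b x))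
           \<partial>lebesgue_on_vars {1..l})" .
  }
  {
    fix l assume l: "n = 2 * l - 1"
    then have l1: "l \<ge> 1" using n(1) by simp
    let ?e = "\<lambda>i::nat. if i = 0 then a else b"
    have P: "{0..l} - {2..l} = {0, 1}" "{0..l} - {0} = {1..l}" "{1..l} - {1} = {2..l}" "{1..l} - {1..l} = {}"
      using l1 by auto
    have img: "?e ` {0, 1} = {a, b}" by auto
    have fa: "simplex_family \<gamma> a b {0..l} {2..l} 0 ?e"
      by (intro simplex_family.intro tc simplex_family_axioms.intro)
         (use n l l1 P assms(3) in \<open>auto simp: inj_on_def\<close>)
    have fb: "simplex_family \<gamma> a b {1..l} {1..l} 1 ?e"
      by (intro simplex_family.intro tc simplex_family_axioms.intro)
         (use n l l1 in auto)
    have ma: "simplex_family.mat_of \<gamma> a b {0..l} {2..l} 0 ?e x = Psi_mat \<gamma> a b l x" for x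
    proof -
      interpret simplex_family \<gamma> a b "{0..l}" "{2..l}" 0 ?e by (rule fa)
      have up: "[1..<l + 1] = 1 # [2..<l + 1]" using l1 by (simp add: upt_conv_Cons numeral_2_eq_2)
      have "map (\<lambda>i. \<gamma> (node x i) - \<gamma> (node x 0)) [2..<l + 1] = map (\<lambda>i. \<gamma> (x i) - \<gamma> a) [2..<l + 1]"
        unfolding node_def by (rule map_cong) auto
      moreover have "\<gamma> (node x 1) - \<gamma> (node x 0) = \<gamma> b - \<gamma> a" by (simp add: node_def)
      ultimately have "map (\<lambda>i. \<gamma> (node x i) - \<gamma> (node x 0)) [1..<l + 1] =
          [\<gamma> b - \<gamma> a] @ map (\<lambda>i. \<gamma> (x i) - \<gamma> a) [2..<l + 1]"
        unfolding up by simp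
      then show ?thesis unfolding mat_of_def Psi_mat_def P(2) ivl by (simp only: append_assoc)
    qed
    have mb: "simplex_family.mat_of \<gamma> a b {1..l} {1..l} 1 ?e x = Phi_mat \<gamma> a b l x" for x
    proof -
      interpret simplex_family \<gamma> a b "{1..l}" "{1..l}" 1 ?e by (rule fb)
      have "map (\<lambda>i. \<gamma> (node x i) - \<gamma> (node x 1)) [2..<l + 1] = map (\<lambda>i. \<gamma> (x i) - \<gamma> (x 1)) [2..<l + 1]"
        unfolding node_def by (rule map_cong) (use l1 in auto)
      then show ?thesis unfolding mat_of_def Phi_mat_def P(3) ivl by (simp only:)
    qed
    have disj1: "card (?e ` ({0..l} - {2..l}) \<union> ?e ` ({1..l} - {1..l})) + card {2..l} + card {1..l} \<le> Suc CARD('m)"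
      unfolding P img using n l l1 assms(3) by simp
    have disj2: "?e ` ({0..l} - {2..l}) \<noteq> ?e ` ({1..l} - {1..l})"
      unfolding P img by simp
    have cover: "card (Z - ?e ` ({0..l} - {2..l})) \<le> card {2..l} \<or> card (Z - ?e ` ({1..l} - {1..l})) \<le> card {1..l}"
      if Z: "finite Z" "Z \<subseteq> {a..b}" "card Z + card (Z \<inter> {a<..<b}) \<le> CARD('m)" for Z
    proof (cases "a \<in> Z \<and> b \<in> Z")
      case True
      have "Z - {a, b} = Z \<inter> {a<..<b}" using Z(2) by fastforce
      moreover have "card (Z \<inter> {a<..<b}) \<le> l - 1"
        using True card_split_ends[OF Z(1,2) assms(3)] Z(3) n l l1 by simp
      ultimately show ?thesis unfolding P img by simp
    next
      case False
      then have "card Z \<le> l"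
        using card_split_ends[OF Z(1,2) assms(3)] Z(3) n l l1 by (auto split: if_splits)
      then show ?thesis unfolding P by simp
    qed
    show "area n (frontier (convex hull (\<gamma> ` {a..b}))) =
          ennreal (1 / fact n) *
          (\<integral>\<^sup>+x\<in>ordered_points {2..l} a b.
             ennreal (gram_sqrt (Psi_mat \<gamma> a b l x)) \<partial>lebesgue_on_vars {2..l}) +
          ennreal (1 / fact n) *
          (\<integral>\<^sup>+x\<in>ordered_points {1..l} a b.
             ennreal (gram_sqrt (Phi_mat \<gamma> a b l x)) \<partial>lebesgue_on_vars {1..l})"
      using area_two_families[OF n fa fb disj1 disj2 cover] unfolding ma mb .
  }
qed

end
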